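(* Let $G=(V,E)$ be a connected graph of bounded degree (i.e. $\sup_{v\in V}\deg(v)<\infty$), and let $k\in\mathbb N=\{1,2,\dots\}$. (i) If the simple random walk (SRW) on $G$ is transient, then the non-backtracking random walk (NBRW) on $G$ is also transient. (ii) If there exists some $R>0$ such that every ball of radius $R$ in $G$ contains a cycle, then the SRW on $G$ is transient if and only if the NBRW on $G$ is transient. (iii) Suppose that there exists some $R>0$ such that for every $\gamma,\gamma'\in\mathcal P_k^{\mathrm e}$ which contain at least one common vertex, the edge $k$-NBRW can reach $\gamma'$ from $\gamma$ in at most $R$ steps, and suppose that the edge $k$-NBRW on $G$ cannot get stuck. Then the SRW on $G$ is transient if and only if the edge $k$-NBRW on $G$ is transient. (iv) Suppose that $G$ is vertex-transitive, that there exists some $R>0$ such that for every $\gamma,\gamma'\in\mathcal P_k^{\mathrm v}$ which contain at least one common vertex, the vertex $k$-NBRW can reach $\gamma'$ from $\gamma$ in at most $R$ steps, and that the vertex $k$-NBRW on $G$ cannot get stuck. If the SRW on $G$ is transient, then the vertex $k$-NBRW on $G$ is also transient.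
   Context: Graphs are simple (no loops, no multiple edges) and locally finite; $x\sim y$ means $\{x,y\}\in E$. SRW: the Markov chain on $V$ with $P(x,y)=\mathbf 1\{x\sim y\}/\deg(x)$. NBRW $(X_t)_{t\ge 0}$ started from a vertex $u$: the first step is a SRW step from $u$; given $(X_i)_{i=0}^{t+1}$, $X_{t+2}$ is uniform on $\{z\sim X_{t+1}: z\ne X_t\}$, unless this set is empty, in which case $X_{t+2}=X_t$. Edge $k$-NBRW: given $(X_i)_{i=0}^t$, $X_{t+1}$ is uniform on the set of $z\sim X_t$ such that $\{z,X_t\}\notin\{\{X_{i-1},X_i\}: t-k<i\le t,\ i\ge 1\}$. Vertex $k$-NBRW: given $(X_i)_{i=0}^t$, $X_{t+1}$ is uniform on the set of $z\sim X_t$ such that $z\notin\{X_i: t-k\le i\le t,\ i\ge 0\}$. In either case, if the set is empty the walk is said to be stuck, and then $X_{t+1}$ is uniform over all neighbors of $X_t$. Let $\mathcal P_k$ be the set of all paths $(x_0,\dots,x_k)\in V^{k+1}$ with $\{x_{i-1},x_i\}\in E$ for $1\le i\le k$. Let $\mathcal P_k^{\mathrm e}$ be the set of $\gamma\in\mathcal P_k$ crossing $k$ distinct (undirected) edges, and $\mathcal P_k^{\mathrm v}$ the set of $\gamma\in\mathcal P_k$ having $k+1$ distinct vertices. Markov chain representation on paths: from $\gamma=(\gamma_0,\dots,\gamma_k)\in\mathcal P_k$ the chain moves to $\gamma(v):=(\gamma_1,\dots,\gamma_k,v)$, where for the edge $k$-NBRW $v$ is uniform among the neighbors of $\gamma_k$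 such that the edge $\{\gamma_k,v\}$ is not crossed by $\gamma$, and for the vertex $k$-NBRW $v$ is uniform among the neighbors of $\gamma_k$ not contained in $\gamma$; if there is no such $v$ (the walk is stuck), $v$ is uniform among all neighbors of $\gamma_k$. "The walk can reach $\gamma'$ from $\gamma$ in at most $R$ steps" means that the $n$-step transition probability of this chain from $\gamma$ to $\gamma'$ is positive for some $n\le R$. "The edge (respectively, vertex) $k$-NBRW on $G$ cannot get stuck" means that the chain is not stuck at any $\gamma\in\mathcal P_k^{\mathrm e}$ (respectively, $\gamma\in\mathcal P_k^{\mathrm v}$). Recurrence/transience: a vertex $v$ is recurrent for a given type of walk if the walk started from $v$ returns to $v$ infinitely often almost surely; otherwise it is transient for that walk. The walk on $G$ is recurrent (respectively, transient) if all vertices are recurrent (respectively, transient) for it. The paper notes that in the cases considered here this is equivalent to the usual notion of recurrence/transience for the Markov chain representation. *)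

theory Defs
  imports "HOL-Probability.Probability"
begin

section \<open>Graphs\<close>

text \<open>
  A graph is given by its vertex set \<open>V\<close> and its set \<open>E\<close> of undirected edges, each edge being
  a two-element set of vertices.
\<close>

definition simple_graph :: "'a set \<Rightarrow> 'a set set \<Rightarrow> bool" where
  "simple_graph V E \<longleftrightarrow> (\<forall>e\<in>E. e \<subseteq> V \<and> card e = 2)"

definition nbrs :: "'a set set \<Rightarrow> 'a \<Rightarrow> 'a set" where
  "nbrs E x = {y. {x, y} \<in> E}"

definition bounded_degree :: "'a set \<Rightarrow> 'a set set \<Rightarrow> bool" where
  "bounded_degree V E \<longleftrightarrow>
     (\<forall>v\<in>V. finite (nbrs E v)) \<and> bdd_above ((\<lambda>v. card (nbrs E v)) ` V)"

text \<open>A path may repeat vertices and edges; \<open>\<P>\<^sub>k\<close> consists of lists of length \<open>k + 1\<close>.\<close>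

definition paths :: "'a set \<Rightarrow> 'a set set \<Rightarrow> nat \<Rightarrow> 'a list set" where
  "paths V E k =
     {\<gamma>. length \<gamma> = Suc k \<and> set \<gamma> \<subseteq> V \<and> (\<forall>i\<in>{1..k}. {\<gamma> ! (i - 1), \<gamma> ! i} \<in> E)}"

definition path_edges :: "'a list \<Rightarrow> 'a set set" where
  "path_edges \<gamma> = {{\<gamma> ! (i - 1), \<gamma> ! i} |i. 1 \<le> i \<and> i < length \<gamma>}"

definition paths_e :: "'a set \<Rightarrow> 'a set set \<Rightarrow> nat \<Rightarrow> 'a list set" where
  "paths_e V E k = {\<gamma> \<in> paths V E k. card (path_edges \<gamma>) = k}"

definition paths_v :: "'a set \<Rightarrow> 'a set set \<Rightarrow> nat \<Rightarrow> 'a list set" where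
  "paths_v V E k = {\<gamma> \<in> paths V E k. card (set \<gamma>) = k + 1}"

definition connected_graph :: "'a set \<Rightarrow> 'a set set \<Rightarrow> bool" where
  "connected_graph V E \<longleftrightarrow>
     (\<forall>x\<in>V. \<forall>y\<in>V. \<exists>n. \<exists>\<gamma>\<in>paths V E n. hd \<gamma> = x \<and> last \<gamma> = y)"

text \<open>Only meaningful for two vertices joined by a path.\<close>

definition graph_dist :: "'a set \<Rightarrow> 'a set set \<Rightarrow> 'a \<Rightarrow> 'a \<Rightarrow> nat" where
  "graph_dist V E x y = (LEAST n. \<exists>\<gamma>\<in>paths V E n. hd \<gamma> = x \<and> last \<gamma> = y)"

definition graph_ball :: "'a set \<Rightarrow> 'a set set \<Rightarrow> 'a \<Rightarrow> real \<Rightarrow> 'a set" where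
  "graph_ball V E x R = {y\<in>V. real (graph_dist V E x y) \<le> R}"

definition is_cycle :: "'a set set \<Rightarrow> 'a list \<Rightarrow> bool" where
  "is_cycle E c \<longleftrightarrow> length c \<ge> 3 \<and> distinct c \<and>
     (\<forall>i<length c. {c ! i, c ! (Suc i mod length c)} \<in> E)"

definition contains_cycle :: "'a set set \<Rightarrow> 'a set \<Rightarrow> bool" where
  "contains_cycle E S \<longleftrightarrow> (\<exists>c. is_cycle E c \<and> set c \<subseteq> S)"

definition graph_automorphism :: "'a set \<Rightarrow> 'a set set \<Rightarrow> ('a \<Rightarrow> 'a) \<Rightarrow> bool" where
  "graph_automorphism V E \<phi> \<longleftrightarrow>
     bij_betw \<phi> V V \<and> (\<forall>x\<in>V. \<forall>y\<in>V. {\<phi> x, \<phi> y} \<in> E \<longleftrightarrow> {x, y} \<in> E)"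

definition vertex_transitive :: "'a set \<Rightarrow> 'a set set \<Rightarrow> bool" where
  "vertex_transitive V E \<longleftrightarrow> (\<forall>x\<in>V. \<forall>y\<in>V. \<exists>\<phi>. graph_automorphism V E \<phi> \<and> \<phi> x = y)"


section \<open>Random walks with memory\<close>

text \<open>
  A walk is described by its step function: \<open>step t x\<close> is the conditional distribution of the
  position at time \<open>t + 1\<close> given the positions \<open>x 0, \<dots>, x t\<close>.  It must not depend on the values
  of \<open>x\<close> after time \<open>t\<close>.  The law of the whole trajectory is the infinite-horizon measure of the
  Ionescu-Tulcea theorem, whose kernels at time \<open>n\<close> see the coordinates \<open>0, \<dots>, n - 1\<close>.
\<close>

type_synonym 'a step = "nat \<Rightarrow> (nat \<Rightarrow> 'a) \<Rightarrow> 'a pmf"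

definition walk_kernel :: "'a set \<Rightarrow> 'a step \<Rightarrow> 'a \<Rightarrow> nat \<Rightarrow> (nat \<Rightarrow> 'a) \<Rightarrow> 'a measure" where
  "walk_kernel V step u n x = restrict_space
     (measure_pmf (case n of 0 \<Rightarrow> return_pmf u | Suc t \<Rightarrow> step t x)) V"

definition walk_law :: "'a set \<Rightarrow> 'a step \<Rightarrow> 'a \<Rightarrow> (nat \<Rightarrow> 'a) measure" where
  "walk_law V step u = projective_family.lim UNIV
     (Ionescu_Tulcea.CI (walk_kernel V step u) (\<lambda>_. count_space V)) (\<lambda>_. count_space V)"

definition recurrent_vertex :: "'a set \<Rightarrow> 'a step \<Rightarrow> 'a \<Rightarrow> bool" where
  "recurrent_vertex V step v \<longleftrightarrow> (AE x in walk_law V step v. \<exists>\<^sub>\<infinity>t. x t = v)"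

definition transient_walk :: "'a set \<Rightarrow> 'a step \<Rightarrow> bool" where
  "transient_walk V step \<longleftrightarrow> (\<forall>v\<in>V. \<not> recurrent_vertex V step v)"

text \<open>The Ionescu-Tulcea construction applies to every walk that stays in a countable \<open>V\<close>.\<close>

lemma Ionescu_Tulcea_walk_kernel:
  assumes "countable V" "u \<in> V"
    and step: "\<And>t x. (\<And>i. i \<le> t \<Longrightarrow> x i \<in> V) \<Longrightarrow> set_pmf (step t x) \<subseteq> V"
  shows "Ionescu_Tulcea (walk_kernel V step u) (\<lambda>_. count_space V)"
proof -
  have prob: "prob_space (walk_kernel V step u n x)"
    if "x \<in> space (PiM {0..<n} (\<lambda>_. count_space V))" for n x
  proof -
    have sub: "set_pmf (case n of 0 \<Rightarrow> return_pmf u | Suc t \<Rightarrow> step t x) \<subseteq> V"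
    proof (cases n)
      case 0
      then show ?thesis using assms(2) by simp
    next
      case (Suc t)
      then have "x i \<in> V" if "i \<le> t" for i
        using that \<open>x \<in> space _\<close> by (auto simp: space_PiM PiE_iff)
      then show ?thesis using Suc step by simp
    qed
    then have "emeasure (measure_pmf (case n of 0 \<Rightarrow> return_pmf u | Suc t \<Rightarrow> step t x)) V = 1"
      by (simp add: measure_pmf.emeasure_eq_1_AE AE_measure_pmf_iff subset_iff)
    then show ?thesis
      unfolding walk_kernel_def
      by (intro prob_spaceI) (simp add: emeasure_restrict_space space_restrict_space)
  qed
  have sets_W: "sets (walk_kernel V step u n x) = sets (count_space V)" for n x
    by (auto simp: walk_kernel_def sets_restrict_space)
  show ?thesis
  proof (rule Ionescu_Tulcea.intro)
    fix n :: nat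
    have PiM: "PiM {0..<n} (\<lambda>_. count_space V) = count_space ({0..<n} \<rightarrow>\<^sub>E V)"
      using assms(1) by (intro count_space_PiM_finite) auto
    show "walk_kernel V step u n
        \<in> measurable (PiM {0..<n} (\<lambda>_. count_space V)) (subprob_algebra (count_space V))"
      unfolding PiM measurable_count_space_eq1
    proof
      fix x assume "x \<in> {0..<n} \<rightarrow>\<^sub>E V"
      then have "prob_space (walk_kernel V step u n x)"
        by (intro prob) (simp add: space_PiM)
      then show "walk_kernel V step u n x \<in> space (subprob_algebra (count_space V))"
        using sets_W[of n x] by (simp add: space_subprob_algebra prob_space_imp_subprob_space)
    qed
  qed (rule prob)
qed


text \<open>Under the law of the walk, paths have the expected finite-dimensional probabilities.\<close>

lemma emeasure_walk_law:
  assumes V: "countable V" "u \<in> V"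
    and step: "\<And>t x. (\<And>i. i \<le> t \<Longrightarrow> x i \<in> V) \<Longrightarrow> set_pmf (step t x) \<subseteq> V"
    and past: "\<And>t x x'. (\<And>i. i \<le> t \<Longrightarrow> x i = x' i) \<Longrightarrow> step t x = step t x'"
    and y: "\<And>i. i \<le> n \<Longrightarrow> y i \<in> V"
  shows "emeasure (walk_law V step u) {x \<in> space (walk_law V step u). \<forall>i\<le>n. x i = y i} =
    ennreal (pmf (return_pmf u) (y 0) * (\<Prod>t<n. pmf (step t y) (y (Suc t))))"
proof -
  let ?M = "\<lambda>_::nat. count_space V"
  interpret Ionescu_Tulcea "walk_kernel V step u" ?M
    by (rule Ionescu_Tulcea_walk_kernel[OF V step])
  define p where "p m = pmf (case m of 0 \<Rightarrow> return_pmf u | Suc t \<Rightarrow> step t y) (y m)" for m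
  have PiM: "PiM {0..<m} ?M = count_space ({0..<m} \<rightarrow>\<^sub>E V)" for m :: nat
    using V(1) by (intro count_space_PiM_finite) auto
  have und: "(\<lambda>_. undefined) \<in> space (PiM {0..<0} ?M)" by (simp add: space_PiM)
  have C: "m \<le> Suc n \<Longrightarrow> emeasure (C 0 m (\<lambda>_. undefined)) {restrict y {0..<m}}
      = ennreal (\<Prod>t<m. p t)" for m
  proof (induction m)
    case 0
    then show ?case by (simp add: PiM_empty)
  next
    case (Suc m)
    let ?r = "restrict y {0..<m}" and ?r' = "restrict y {0..<Suc m}"
    have ym: "y i \<in> V" if "i \<le> m" for i using that y Suc.prems by auto
    have r: "?r \<in> space (PiM {0..<m} ?M)" using ym by (auto simp: space_PiM)
    have r': "{?r'} \<in> sets (PiM {0..<Suc m} ?M)" using ym by (auto simp: PiM)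
    have K: "emeasure (walk_kernel V step u m ?r) {y m} = ennreal (p m)"
    proof -
      have "(case m of 0 \<Rightarrow> return_pmf u | Suc t \<Rightarrow> step t ?r)
          = (case m of 0 \<Rightarrow> return_pmf u | Suc t \<Rightarrow> step t y)"
        by (cases m) (auto intro!: past)
      then show ?thesis
        using ym[of m]
        by (simp add: walk_kernel_def p_def emeasure_restrict_space emeasure_pmf_single)
    qed
    have e: "emeasure (eP m x) {?r'} = ennreal (p m) * indicator {?r} x"
      if x: "x \<in> space (PiM {0..<m} ?M)" for x
    proof -
      have ext: "x \<in> extensional {0..<m}" using x by (auto simp: space_PiM PiE_iff)
      have eq: "x(m := v) = ?r' \<longleftrightarrow> v = y m \<and> x = ?r" for v
      proof
        assume L: "x(m := v) = ?r'"
        have "x i = ?r i" for i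
          using fun_cong[OF L, of i] ext by (cases "i < m") (auto simp: extensional_def)
        then show "v = y m \<and> x = ?r" using fun_cong[OF L, of m] by auto
      qed (auto simp: fun_eq_iff)
      have "(\<lambda>v. x(m := v)) -` {?r'} \<inter> space (?M m) = (if x = ?r then {y m} else {})"
        using ym[of m] unfolding vimage_def mem_Collect_eq singleton_iff eq by auto
      then show ?thesis
        by (subst emeasure_eP[OF x r']) (auto simp: K)
    qed
    have "emeasure (C 0 (Suc m) (\<lambda>_. undefined)) {?r'}
        = (\<integral>\<^sup>+x. emeasure (eP m x) {?r'} \<partial>C 0 m (\<lambda>_. undefined))"
      using r' measurable_eP[of m] prob_space.not_empty[OF prob_space_C[OF und, of m]]
      by (simp del: fun_upd_apply)
        (subst emeasure_bind[where N = "PiM {0..<Suc m} ?M"];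
          auto simp: measurable_cong_sets[OF sets_C[OF und, of m]])
    also have "\<dots> = (\<integral>\<^sup>+x. ennreal (p m) * indicator {?r} x \<partial>C 0 m (\<lambda>_. undefined))"
      by (intro nn_integral_cong e) (simp add: space_C[OF und])
    also have "\<dots> = ennreal (p m) * emeasure (C 0 m (\<lambda>_. undefined)) {?r}"
      using r by (intro nn_integral_cmult_indicator) (simp add: sets_C[OF und] PiM)
    also have "\<dots> = ennreal (\<Prod>t<Suc m. p t)"
      unfolding Suc.IH[OF Suc_leD[OF Suc.prems]]
      by (simp add: p_def ennreal_mult' mult.commute)
    finally show ?case .
  qed
  let ?J = "{0..<Suc n}"
  have X: "{restrict y ?J} \<in> sets (PiM ?J ?M)" using y by (auto simp: PiM)
  have "{x \<in> space (walk_law V step u). \<forall>i\<le>n. x i = y i} = PF.emb UNIV ?J {restrict y ?J}"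
    by (auto simp: walk_law_def prod_emb_def space_PiM fun_eq_iff restrict_def less_Suc_eq_le
        split: if_splits)
  then have "emeasure (walk_law V step u) {x \<in> space (walk_law V step u). \<forall>i\<le>n. x i = y i}
      = emeasure (CI ?J) {restrict y ?J}"
    using lim[OF _ X] by (simp add: walk_law_def)
  also have "\<dots> = emeasure (C 0 (Suc n) (\<lambda>_. undefined)) (PF.emb ?J ?J {restrict y ?J})"
    by (rule emeasure_CI[OF order_refl X])
  also have "PF.emb ?J ?J {restrict y ?J} = {restrict y ?J}"
    using sets.sets_into_space[OF X] by (intro prod_emb_id) (simp add: space_PiM)
  also have "emeasure (C 0 (Suc n) (\<lambda>_. undefined)) {restrict y ?J} = ennreal (\<Prod>t<Suc n. p t)"
    by (rule C) simp
  also have "(\<Prod>t<Suc n. p t) = p 0 * (\<Prod>t<n. p (Suc t))"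
    by (rule prod.lessThan_Suc_shift)
  finally show ?thesis by (simp add: p_def)
qed


section \<open>The walks\<close>

definition uniform_or :: "'a set \<Rightarrow> 'a pmf \<Rightarrow> 'a pmf" where
  "uniform_or S p = (if S = {} then p else pmf_of_set S)"

text \<open>A walk at an isolated vertex stays there; in a connected graph this only concerns the
  one-vertex graph.\<close>

definition uniform_nbr :: "'a set set \<Rightarrow> 'a \<Rightarrow> 'a pmf" where
  "uniform_nbr E x = uniform_or (nbrs E x) (return_pmf x)"

definition srw :: "'a set set \<Rightarrow> 'a step" where
  "srw E t x = uniform_nbr E (x t)"

definition nbrw :: "'a set set \<Rightarrow> 'a step" where
  "nbrw E t x = (case t of
       0 \<Rightarrow> uniform_nbr E (x 0)
     | Suc s \<Rightarrow> uniform_or {z \<in> nbrs E (x (Suc s)). z \<noteq> x s} (return_pmf (x s)))"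

text \<open>The conditions \<open>t - k < i\<close> and \<open>t - k \<le> i\<close> on integers are written additively in the
  natural numbers.\<close>

definition edge_knbrw :: "'a set set \<Rightarrow> nat \<Rightarrow> 'a step" where
  "edge_knbrw E k t x = uniform_or
     {z \<in> nbrs E (x t). {z, x t} \<notin> {{x (i - 1), x i} |i. t < i + k \<and> i \<le> t \<and> 1 \<le> i}}
     (uniform_nbr E (x t))"

definition vertex_knbrw :: "'a set set \<Rightarrow> nat \<Rightarrow> 'a step" where
  "vertex_knbrw E k t x = uniform_or
     {z \<in> nbrs E (x t). z \<notin> {x i |i. t \<le> i + k \<and> i \<le> t}}
     (uniform_nbr E (x t))"


section \<open>Markov chain representation on paths\<close>

definition edge_free :: "'a set set \<Rightarrow> 'a list \<Rightarrow> 'a set" where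
  "edge_free E \<gamma> = {v \<in> nbrs E (last \<gamma>). {last \<gamma>, v} \<notin> path_edges \<gamma>}"

definition vertex_free :: "'a set set \<Rightarrow> 'a list \<Rightarrow> 'a set" where
  "vertex_free E \<gamma> = {v \<in> nbrs E (last \<gamma>). v \<notin> set \<gamma>}"

text \<open>In the following, \<open>F\<close> is one of \<^term>\<open>edge_free E\<close> and \<^term>\<open>vertex_free E\<close>; the chain is
  stuck at \<open>\<gamma>\<close> iff \<open>F \<gamma>\<close> is empty.\<close>

definition path_chain :: "'a set set \<Rightarrow> ('a list \<Rightarrow> 'a set) \<Rightarrow> 'a list \<Rightarrow> 'a list pmf" where
  "path_chain E F \<gamma> =
     map_pmf (\<lambda>v. tl \<gamma> @ [v]) (uniform_or (F \<gamma>) (uniform_nbr E (last \<gamma>)))"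

definition path_chain_n ::
  "'a set set \<Rightarrow> ('a list \<Rightarrow> 'a set) \<Rightarrow> nat \<Rightarrow> 'a list \<Rightarrow> 'a list pmf" where
  "path_chain_n E F n \<gamma> = ((\<lambda>p. bind_pmf p (path_chain E F)) ^^ n) (return_pmf \<gamma>)"

definition can_reach_within ::
  "'a set set \<Rightarrow> ('a list \<Rightarrow> 'a set) \<Rightarrow> real \<Rightarrow> 'a list \<Rightarrow> 'a list \<Rightarrow> bool" where
  "can_reach_within E F R \<gamma> \<gamma>' \<longleftrightarrow> (\<exists>n. real n \<le> R \<and> pmf (path_chain_n E F n \<gamma>) \<gamma>' > 0)"

definition cannot_get_stuck :: "('a list \<Rightarrow> 'a set) \<Rightarrow> 'a list set \<Rightarrow> bool" where
  "cannot_get_stuck F P \<longleftrightarrow> (\<forall>\<gamma>\<in>P. F \<gamma> \<noteq> {})"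

definition uniformly_reachable ::
  "'a set set \<Rightarrow> ('a list \<Rightarrow> 'a set) \<Rightarrow> 'a list set \<Rightarrow> bool" where
  "uniformly_reachable E F P \<longleftrightarrow>
     (\<exists>R>0. \<forall>\<gamma>\<in>P. \<forall>\<gamma>'\<in>P. set \<gamma> \<inter> set \<gamma>' \<noteq> {} \<longrightarrow> can_reach_within E F R \<gamma> \<gamma>')"

end

theory Submission
  imports Defs
begin

text \<open>
  Each walk is a Markov chain on paths, and transience amounts to boundedness of the Green function
  of this chain.  For a chain with a (nearly) invariant weight \<open>\<pi>\<close> bounded from both sides,
  the truncated Green function \<open>f = (\<Sum>m\<le>n. P\<^sup>m(\<cdot>, z))\<close> has finite support and satisfies
  \<open>(I - P) f \<le> \<delta>\<^sub>z\<close>, so its Dirichlet energy is at most \<open>2 \<pi>(z) f(z)\<close>.  An inequality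
  \<open>f(z)\<^sup>2 \<le> C * energy(f)\<close> therefore bounds the Green function at \<open>z\<close>.  Transience of the simple
  random walk gives this inequality for functions on \<open>V\<close>, and the reachability hypotheses carry it
  over to functions on paths.

  For the converse, the flow of the path chain is reversed by reversing the paths.  This symmetry,
  together with an \<open>\<ell>\<^sup>2\<close> bound on functions that are odd under reversal, yields a sector
  condition, so transience of the path chain implies the same inequality for even functions, in
  particular for those lifted from \<open>V\<close>.  Trails carry an explicit weight with this symmetry.  For
  the vertex walk no invariant weight is available, but if it were recurrent, its normalized
  occupation measures would be nearly invariant and, by transitivity, bounded below.
\<close>

subsection \<open>Finitely branching Markov chains\<close>

text \<open>For \<open>k \<ge> 1\<close> the path chains are in general not reversible, and this
  makes the two directions unequal. Bounding the Green function uses only the symmetric part of the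
  Dirichlet form; the converse pairs an arbitrary test function with a Green function, where the
  antisymmetric part enters. It is tamed because a path and its reverse are linked by boundedly many
  transitions, which is the use of short cycles and of the reachability hypothesis there. A last
  obstacle is the start of the edge walk. The hypothesis on getting stuck speaks only of trails with
  \<open>k\<close> edges, so a shorter history may be stuck and the first windows need not be
  trails; recurrence has to be derived from all windows nevertheless.\<close>

primrec kn :: "('s \<Rightarrow> 's pmf) \<Rightarrow> nat \<Rightarrow> 's \<Rightarrow> 's pmf" where
  "kn K 0 x = return_pmf x"
| "kn K (Suc n) x = bind_pmf (K x) (kn K n)"

lemma kn_add: "kn K (m + n) x = bind_pmf (kn K m x) (kn K n)"
proof (induction m arbitrary: x)
  case (Suc m)
  then have "kn K (m + n) = (\<lambda>x. bind_pmf (kn K m x) (kn K n))" by (intro ext)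
  then show ?case by (simp add: bind_assoc_pmf)
qed (simp add: bind_return_pmf)

lemma bind_kn_0 [simp]: "bind_pmf p (kn K 0) = p"
proof -
  have "kn K 0 = return_pmf" by (intro ext) simp
  then show ?thesis by (simp add: bind_return_pmf')
qed

lemma kn_Suc': "kn K (Suc n) x = bind_pmf (kn K n x) K"
proof -
  have "kn K 1 = K" by (intro ext) simp
  then show ?thesis using kn_add[of K n 1 x] by simp
qed

definition green :: "('s \<Rightarrow> 's pmf) \<Rightarrow> nat \<Rightarrow> 's \<Rightarrow> 's \<Rightarrow> real" where
  "green K n x z = (\<Sum>m\<le>n. pmf (kn K m x) z)"

text \<open>The set is tested at times 1 to \<open>n\<close> only, so this is the probability that
  the first \<open>n\<close> steps avoid \<open>A\<close> even if \<open>x\<close> lies in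
  \<open>A\<close>; for such \<open>x\<close> the complement is a return probability.\<close>

primrec surv :: "('s \<Rightarrow> 's pmf) \<Rightarrow> 's set \<Rightarrow> nat \<Rightarrow> 's \<Rightarrow> real" where
  "surv K A 0 x = 1"
| "surv K A (Suc n) x = (\<Sum>y\<in>set_pmf (K x) - A. pmf (K x) y * surv K A n y)"

text \<open>Started at \<open>x\<close>, the chain enters \<open>A\<close> at some positive time
  with probability one.\<close>

definition dead :: "('s \<Rightarrow> 's pmf) \<Rightarrow> 's set \<Rightarrow> 's \<Rightarrow> bool" where
  "dead K A x \<longleftrightarrow> (\<lambda>n. surv K A n x) \<longlonglongrightarrow> 0"

text \<open>Transience of the state \<open>z\<close>, phrased through partial sums so that no
  infinite sum is needed.\<close>

definition bounded_green :: "('s \<Rightarrow> 's pmf) \<Rightarrow> 's \<Rightarrow> bool" where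
  "bounded_green K z \<longleftrightarrow> (\<exists>G. \<forall>n. green K n z z \<le> G)"

lemma pmf_bind_sum:
  assumes "finite (set_pmf p)"
  shows "pmf (bind_pmf p f) z = (\<Sum>y\<in>set_pmf p. pmf p y * pmf (f y) z)"
proof -
  have "pmf (bind_pmf p f) z = measure_pmf.expectation p (\<lambda>y. pmf (f y) z)"
    by (simp add: pmf_bind)
  also have "\<dots> = (\<Sum>y\<in>set_pmf p. pmf (f y) z * pmf p y)"
    using assms by (intro integral_measure_pmf_real) auto
  finally show ?thesis by (simp add: mult.commute)
qed

text \<open>Finite branching turns every expectation into a finite sum. Everything is relative to a
  closed set \<Omega>, since one kernel is later used on several sets of paths.\<close>

locale fin_chain =
  fixes K :: "'s \<Rightarrow> 's pmf" and \<Omega> :: "'s set"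
  assumes closed: "x \<in> \<Omega> \<Longrightarrow> set_pmf (K x) \<subseteq> \<Omega>"
    and fin: "x \<in> \<Omega> \<Longrightarrow> finite (set_pmf (K x))"
begin

definition T :: "('s \<times> 's) set" where
  "T = {(x, y). x \<in> \<Omega> \<and> y \<in> set_pmf (K x)}"

lemma T_in: "(x, y) \<in> T \<Longrightarrow> x \<in> \<Omega>" "(x, y) \<in> T \<Longrightarrow> y \<in> \<Omega>"
  using closed by (auto simp: T_def)

lemma sum_K: "x \<in> \<Omega> \<Longrightarrow> (\<Sum>y\<in>set_pmf (K x). pmf (K x) y) = 1"
  using fin by (simp add: sum_pmf_eq_1)

lemma sum_K_le: 
  assumes "finite S"
  shows "(\<Sum>y\<in>S. pmf (K x) y) \<le> 1"
  using assms by (metis measure_measure_pmf_finite measure_pmf.prob_le_1)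

lemma finite_kn: "x \<in> \<Omega> \<Longrightarrow> finite (set_pmf (kn K n x)) \<and> set_pmf (kn K n x) \<subseteq> \<Omega>"
proof (induction n arbitrary: x)
  case (Suc n)
  then show ?case using closed[OF Suc.prems] fin[OF Suc.prems] by (auto simp: subset_iff)
qed simp

lemma pmf_kn_Suc: "x \<in> \<Omega> \<Longrightarrow>
    pmf (kn K (Suc n) x) z = (\<Sum>y\<in>set_pmf (K x). pmf (K x) y * pmf (kn K n y) z)"
  by (simp add: pmf_bind_sum fin)

lemma pmf_kn_add: "x \<in> \<Omega> \<Longrightarrow>
    pmf (kn K (m + n) x) z = (\<Sum>y\<in>set_pmf (kn K m x). pmf (kn K m x) y * pmf (kn K n y) z)"
  by (simp add: kn_add pmf_bind_sum finite_kn)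

lemma pmf_kn_add_ge:
  assumes "x \<in> \<Omega>"
  shows "pmf (kn K m x) y * pmf (kn K n y) z \<le> pmf (kn K (m + n) x) z"
proof (cases "y \<in> set_pmf (kn K m x)")
  case True
  then show ?thesis
    unfolding pmf_kn_add[OF assms] using finite_kn[OF assms, of m]
    by (intro member_le_sum) auto
next
  case False
  then show ?thesis by (simp add: set_pmf_iff)
qed

lemma set_kn: "x \<in> \<Omega> \<Longrightarrow> y \<in> set_pmf (kn K n x) \<longleftrightarrow> (x, y) \<in> T ^^ n"
proof (induction n arbitrary: x)
  case (Suc n)
  have "y \<in> set_pmf (kn K (Suc n) x) \<longleftrightarrow> (\<exists>w\<in>set_pmf (K x). y \<in> set_pmf (kn K n w))" by simp
  also have "\<dots> \<longleftrightarrow> (\<exists>w\<in>set_pmf (K x). (w, y) \<in> T ^^ n)"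
    using Suc.IH closed[OF Suc.prems] by blast
  also have "\<dots> \<longleftrightarrow> (\<exists>w. (x, w) \<in> T \<and> (w, y) \<in> T ^^ n)"
    using Suc.prems by (auto simp: T_def)
  also have "\<dots> \<longleftrightarrow> (x, y) \<in> T ^^ Suc n"
    by (metis relpow_Suc_D2 relpow_Suc_I2)
  finally show ?case .
qed auto

lemma green_nonneg: "green K n x z \<ge> 0"
  by (simp add: green_def sum_nonneg)

lemma green_mono: "m \<le> n \<Longrightarrow> green K m x z \<le> green K n x z"
  unfolding green_def by (intro sum_mono2) auto

lemma green_Suc:
  assumes "x \<in> \<Omega>"
  shows "green K (Suc n) x z =
    indicator {z} x + (\<Sum>y\<in>set_pmf (K x). pmf (K x) y * green K n y z)"
proof -
  have "green K (Suc n) x z = pmf (kn K 0 x) z + (\<Sum>m\<le>n. pmf (kn K (Suc m) x) z)"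
    unfolding green_def by (rule sum.atMost_Suc_shift)
  also have "(\<Sum>m\<le>n. pmf (kn K (Suc m) x) z) =
      (\<Sum>m\<le>n. \<Sum>y\<in>set_pmf (K x). pmf (K x) y * pmf (kn K m y) z)"
    by (simp only: pmf_kn_Suc[OF assms])
  also have "\<dots> = (\<Sum>y\<in>set_pmf (K x). \<Sum>m\<le>n. pmf (K x) y * pmf (kn K m y) z)"
    by (rule sum.swap)
  finally show ?thesis by (simp add: green_def sum_distrib_left pmf_return indicator_def)
qed

text \<open>Visits to \<open>z\<close> can only begin once \<open>z\<close> is first reached, and
  from then on no more than \<open>n\<close> steps remain.\<close>

lemma green_le_diag: "x \<in> \<Omega> \<Longrightarrow> z \<in> \<Omega> \<Longrightarrow> green K n x z \<le> green K n z z"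
proof (induction n arbitrary: x)
  case 0
  then show ?case by (simp add: green_def pmf_return)
next
  case (Suc n)
  show ?case
  proof (cases "x = z")
    case False
    have "green K (Suc n) x z = (\<Sum>y\<in>set_pmf (K x). pmf (K x) y * green K n y z)"
      using Suc.prems False by (simp add: green_Suc)
    also have "\<dots> \<le> (\<Sum>y\<in>set_pmf (K x). pmf (K x) y * green K n z z)"
      using Suc.IH Suc.prems closed by (intro sum_mono mult_left_mono) auto
    also have "\<dots> = green K n z z"
      using sum_K[OF Suc.prems(1)] by (simp add: sum_distrib_right[symmetric])
    also have "\<dots> \<le> green K (Suc n) z z" by (rule green_mono) simp
    finally show ?thesis .
  qed simp
qed

text \<open>Go from \<open>x\<close> to \<open>y\<close> in \<open>a\<close> steps, loop at
  \<open>y\<close> for \<open>m\<close> steps, return in \<open>b\<close> steps. Different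
  \<open>m\<close> give different total lengths, so the contributions do not overlap.\<close>

lemma green_add_ge:
  assumes "x \<in> \<Omega>" "y \<in> \<Omega>"
  shows "pmf (kn K a x) y * green K n y y * pmf (kn K b y) x \<le> green K (n + a + b) x x"
proof -
  have "pmf (kn K a x) y * green K n y y * pmf (kn K b y) x =
      (\<Sum>m\<le>n. pmf (kn K a x) y * pmf (kn K m y) y * pmf (kn K b y) x)"
    by (simp add: green_def sum_distrib_left sum_distrib_right)
  also have "\<dots> \<le> (\<Sum>m\<le>n. pmf (kn K (a + m + b) x) x)"
  proof (intro sum_mono)
    fix m
    have "pmf (kn K a x) y * pmf (kn K m y) y * pmf (kn K b y) x
        \<le> pmf (kn K (a + m) x) y * pmf (kn K b y) x"
      by (intro mult_right_mono pmf_kn_add_ge assms) simp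
    also have "\<dots> \<le> pmf (kn K (a + m + b) x) x" by (intro pmf_kn_add_ge assms)
    finally show "pmf (kn K a x) y * pmf (kn K m y) y * pmf (kn K b y) x
        \<le> pmf (kn K (a + m + b) x) x" .
  qed
  also have "\<dots> = (\<Sum>m\<in>(\<lambda>m. a + m + b) ` {..n}. pmf (kn K m x) x)"
    by (subst sum.reindex) (auto simp: inj_on_def)
  also have "\<dots> \<le> green K (n + a + b) x x"
    unfolding green_def by (intro sum_mono2) auto
  finally show ?thesis .
qed

lemma green_le_add: "green K (n + j) x z \<le> green K n x z + real j"
proof (induction j)
  case (Suc j)
  then show ?case using pmf_le_1[of "kn K (Suc (n + j)) x" z]
    by (simp add: green_def)
qed simp

lemma pmf_kn_pos: "x \<in> \<Omega> \<Longrightarrow> (x, y) \<in> T ^^ n \<Longrightarrow> pmf (kn K n x) y > 0"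
  using set_kn[of x y n] by (simp add: pmf_positive)

lemma rtrancl_T_in: "(x, y) \<in> T\<^sup>* \<Longrightarrow> x \<in> \<Omega> \<Longrightarrow> y \<in> \<Omega>"
  by (induction rule: rtrancl_induct) (auto dest: T_in)

lemma bounded_green_transfer:
  assumes "x \<in> \<Omega>" "bounded_green K x" "(x, y) \<in> T\<^sup>*" "(y, x) \<in> T\<^sup>*"
  shows "bounded_green K y"
proof -
  have y: "y \<in> \<Omega>" using assms rtrancl_T_in by blast
  obtain a b where ab: "(x, y) \<in> T ^^ a" "(y, x) \<in> T ^^ b"
    using assms(3,4) by (auto simp: rtrancl_power)
  let ?p = "pmf (kn K a x) y * pmf (kn K b y) x"
  have p: "?p > 0" using ab assms(1) y by (simp add: pmf_kn_pos)
  obtain G where G: "\<And>n. green K n x x \<le> G" using assms(2) by (auto simp: bounded_green_def)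
  have "green K n y y \<le> G / ?p" for n
  proof -
    have "green K n y y * ?p \<le> G"
      using green_add_ge[OF assms(1) y, of a n b] G[of "n + a + b"] by (simp add: mult_ac)
    then show ?thesis using p by (simp add: pos_le_divide_eq)
  qed
  then show ?thesis by (auto simp: bounded_green_def)
qed

subsection \<open>Hitting probabilities\<close>

lemma surv_nonneg: "surv K A n x \<ge> 0"
  by (induction n arbitrary: x) (auto intro!: sum_nonneg)

lemma surv_le_1: "x \<in> \<Omega> \<Longrightarrow> surv K A n x \<le> 1"
proof (induction n arbitrary: x)
  case (Suc n)
  have "surv K A (Suc n) x \<le> (\<Sum>y\<in>set_pmf (K x) - A. pmf (K x) y * 1)"
    unfolding surv.simps using Suc closed by (intro sum_mono mult_left_mono) auto
  also have "\<dots> \<le> 1" using sum_K_le[of "set_pmf (K x) - A"] fin Suc.prems by simp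
  finally show ?case .
qed simp

lemma surv_Suc_le: "x \<in> \<Omega> \<Longrightarrow> surv K A (Suc n) x \<le> surv K A n x"
proof (induction n arbitrary: x)
  case 0
  then show ?case using surv_le_1[of x A 1] by simp
next
  case (Suc n)
  then show ?case using closed
    by (subst (1 2) surv.simps) (intro sum_mono mult_left_mono, auto)
qed

lemma surv_antimono: "m \<le> n \<Longrightarrow> x \<in> \<Omega> \<Longrightarrow> surv K A n x \<le> surv K A m x"
  by (induction n rule: dec_induct) (auto intro: order_trans[OF surv_Suc_le] simp del: surv.simps)

lemma surv_mono_set: "A \<subseteq> B \<Longrightarrow> x \<in> \<Omega> \<Longrightarrow> surv K B n x \<le> surv K A n x"
proof (induction n arbitrary: x)
  case (Suc n)
  have "surv K B (Suc n) x \<le> (\<Sum>y\<in>set_pmf (K x) - B. pmf (K x) y * surv K A n y)"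
    unfolding surv.simps using Suc closed by (intro sum_mono mult_left_mono) auto
  also have "\<dots> \<le> surv K A (Suc n) x"
    unfolding surv.simps using Suc.prems fin
    by (intro sum_mono2) (auto intro!: mult_nonneg_nonneg surv_nonneg)
  finally show ?case .
qed simp

lemma dead_mono: "dead K A x \<Longrightarrow> A \<subseteq> B \<Longrightarrow> x \<in> \<Omega> \<Longrightarrow> dead K B x"
  unfolding dead_def
  by (erule tendsto_sandwich[OF _ _ tendsto_const, rotated 2])
    (auto intro!: always_eventually surv_nonneg surv_mono_set)

text \<open>The probability of never entering \<open>A\<close> at a positive time, as the limit of a
  decreasing sequence.\<close>

definition usurv :: "'s set \<Rightarrow> 's \<Rightarrow> real" where
  "usurv A x = (INF n. surv K A n x)"

lemma surv_tendsto: "x \<in> \<Omega> \<Longrightarrow> (\<lambda>n. surv K A n x) \<longlonglongrightarrow> usurv A x"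
  unfolding usurv_def
  by (intro LIMSEQ_decseq_INF) 
    (auto intro!: bdd_belowI[of _ 0] surv_nonneg simp: decseq_def surv_antimono)

lemma usurv_le: "usurv A x \<le> surv K A n x"
  unfolding usurv_def by (rule cINF_lower) (auto intro!: bdd_belowI[of _ 0] surv_nonneg)

lemma usurv_nonneg: "usurv A x \<ge> 0"
  unfolding usurv_def by (rule cINF_greatest) (auto intro: surv_nonneg)

lemma dead_iff: "x \<in> \<Omega> \<Longrightarrow> dead K A x \<longleftrightarrow> usurv A x = 0"
  unfolding dead_def using surv_tendsto[of x A] LIMSEQ_unique by auto

lemma usurv_step: 
  assumes "x \<in> \<Omega>"
  shows "usurv A x = (\<Sum>y\<in>set_pmf (K x) - A. pmf (K x) y * usurv A y)"
proof -
  have "(\<lambda>n. surv K A (Suc n) x) \<longlonglongrightarrow> (\<Sum>y\<in>set_pmf (K x) - A. pmf (K x) y * usurv A y)"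
    unfolding surv.simps using assms closed
    by (intro tendsto_sum tendsto_mult tendsto_const surv_tendsto) auto
  moreover have "(\<lambda>n. surv K A (Suc n) x) \<longlonglongrightarrow> usurv A x"
    using surv_tendsto[OF assms] LIMSEQ_Suc by blast
  ultimately show ?thesis using LIMSEQ_unique by blast
qed

text \<open>Decomposition according to the last visit to \<open>z\<close> up to time
  \<open>n\<close>. The separate term is the event of no visit at all, impossible for
  \<open>x = z\<close> because time 0 counts as a visit.\<close>

lemma last_exit:
  "x \<in> \<Omega> \<Longrightarrow> (\<Sum>m\<le>n. pmf (kn K m x) z * surv K {z} (n - m) z)
     + (if x = z then 0 else surv K {z} n x) = 1"
proof (induction n arbitrary: x)
  case 0
  then show ?case by (simp add: pmf_return)
next
  case (Suc n)
  let ?s = "\<lambda>n x. surv K {z} n x" and ?S = "set_pmf (K x)"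
  have "(\<Sum>m\<le>Suc n. pmf (kn K m x) z * ?s (Suc n - m) z) =
     pmf (kn K 0 x) z * ?s (Suc n) z + (\<Sum>m\<le>n. pmf (kn K (Suc m) x) z * ?s (n - m) z)"
    by (subst sum.atMost_Suc_shift) simp
  also have "(\<Sum>m\<le>n. pmf (kn K (Suc m) x) z * ?s (n - m) z) =
     (\<Sum>m\<le>n. \<Sum>y\<in>?S. pmf (K x) y * (pmf (kn K m y) z * ?s (n - m) z))"
    by (simp only: pmf_kn_Suc[OF Suc.prems] sum_distrib_right mult.assoc)
  also have "\<dots> = (\<Sum>y\<in>?S. pmf (K x) y * (\<Sum>m\<le>n. pmf (kn K m y) z * ?s (n - m) z))"
    by (subst sum.swap) (simp add: sum_distrib_left)
  also have "\<dots> = (\<Sum>y\<in>?S. pmf (K x) y * (1 - (if y = z then 0 else ?s n y)))"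
  proof (intro sum.cong refl)
    fix y assume "y \<in> ?S"
    then have "y \<in> \<Omega>" using closed Suc.prems by auto
    from Suc.IH[OF this]
    have e: "(\<Sum>m\<le>n. pmf (kn K m y) z * ?s (n - m) z) = 1 - (if y = z then 0 else ?s n y)" by linarith
    show "pmf (K x) y * (\<Sum>m\<le>n. pmf (kn K m y) z * ?s (n - m) z) =
        pmf (K x) y * (1 - (if y = z then 0 else ?s n y))" unfolding e ..
  qed
  also have "\<dots> = 1 - (\<Sum>y\<in>?S. pmf (K x) y * (if y = z then 0 else ?s n y))"
    using sum_K[OF Suc.prems] by (simp add: right_diff_distrib sum_subtractf)
  also have "(\<Sum>y\<in>?S. pmf (K x) y * (if y = z then 0 else ?s n y)) = ?s (Suc n) x"
    using fin[OF Suc.prems] unfolding surv.simps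
    by (intro sum.mono_neutral_cong_right) auto
  finally show ?case by (simp add: pmf_return del: surv.simps)
qed

lemma green_surv_le: 
  assumes "z \<in> \<Omega>"
  shows "green K n z z * surv K {z} n z \<le> 1"
proof -
  have "green K n z z * surv K {z} n z \<le> (\<Sum>m\<le>n. pmf (kn K m z) z * surv K {z} (n - m) z)"
    unfolding green_def sum_distrib_right
    using assms by (intro sum_mono mult_left_mono surv_antimono) auto
  also have "\<dots> = 1" using last_exit[OF assms, of z n] by simp
  finally show ?thesis .
qed

text \<open>By the last-exit identity the Green function is at most the inverse of the escape
  probability, so an unbounded Green function forces the latter to vanish.\<close>

lemma dead_self:
  assumes z: "z \<in> \<Omega>" and inf: "\<not> bounded_green K z"
  shows "dead K {z} z"
proof -
  have "usurv {z} z = 0"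
  proof (rule ccontr)
    assume "usurv {z} z \<noteq> 0"
    then have u: "usurv {z} z > 0" using usurv_nonneg[of "{z}" z] by simp
    have "green K n z z \<le> 1 / usurv {z} z" for n
    proof -
      have "green K n z z * usurv {z} z \<le> green K n z z * surv K {z} n z"
        by (intro mult_left_mono usurv_le green_nonneg)
      also have "\<dots> \<le> 1" by (rule green_surv_le[OF z])
      finally show ?thesis using u by (simp add: pos_le_divide_eq)
    qed
    then show False using inf by (auto simp: bounded_green_def)
  qed
  then show ?thesis using dead_iff[OF z] by simp
qed

text \<open>The escape probability of \<open>x\<close> is a sum of nonnegative terms over the
  successors outside \<open>A\<close>, so each of these terms vanishes with it.\<close>

lemma dead_step:
  assumes "dead K A x" "(x, y) \<in> T" "y \<notin> A"
  shows "dead K A y"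
proof -
  have x: "x \<in> \<Omega>" and y: "y \<in> set_pmf (K x) - A" "y \<in> \<Omega>"
    using T_in[OF assms(2)] assms(2,3) by (simp_all add: T_def)
  have "pmf (K x) y * usurv A y \<le> (\<Sum>y\<in>set_pmf (K x) - A. pmf (K x) y * usurv A y)"
    by (rule member_le_sum[OF y(1)]) (use fin[OF x] in \<open>simp_all add: usurv_nonneg\<close>)
  also have "\<dots> = usurv A x" by (rule usurv_step[OF x, symmetric])
  finally have "pmf (K x) y * usurv A y \<le> usurv A x" .
  then have "pmf (K x) y * usurv A y \<le> 0" using assms(1) dead_iff[OF x] by simp
  moreover have "pmf (K x) y > 0" using y by (intro pmf_positive) auto
  ultimately have "usurv A y \<le> 0" using mult_pos_pos[of "pmf (K x) y" "usurv A y"] by linarith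
  then show ?thesis using dead_iff[OF y(2)] usurv_nonneg[of A y] by simp
qed

lemma dead_reach:
  assumes "z \<in> \<Omega>" "\<not> bounded_green K z" "(z, x) \<in> T\<^sup>*"
  shows "dead K {z} x"
  using assms(3)
proof (induction rule: rtrancl_induct)
  case base
  then show ?case using dead_self assms by blast
next
  case (step x y)
  then show ?case using dead_step[of "{z}" x y] dead_self assms by (cases "y = z") auto
qed

text \<open>With probability \<open>1 - surv K {z} j x\<close> the state \<open>z\<close> is reached
  at a time between 1 and \<open>j\<close>, and then at least \<open>n\<close> steps are
  left.\<close>

lemma green_ge_surv:
  assumes z: "z \<in> \<Omega>"
  shows "x \<in> \<Omega> \<Longrightarrow> (1 - surv K {z} j x) * green K n z z \<le> green K (n + j) x z"
proof (induction j arbitrary: x)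
  case 0
  then show ?case by (simp add: green_nonneg)
next
  case (Suc j)
  let ?S = "set_pmf (K x)" and ?g = "green K n z z"
  have "(1 - surv K {z} (Suc j) x) * ?g =
      (\<Sum>y\<in>?S. pmf (K x) y * (1 - (if y = z then 0 else surv K {z} j y))) * ?g"
  proof -
    have "(\<Sum>y\<in>?S. pmf (K x) y * (if y = z then 0 else surv K {z} j y)) = surv K {z} (Suc j) x"
      using fin[OF Suc.prems] unfolding surv.simps
      by (intro sum.mono_neutral_cong_right) auto
    then show ?thesis
      using sum_K[OF Suc.prems] by (simp add: right_diff_distrib sum_subtractf)
  qed
  also have "\<dots> = (\<Sum>y\<in>?S. pmf (K x) y * ((1 - (if y = z then 0 else surv K {z} j y)) * ?g))"
    by (simp add: sum_distrib_right mult.assoc)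
  also have "\<dots> \<le> (\<Sum>y\<in>?S. pmf (K x) y * green K (n + j) y z)"
  proof (intro sum_mono mult_left_mono)
    fix y assume "y \<in> ?S"
    then have y: "y \<in> \<Omega>" using closed Suc.prems by auto
    show "(1 - (if y = z then 0 else surv K {z} j y)) * ?g \<le> green K (n + j) y z"
      using Suc.IH[OF y] green_mono[of n "n + j" z z] by auto
  qed simp
  also have "\<dots> \<le> green K (n + Suc j) x z"
    using green_Suc[OF Suc.prems, of "n + j" z] by simp
  finally show ?case .
qed

text \<open>Iterate the inequality for the chain killed on \<open>B\<close>: each step keeps only
  the mass that has not entered \<open>B\<close>, and at the end \<open>u\<close> is replaced by its
  bound \<open>s\<close>.\<close>

lemma subharmonic_le_surv:
  assumes X: "X \<subseteq> \<Omega>" "\<And>x y. x \<in> X \<Longrightarrow> y \<in> set_pmf (K x) \<Longrightarrow> y \<notin> B \<Longrightarrow> y \<in> X"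
    and u: "\<And>x. x \<in> X \<Longrightarrow> u x \<le> (\<Sum>y\<in>set_pmf (K x) - B. pmf (K x) y * u y)"
    and s: "\<And>x. x \<in> X \<Longrightarrow> u x \<le> s"
  shows "x \<in> X \<Longrightarrow> u x \<le> s * surv K B n x"
proof (induction n arbitrary: x)
  case (Suc n)
  have "u x \<le> (\<Sum>y\<in>set_pmf (K x) - B. pmf (K x) y * u y)" using u Suc by blast
  also have "\<dots> \<le> (\<Sum>y\<in>set_pmf (K x) - B. pmf (K x) y * (s * surv K B n y))"
    using Suc.IH X(2)[OF Suc.prems] by (intro sum_mono mult_left_mono) auto
  also have "\<dots> = s * surv K B (Suc n) x" by (simp add: sum_distrib_left mult_ac)
  finally show ?case .
qed (use s in simp)

text \<open>The supremum \<open>s\<close> of \<open>u\<close> contracts: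
  \<open>u y \<le> s * surv K B n y\<close> gives \<open>s \<le> s * (1 - \<delta>)\<close>. The
  number of steps may depend on the state; only \<delta> has to be uniform.\<close>

lemma subharmonic_zero:
  fixes u :: "'s \<Rightarrow> real" and \<delta> :: real
  assumes X: "X \<subseteq> \<Omega>" "\<And>x y. x \<in> X \<Longrightarrow> y \<in> set_pmf (K x) \<Longrightarrow> y \<notin> B \<Longrightarrow> y \<in> X"
    and u: "\<And>x. x \<in> X \<Longrightarrow> u x \<le> (\<Sum>y\<in>set_pmf (K x) - B. pmf (K x) y * u y)"
    and u0: "\<And>x. x \<in> X \<Longrightarrow> u x \<ge> 0" and u1: "\<And>x. x \<in> X \<Longrightarrow> u x \<le> 1"
    and \<delta>: "\<delta> > 0" "\<And>x. x \<in> X \<Longrightarrow> \<exists>n. surv K B n x \<le> 1 - \<delta>"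
    and x: "x \<in> X"
  shows "u x = 0"
proof -
  define s where "s = (SUP x\<in>X. u x)"
  have bdd: "bdd_above (u ` X)" using u1 by (auto intro: bdd_aboveI[of _ 1])
  have le: "u x \<le> s" if "x \<in> X" for x unfolding s_def using that bdd by (rule cSUP_upper)
  have s0: "s \<ge> 0" using le[OF x] u0[OF x] by linarith
  have "u y \<le> s * (1 - \<delta>)" if y: "y \<in> X" for y
  proof -
    obtain n where n: "surv K B n y \<le> 1 - \<delta>" using \<delta>(2) y by blast
    have "u y \<le> s * surv K B n y"
      by (rule subharmonic_le_surv[OF X u le y])
    also have "\<dots> \<le> s * (1 - \<delta>)" using n s0 by (rule mult_left_mono)
    finally show ?thesis .
  qed
  then have "s \<le> s * (1 - \<delta>)" unfolding s_def using x by (intro cSUP_least) (auto simp: s_def)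
  then have "s * \<delta> \<le> 0" by (simp add: algebra_simps)
  then have "s \<le> 0" using \<delta>(1) by (simp add: mult_le_0_iff)
  then show ?thesis using le[OF x] u0[OF x] by linarith
qed

lemma dead_uniform:
  assumes X: "X \<subseteq> \<Omega>" "\<And>x y. x \<in> X \<Longrightarrow> y \<in> set_pmf (K x) \<Longrightarrow> y \<notin> B \<Longrightarrow> y \<in> X"
    and \<delta>: "\<delta> > 0" "\<And>x. x \<in> X \<Longrightarrow> \<exists>n. surv K B n x \<le> 1 - \<delta>"
    and x: "x \<in> X"
  shows "dead K B x"
proof -
  have "usurv B x = 0"
  proof (rule subharmonic_zero[OF X _ _ _ \<delta> x])
    show "usurv B x \<le> (\<Sum>y\<in>set_pmf (K x) - B. pmf (K x) y * usurv B y)" if "x \<in> X" for x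
      using that X(1) usurv_step[of x B] by auto
    show "usurv B x \<le> 1" if "x \<in> X" for x
      using that X(1) usurv_le[of B x 0] by auto
  qed (auto intro: usurv_nonneg)
  then show ?thesis using dead_iff x X(1) by auto
qed

text \<open>The escape probability for \<open>A\<close> vanishes at the states of \<open>B\<close>,
  hence it is subharmonic for the chain killed on \<open>B\<close>, which has a uniform chance of
  absorption.\<close>

lemma dead_through:
  assumes X: "X \<subseteq> \<Omega>" "\<And>x y. x \<in> X \<Longrightarrow> y \<in> set_pmf (K x) \<Longrightarrow> y \<notin> B \<Longrightarrow> y \<in> X"
    and B: "\<And>x. x \<in> B \<Longrightarrow> x \<in> \<Omega> \<Longrightarrow> dead K A x"
    and \<delta>: "\<delta> > 0" "\<And>x. x \<in> X \<Longrightarrow> \<exists>n. surv K B n x \<le> 1 - \<delta>"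
    and x: "x \<in> X"
  shows "dead K A x"
proof -
  have "usurv A x = 0"
  proof (rule subharmonic_zero[OF X _ _ _ \<delta> x])
    fix x assume x: "x \<in> X"
    then have "x \<in> \<Omega>" using X by auto
    have "usurv A x = (\<Sum>y\<in>set_pmf (K x) - A. pmf (K x) y * usurv A y)"
      using x X(1) usurv_step[of x A] by auto
    also have "\<dots> \<le> (\<Sum>y\<in>set_pmf (K x). pmf (K x) y * usurv A y)"
      using fin[OF \<open>x \<in> \<Omega>\<close>] by (intro sum_mono2) (auto intro!: mult_nonneg_nonneg usurv_nonneg)
    also have "\<dots> = (\<Sum>y\<in>set_pmf (K x) - B. pmf (K x) y * usurv A y)"
      using fin[OF \<open>x \<in> \<Omega>\<close>] B closed[OF \<open>x \<in> \<Omega>\<close>] dead_iff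
      by (intro sum.mono_neutral_right) auto
    finally show "usurv A x \<le> (\<Sum>y\<in>set_pmf (K x) - B. pmf (K x) y * usurv A y)" .
    show "usurv A x \<le> 1" using usurv_le[of A x 0] by auto
  qed (auto intro: usurv_nonneg)
  then show ?thesis using dead_iff x X(1) by auto
qed

text \<open>Being at \<open>y\<close> at the final time already violates avoidance of
  \<open>A\<close>. The number of steps is positive because time 0 is not tested.\<close>

lemma surv_le_kn: "x \<in> \<Omega> \<Longrightarrow> y \<in> A \<Longrightarrow> surv K A (Suc n) x \<le> 1 - pmf (kn K (Suc n) x) y"
proof (induction n arbitrary: x)
  case 0
  have "surv K A 1 x + pmf (K x) y \<le> (\<Sum>w\<in>insert y (set_pmf (K x) - A). pmf (K x) w)"
    using fin[OF 0(1)] 0(2) by simp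
  also have "\<dots> \<le> 1" using fin[OF 0(1)] by (intro sum_K_le) auto
  finally show ?case by simp
next
  case (Suc n)
  have "surv K A (Suc (Suc n)) x \<le> (\<Sum>v\<in>set_pmf (K x). pmf (K x) v * surv K A (Suc n) v)"
    unfolding surv.simps(2)[of K A "Suc n"] using fin[OF Suc.prems(1)]
    by (intro sum_mono2) (auto intro!: mult_nonneg_nonneg surv_nonneg simp del: surv.simps)
  also have "\<dots> \<le> (\<Sum>v\<in>set_pmf (K x). pmf (K x) v * (1 - pmf (kn K (Suc n) v) y))"
    using Suc.IH Suc.prems closed[OF Suc.prems(1)] by (intro sum_mono mult_left_mono) (auto simp del: surv.simps kn.simps)
  also have "\<dots> = 1 - (\<Sum>v\<in>set_pmf (K x). pmf (K x) v * pmf (kn K (Suc n) v) y)"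
    using sum_K[OF Suc.prems(1)] by (simp add: right_diff_distrib sum_subtractf del: kn.simps)
  also have "\<dots> = 1 - pmf (kn K (Suc (Suc n)) x) y" by (simp only: pmf_kn_Suc[OF Suc.prems(1)])
  finally show ?case .
qed

lemma dead_finite:
  assumes X: "X \<subseteq> \<Omega>" "\<And>x y. x \<in> X \<Longrightarrow> y \<in> set_pmf (K x) \<Longrightarrow> y \<notin> B \<Longrightarrow> y \<in> X"
    and finX: "finite X"
    and reach: "\<And>x. x \<in> X \<Longrightarrow> \<exists>n. \<exists>y\<in>B. (x, y) \<in> T ^^ Suc n"
    and x: "x \<in> X"
  shows "dead K B x"
proof -
  have "\<exists>n. surv K B n x < 1" if x: "x \<in> X" for x
  proof -
    obtain n y where y: "y \<in> B" "(x, y) \<in> T ^^ Suc n" using reach[OF x] by blast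
    have "x \<in> \<Omega>" using x X(1) by blast
    then have "surv K B (Suc n) x < 1"
      using surv_le_kn[of x y B n] pmf_kn_pos[of x y "Suc n"] y by linarith
    then show ?thesis by blast
  qed
  then obtain N where N: "\<And>x. x \<in> X \<Longrightarrow> surv K B (N x) x < 1" by metis
  define \<delta> where "\<delta> = (MIN x\<in>X. 1 - surv K B (N x) x)"
  have d: "\<delta> > 0" unfolding \<delta>_def using finX x N by (subst Min_gr_iff) auto
  have e: "\<exists>n. surv K B n x \<le> 1 - \<delta>" if "x \<in> X" for x
  proof -
    have "\<delta> \<le> 1 - surv K B (N x) x" unfolding \<delta>_def using finX that by (intro Min_le) auto
    then show ?thesis by (intro exI[of _ "N x"]) simp
  qed
  show ?thesis by (rule dead_uniform[OF X d e x])
qed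

text \<open>Hitting chances multiply: enter \<open>B\<close> within \<open>n\<close> steps, then
  \<open>A\<close> within \<open>m\<close> more. Only the states through which \<open>B\<close> is
  entered from \<open>X\<close> need the bound.\<close>

lemma surv_through:
  assumes X: "X \<subseteq> \<Omega>" "\<And>x y. x \<in> X \<Longrightarrow> y \<in> set_pmf (K x) \<Longrightarrow> y \<notin> B \<Longrightarrow> y \<in> X"
    and B: "\<And>x y. x \<in> X \<Longrightarrow> y \<in> set_pmf (K x) \<Longrightarrow> y \<in> B \<Longrightarrow> surv K A m y \<le> 1 - \<delta>"
    and \<delta>: "\<delta> \<ge> 0"
  shows "x \<in> X \<Longrightarrow> surv K A (n + m) x \<le> 1 - (1 - surv K B n x) * \<delta>"
proof (induction n arbitrary: x)
  case 0
  then show ?case using surv_le_1 X(1) by auto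
next
  case (Suc n)
  let ?S = "set_pmf (K x)" and ?s = "\<lambda>y. if y \<in> B then 0 else surv K B n y"
  have x: "x \<in> \<Omega>" using Suc.prems X(1) by auto
  have "surv K A (Suc n + m) x \<le> (\<Sum>y\<in>?S. pmf (K x) y * surv K A (n + m) y)"
    using fin[OF x] by (simp, intro sum_mono2) (auto intro!: mult_nonneg_nonneg surv_nonneg)
  also have "\<dots> \<le> (\<Sum>y\<in>?S. pmf (K x) y * (1 - (1 - ?s y) * \<delta>))"
  proof (intro sum_mono mult_left_mono)
    fix y assume y: "y \<in> ?S"
    show "surv K A (n + m) y \<le> 1 - (1 - ?s y) * \<delta>"
    proof (cases "y \<in> B")
      case True
      have "surv K A (n + m) y \<le> surv K A m y"
        using surv_antimono[of m "n + m" y] y x closed by auto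
      then show ?thesis using B[OF Suc.prems y True] True by simp
    next
      case False
      then show ?thesis using Suc.IH X(2)[OF Suc.prems y] by auto
    qed
  qed simp
  also have "\<dots> = (\<Sum>y\<in>?S. pmf (K x) y) * (1 - \<delta>) + (\<Sum>y\<in>?S. pmf (K x) y * ?s y) * \<delta>"
    by (simp only: sum_distrib_right sum.distrib[symmetric]) (intro sum.cong, auto simp: algebra_simps)
  also have "(\<Sum>y\<in>?S. pmf (K x) y * ?s y) = surv K B (Suc n) x"
    using fin[OF x] unfolding surv.simps
    by (intro sum.mono_neutral_cong_right) auto
  finally show ?case using sum_K[OF x] by (simp add: algebra_simps)
qed

end

subsection \<open>Walks as Markov chains on windows\<close>

text \<open>The last \<open>k + 1\<close> positions. For \<open>t < k\<close> the subtraction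
  truncates and the window is the shorter complete history; full windows need
  \<open>k \<le> t\<close>.\<close>

definition win :: "nat \<Rightarrow> nat \<Rightarrow> (nat \<Rightarrow> 'a) \<Rightarrow> 'a list" where
  "win k t x = map x [t - k..<Suc t]"

lemma win_cong: "(\<And>i. i \<le> t \<Longrightarrow> x i = y i) \<Longrightarrow> win k t x = win k t y"
  by (auto simp: win_def)

lemma last_win [simp]: "last (win k t x) = x t"
  by (simp add: win_def)

lemma win_Suc:
  assumes "k \<le> t"
  shows "win k (Suc t) x = tl (win k t x) @ [x (Suc t)]"
proof -
  have "[t - k..<Suc t] = (t - k) # [Suc t - k..<Suc t]"
    using assms by (metis Suc_diff_le diff_le_self le_imp_less_Suc upt_conv_Cons)
  moreover have "[Suc t - k..<Suc (Suc t)] = [Suc t - k..<Suc t] @ [Suc t]"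
    using assms by simp
  ultimately show ?thesis unfolding win_def by (simp del: upt_Suc)
qed

lemma set_win: "set (win k t x) = x ` {t - k..t}"
  by (auto simp: win_def simp del: upt_Suc)

text \<open>Histories that have positive probability up to time \<open>t\<close>; later values are
  unconstrained.\<close>

definition valid :: "'a step \<Rightarrow> 'a \<Rightarrow> nat \<Rightarrow> (nat \<Rightarrow> 'a) \<Rightarrow> bool" where
  "valid step u t y \<longleftrightarrow> y 0 = u \<and> (\<forall>i<t. y (Suc i) \<in> set_pmf (step i y))"

text \<open>Links a walk with memory to a chain on windows. Agreement is demanded only on histories
  of positive probability and once the window is full, because the memory is shorter before
  that.\<close>

locale window_walk = fin_chain K \<Omega> for K :: "'a list \<Rightarrow> 'a list pmf" and \<Omega> +
  fixes V :: "'a set" and step :: "'a step" and u :: 'a and k :: nat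
  assumes V: "countable V" "u \<in> V"
    and step: "\<And>t x. (\<And>i. i \<le> t \<Longrightarrow> x i \<in> V) \<Longrightarrow> set_pmf (step t x) \<subseteq> V"
    and past: "\<And>t x x'. (\<And>i. i \<le> t \<Longrightarrow> x i = x' i) \<Longrightarrow> step t x = step t x'"
    and fin_step: "\<And>t x. (\<And>i. i \<le> t \<Longrightarrow> x i \<in> V) \<Longrightarrow> finite (set_pmf (step t x))"
    and win_in: "\<And>t x. valid step u t x \<Longrightarrow> k \<le> t \<Longrightarrow> win k t x \<in> \<Omega>"
    and win_step: "\<And>t x. valid step u t x \<Longrightarrow> k \<le> t \<Longrightarrow>
        K (win k t x) = map_pmf (\<lambda>v. tl (win k t x) @ [v]) (step t x)"
begin

definition M :: "(nat \<Rightarrow> 'a) measure" where "M = walk_law V step u"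

definition cyl :: "nat \<Rightarrow> (nat \<Rightarrow> 'a) \<Rightarrow> (nat \<Rightarrow> 'a) set" where
  "cyl t y = {x \<in> space M. \<forall>i\<le>t. x i = y i}"

lemma space_M: "space M = UNIV \<rightarrow>\<^sub>E V" and sets_M: "sets M = sets (PiM UNIV (\<lambda>_. count_space V))"
proof -
  interpret IT: Ionescu_Tulcea "walk_kernel V step u" "\<lambda>_. count_space V"
    by (rule Ionescu_Tulcea_walk_kernel[OF V step])
  show "space M = UNIV \<rightarrow>\<^sub>E V" by (simp add: M_def walk_law_def space_PiM)
  show "sets M = sets (PiM UNIV (\<lambda>_. count_space V))" by (simp add: M_def walk_law_def)
qed

lemma prob_space_M: "prob_space M"
proof
  interpret IT: Ionescu_Tulcea "walk_kernel V step u" "\<lambda>_. count_space V"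
    by (rule Ionescu_Tulcea_walk_kernel[OF V step])
  let ?J = "{0::nat}"
  let ?X = "space (PiM ?J (\<lambda>_. count_space V))"
  have "IT.PF.emb UNIV ?J ?X = space M"
    by (auto simp: prod_emb_def space_PiM space_M)
  then have "emeasure M (space M) = emeasure (IT.CI ?J) ?X"
    using IT.lim[of ?J ?X] by (simp add: M_def walk_law_def)
  also have "\<dots> = 1"
    using prob_space.emeasure_space_1[OF IT.PF.prob_space_P[of ?J]]
    by (simp add: IT.PF.space_P)
  finally show "emeasure M (space M) = 1" .
qed

sublocale P: prob_space M by (rule prob_space_M)

lemma coord_measurable [measurable]: "(\<lambda>x. x i) \<in> measurable M (count_space V)"
  unfolding measurable_cong_sets[OF sets_M refl] by (rule measurable_component_singleton) simp

lemma coord_sets [measurable]: "{x \<in> space M. x i = a} \<in> sets M"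
proof (cases "a \<in> V")
  case True
  have "(\<lambda>x. x i) -` {a} \<inter> space M \<in> sets M"
    using True by (intro measurable_sets[OF coord_measurable]) auto
  also have "(\<lambda>x. x i) -` {a} \<inter> space M = {x \<in> space M. x i = a}" by auto
  finally show ?thesis .
next
  case False
  then have "{x \<in> space M. x i = a} = {}" by (auto simp: space_M)
  then show ?thesis by simp
qed

lemma cyl_sets [measurable]: "cyl t y \<in> sets M"
  unfolding cyl_def by (intro sets.sets_Collect_countable_All sets.sets_Collect_imp) auto

lemma valid_V: "valid step u t y \<Longrightarrow> i \<le> t \<Longrightarrow> y i \<in> V"
proof (induction i rule: less_induct)
  case (less i)
  show ?case
  proof (cases i)
    case 0
    then show ?thesis using less V by (simp add: valid_def)
  next
    case (Suc j)
    have "set_pmf (step j y) \<subseteq> V" using less Suc by (intro step) auto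
    moreover have "y (Suc j) \<in> set_pmf (step j y)" using less Suc by (simp add: valid_def)
    ultimately show ?thesis using Suc by auto
  qed
qed

definition wt :: "nat \<Rightarrow> (nat \<Rightarrow> 'a) \<Rightarrow> real" where
  "wt t y = pmf (return_pmf u) (y 0) * (\<Prod>s<t. pmf (step s y) (y (Suc s)))"

lemma measure_cyl:
  assumes "\<And>i. i \<le> t \<Longrightarrow> y i \<in> V"
  shows "measure M (cyl t y) = wt t y"
proof -
  have "emeasure M (cyl t y) = ennreal (wt t y)"
    unfolding M_def cyl_def wt_def by (rule emeasure_walk_law[OF V step past assms])
  moreover have "wt t y \<ge> 0" by (auto simp: wt_def intro!: mult_nonneg_nonneg prod_nonneg)
  ultimately show ?thesis by (simp add: measure_def)
qed

lemma wt_pos: "valid step u t y \<Longrightarrow> wt t y > 0"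
  unfolding valid_def wt_def by (intro mult_pos_pos prod_pos) (auto intro: pmf_positive)

lemma wt_zero: "\<not> valid step u t y \<Longrightarrow> wt t y = 0"
  unfolding valid_def wt_def by (auto simp: pmf_return set_pmf_iff)

lemma valid_upd:
  assumes "valid step u t y" "w \<in> set_pmf (step t y)"
  shows "valid step u (Suc t) (y(Suc t := w))"
proof -
  have "step i (y(Suc t := w)) = step i y" if "i \<le> t" for i using that by (intro past) auto
  then show ?thesis using assms unfolding valid_def by (auto simp: less_Suc_eq)
qed

lemma wt_upd:
  "wt (Suc t) (y(Suc t := w)) = wt t y * pmf (step t y) w"
proof -
  have s: "step i (y(Suc t := w)) = step i y" if "i \<le> t" for i using that by (intro past) auto
  have "(\<Prod>s<t. pmf (step s (y(Suc t := w))) ((y(Suc t := w)) (Suc s))) =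
        (\<Prod>s<t. pmf (step s y) (y (Suc s)))"
    by (intro prod.cong refl) (auto simp: s)
  then show ?thesis by (simp add: wt_def s)
qed

text \<open>The step probabilities sum to one, so the extensions by a possible next position exhaust
  the measure of the cylinder; the rest of it is a null set.\<close>

lemma measure_split:
  assumes v: "valid step u t y" and E: "E \<in> sets M"
  shows "measure M (cyl t y \<inter> E) =
     (\<Sum>w\<in>set_pmf (step t y). measure M (cyl (Suc t) (y(Suc t := w)) \<inter> E))"
proof -
  let ?S = "set_pmf (step t y)" and ?c = "\<lambda>w. cyl (Suc t) (y(Suc t := w))"
  have yV: "\<And>i. i \<le> t \<Longrightarrow> y i \<in> V" using v valid_V by blast
  have finS: "finite ?S" by (rule fin_step[OF yV])
  have SV: "?S \<subseteq> V" by (rule step[OF yV])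
  have disj: "disjoint_family_on ?c ?S"
    by (auto simp: disjoint_family_on_def cyl_def)
  have sub: "(\<Union>w\<in>?S. ?c w) \<subseteq> cyl t y"
    by (auto simp: cyl_def)
  have "measure M (\<Union>w\<in>?S. ?c w) = (\<Sum>w\<in>?S. measure M (?c w))"
    using finS disj by (intro P.finite_measure_finite_Union) auto
  also have "\<dots> = (\<Sum>w\<in>?S. wt t y * pmf (step t y) w)"
  proof (intro sum.cong refl)
    fix w assume "w \<in> ?S"
    then have "measure M (?c w) = wt (Suc t) (y(Suc t := w))"
      using yV SV by (intro measure_cyl) (auto simp: le_Suc_eq)
    then show "measure M (?c w) = wt t y * pmf (step t y) w" by (simp add: wt_upd)
  qed
  also have "\<dots> = measure M (cyl t y)"
    using finS by (simp add: sum_distrib_left[symmetric] sum_pmf_eq_1 measure_cyl yV)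
  finally have eq: "measure M (\<Union>w\<in>?S. ?c w) = measure M (cyl t y)" .
  have U: "(\<Union>w\<in>?S. ?c w) \<in> sets M" using finS by auto
  have null: "measure M (cyl t y - (\<Union>w\<in>?S. ?c w)) = 0"
    using P.finite_measure_Diff[OF _ U sub] eq by simp
  have "measure M (cyl t y \<inter> E) \<le> measure M ((\<Union>w\<in>?S. ?c w) \<inter> E \<union> (cyl t y - (\<Union>w\<in>?S. ?c w)))"
    using U E by (intro P.finite_measure_mono) auto
  also have "\<dots> \<le> measure M ((\<Union>w\<in>?S. ?c w) \<inter> E) + measure M (cyl t y - (\<Union>w\<in>?S. ?c w))"
    using U E by (intro measure_Un_le) auto
  finally have "measure M (cyl t y \<inter> E) \<le> measure M ((\<Union>w\<in>?S. ?c w) \<inter> E)" using null by simp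
  moreover have "measure M ((\<Union>w\<in>?S. ?c w) \<inter> E) \<le> measure M (cyl t y \<inter> E)"
    using sub E by (intro P.finite_measure_mono) auto
  moreover have "measure M (\<Union>w\<in>?S. ?c w \<inter> E) = (\<Sum>w\<in>?S. measure M (?c w \<inter> E))"
    using finS disj E by (intro P.finite_measure_finite_Union) (auto simp: disjoint_family_on_def)
  ultimately show ?thesis by (simp add: Int_UN_distrib2)
qed

lemma sum_K_win:
  assumes v: "valid step u t y" "k \<le> t"
  shows "(\<Sum>\<gamma>\<in>set_pmf (K (win k t y)) - A. pmf (K (win k t y)) \<gamma> * f \<gamma>) =
    (\<Sum>w\<in>set_pmf (step t y). if win k (Suc t) (y(Suc t := w)) \<in> A then 0
       else pmf (step t y) w * f (win k (Suc t) (y(Suc t := w))))"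
proof -
  let ?g = "\<lambda>w. tl (win k t y) @ [w]" and ?S = "set_pmf (step t y)"
  have yV: "\<And>i. i \<le> t \<Longrightarrow> y i \<in> V" using v valid_V by blast
  have finS: "finite ?S" by (rule fin_step[OF yV])
  have inj: "inj ?g" by (auto simp: inj_def)
  have w: "win k (Suc t) (y(Suc t := w)) = ?g w" for w
    using win_Suc[OF v(2), of "y(Suc t := w)"] win_cong[of t "y(Suc t := w)" y k] by simp
  have "(\<Sum>\<gamma>\<in>set_pmf (K (win k t y)) - A. pmf (K (win k t y)) \<gamma> * f \<gamma>) =
     (\<Sum>\<gamma>\<in>?g ` ?S. if \<gamma> \<in> A then 0 else pmf (K (win k t y)) \<gamma> * f \<gamma>)"
    using finS by (intro sum.mono_neutral_cong_left) (auto simp: win_step[OF v])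
  also have "\<dots> = (\<Sum>w\<in>?S. if ?g w \<in> A then 0 else pmf (K (win k t y)) (?g w) * f (?g w))"
    by (subst sum.reindex) (auto intro: inj_on_subset[OF inj] simp: o_def)
  also have "\<dots> = (\<Sum>w\<in>?S. if ?g w \<in> A then 0 else pmf (step t y) w * f (?g w))"
    by (intro sum.cong refl) (simp add: win_step[OF v] pmf_map_inj'[OF inj])
  finally show ?thesis by (simp only: w)
qed

lemma win_sets [measurable]: "{x \<in> space M. v \<in> set (win k t x)} \<in> sets M"
proof -
  have "{x \<in> space M. v \<in> set (win k t x)} = (\<Union>i\<in>{t - k..t}. {x \<in> space M. x i = v})"
    by (auto simp: set_win)
  then show ?thesis by simp
qed

definition avoid :: "'a \<Rightarrow> nat \<Rightarrow> nat \<Rightarrow> (nat \<Rightarrow> 'a) set" where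
  "avoid v t n = {x \<in> space M. \<forall>s\<in>{t<..t+n}. v \<notin> set (win k s x)}"

lemma avoid_sets [measurable]: "avoid v t n \<in> sets M"
proof -
  have "avoid v t n = space M - (\<Union>s\<in>{t<..t+n}. {x \<in> space M. v \<in> set (win k s x)})"
    by (auto simp: avoid_def)
  then show ?thesis by simp
qed

text \<open>Only windows after time \<open>t\<close> are tested, which matches the convention of
  \<open>surv\<close> to ignore the starting state.\<close>

lemma measure_avoid:
  "valid step u t y \<Longrightarrow> k \<le> t \<Longrightarrow>
    measure M (cyl t y \<inter> avoid v t n) = wt t y * surv K {\<gamma>. v \<in> set \<gamma>} n (win k t y)"
proof (induction n arbitrary: t y)
  case 0
  have "cyl t y \<inter> avoid v t 0 = cyl t y" by (auto simp: avoid_def cyl_def)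
  then show ?case using 0 valid_V by (simp add: measure_cyl)
next
  case (Suc n)
  let ?A = "{\<gamma>. v \<in> set \<gamma>}" and ?y = "\<lambda>w. y(Suc t := w)"
  have "measure M (cyl t y \<inter> avoid v t (Suc n)) =
     (\<Sum>w\<in>set_pmf (step t y). measure M (cyl (Suc t) (?y w) \<inter> avoid v t (Suc n)))"
    using Suc.prems by (intro measure_split) auto
  also have "\<dots> = (\<Sum>w\<in>set_pmf (step t y). wt t y * (if win k (Suc t) (?y w) \<in> ?A then 0
       else pmf (step t y) w * surv K ?A n (win k (Suc t) (?y w))))"
  proof (intro sum.cong refl)
    fix w assume w: "w \<in> set_pmf (step t y)"
    have c: "win k (Suc t) x = win k (Suc t) (?y w)" if "x \<in> cyl (Suc t) (?y w)" for x
      using that by (intro win_cong) (auto simp: cyl_def)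
    have i: "{t<..t + Suc n} = insert (Suc t) {Suc t<..Suc t + n}" by auto
    show "measure M (cyl (Suc t) (?y w) \<inter> avoid v t (Suc n)) =
        wt t y * (if win k (Suc t) (?y w) \<in> ?A then 0
          else pmf (step t y) w * surv K ?A n (win k (Suc t) (?y w)))"
    proof (cases "win k (Suc t) (?y w) \<in> ?A")
      case True
      then have "cyl (Suc t) (?y w) \<inter> avoid v t (Suc n) = {}"
        using c unfolding avoid_def i by (simp add: disjoint_iff)
      then show ?thesis using True by simp
    next
      case False
      then have e: "cyl (Suc t) (?y w) \<inter> avoid v t (Suc n) = cyl (Suc t) (?y w) \<inter> avoid v (Suc t) n"
        using c unfolding avoid_def i by auto
      show ?thesis unfolding e
        using Suc.IH[OF valid_upd[OF Suc.prems(1) w]] Suc.prems(2) False wt_upd[of t y w]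
        by (simp del: fun_upd_apply add: fun_upd_def[symmetric])
    qed
  qed
  also have "\<dots> = wt t y * surv K ?A (Suc n) (win k t y)"
    unfolding surv.simps sum_K_win[OF Suc.prems] by (simp add: sum_distrib_left)
  finally show ?case .
qed

lemma measure_at:
  "valid step u t y \<Longrightarrow> k \<le> t \<Longrightarrow>
    measure M (cyl t y \<inter> {x \<in> space M. x (t + n) = v}) =
      wt t y * measure (measure_pmf (kn K n (win k t y))) {\<gamma>. last \<gamma> = v}"
proof (induction n arbitrary: t y)
  case 0
  have "cyl t y \<inter> {x \<in> space M. x (t + 0) = v} = (if y t = v then cyl t y else {})"
    by (auto simp: cyl_def)
  then show ?case using 0 valid_V by (simp add: measure_cyl measure_return_pmf)
next
  case (Suc n)
  let ?E = "{x \<in> space M. x (t + Suc n) = v}" and ?y = "\<lambda>w. y(Suc t := w)"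
  let ?A = "{\<gamma>. last \<gamma> = v}"
  have "measure M (cyl t y \<inter> ?E) = (\<Sum>w\<in>set_pmf (step t y). measure M (cyl (Suc t) (?y w) \<inter> ?E))"
    using Suc.prems by (intro measure_split) auto
  also have "\<dots> = (\<Sum>w\<in>set_pmf (step t y). wt t y * (if win k (Suc t) (?y w) \<in> {} then 0
       else pmf (step t y) w * measure (measure_pmf (kn K n (win k (Suc t) (?y w)))) ?A))"
  proof (intro sum.cong refl)
    fix w assume w: "w \<in> set_pmf (step t y)"
    show "measure M (cyl (Suc t) (?y w) \<inter> ?E) = wt t y * (if win k (Suc t) (?y w) \<in> {} then 0
       else pmf (step t y) w * measure (measure_pmf (kn K n (win k (Suc t) (?y w)))) ?A)"
      using Suc.IH[OF valid_upd[OF Suc.prems(1) w]] Suc.prems(2) wt_upd[of t y w] by (simp del: fun_upd_apply add: fun_upd_def[symmetric])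
  qed
  also have "\<dots> = wt t y * (\<Sum>\<gamma>\<in>set_pmf (K (win k t y)) - {}.
      pmf (K (win k t y)) \<gamma> * measure (measure_pmf (kn K n \<gamma>)) ?A)"
    unfolding sum_K_win[OF Suc.prems] by (simp add: sum_distrib_left)
  also have "(\<Sum>\<gamma>\<in>set_pmf (K (win k t y)) - {}.
      pmf (K (win k t y)) \<gamma> * measure (measure_pmf (kn K n \<gamma>)) ?A) =
      measure_pmf.expectation (K (win k t y)) (\<lambda>\<gamma>. measure (measure_pmf (kn K n \<gamma>)) ?A)"
    using fin[OF win_in[OF Suc.prems]]
    by (subst integral_measure_pmf_real[of "set_pmf (K (win k t y))"]) (auto simp: mult.commute)
  also have "\<dots> = measure (measure_pmf (kn K (Suc n) (win k t y))) ?A"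
    by (simp add: measure_pmf_bind) (subst measure_pmf.measure_bind[where N="count_space UNIV"], auto simp: space_subprob_algebra measure_pmf.subprob_space_axioms)
  finally show ?case .
qed

text \<open>There are countably many histories up to a given time, so almost surely some window
  after each late time contains \<open>v\<close>. All histories of positive probability must be
  covered, as the conclusion is an almost sure statement.\<close>

lemma recurrentI:
  assumes t0: "\<And>t y. t \<ge> t0 \<Longrightarrow> valid step u t y \<Longrightarrow> k \<le> t \<Longrightarrow> dead K {\<gamma>. v \<in> set \<gamma>} (win k t y)"
  shows "AE x in walk_law V step u. \<exists>\<^sub>\<infinity>t. x t = v"
proof -
  define bad where "bad t = (\<Inter>n. avoid v t n)" for t
  have null: "cyl t y \<inter> bad t \<in> null_sets M" if t: "t \<ge> t0" "k \<le> t" and yV: "\<And>i. i \<le> t \<Longrightarrow> y i \<in> V" for t y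
  proof -
    have s: "cyl t y \<inter> bad t \<in> sets M" unfolding bad_def by (intro sets.Int sets.countable_INT) auto
    have "measure M (cyl t y \<inter> bad t) \<le> 0"
    proof (cases "valid step u t y")
      case False
      have "measure M (cyl t y \<inter> bad t) \<le> measure M (cyl t y)" by (intro P.finite_measure_mono) auto
      then show ?thesis using False by (simp add: measure_cyl yV wt_zero)
    next
      case True
      have "measure M (cyl t y \<inter> bad t) \<le> wt t y * surv K {\<gamma>. v \<in> set \<gamma>} n (win k t y)" for n
        unfolding measure_avoid[OF True t(2), symmetric] bad_def
        by (intro P.finite_measure_mono) auto
      moreover have "(\<lambda>n. wt t y * surv K {\<gamma>. v \<in> set \<gamma>} n (win k t y)) \<longlonglongrightarrow> wt t y * 0"
        using t0[OF t(1) True t(2)] unfolding dead_def by (intro tendsto_mult tendsto_const)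
      ultimately show ?thesis
        by (intro LIMSEQ_le_const[of "\<lambda>n. wt t y * surv K {\<gamma>. v \<in> set \<gamma>} n (win k t y)"]) auto
    qed
    then have "measure M (cyl t y \<inter> bad t) = 0" using measure_nonneg[of M "cyl t y \<inter> bad t"] by linarith
    then show ?thesis using s by (intro null_setsI) (simp_all add: P.emeasure_eq_measure)
  qed
  have "bad t \<in> null_sets M" if t: "t \<ge> t0" "k \<le> t" for t
  proof -
    have "bad t = (\<Union>y\<in>{..t} \<rightarrow>\<^sub>E V. cyl t y \<inter> bad t)"
    proof (intro equalityI subsetI)
      fix x assume x: "x \<in> bad t"
      then have "x \<in> space M" by (auto simp: bad_def avoid_def)
      then have "restrict x {..t} \<in> {..t} \<rightarrow>\<^sub>E V" "x \<in> cyl t (restrict x {..t})"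
        by (auto simp: space_M cyl_def)
      then show "x \<in> (\<Union>y\<in>{..t} \<rightarrow>\<^sub>E V. cyl t y \<inter> bad t)" using x by blast
    qed auto
    moreover have "(\<Union>y\<in>{..t} \<rightarrow>\<^sub>E V. cyl t y \<inter> bad t) \<in> null_sets M"
      using V(1) t by (intro null_sets_UN' null countable_PiE) auto
    ultimately show ?thesis by simp
  qed
  then have "AE x in M. \<forall>t. t \<ge> max t0 k \<longrightarrow> x \<notin> bad t"
    unfolding AE_all_countable by (auto intro: AE_not_in)
  then have "AE x in M. \<exists>\<^sub>\<infinity>t. x t = v"
  proof (rule AE_mp, intro AE_I2 impI)
    fix x assume x: "x \<in> space M" and b: "\<forall>t. t \<ge> max t0 k \<longrightarrow> x \<notin> bad t"
    show "\<exists>\<^sub>\<infinity>t. x t = v"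
      unfolding INFM_nat_le
    proof
      fix m
      \<comment> \<open>A window at time \<open>s\<close> may place the visit as early as
        \<open>s - k\<close>; the additional \<open>k\<close> keeps it at or after
        \<open>m\<close>.\<close>
      have "x \<notin> bad (max t0 k + m + k)" using b by simp
      then obtain s where s: "s > max t0 k + m + k" "v \<in> set (win k s x)"
        using x by (auto simp: bad_def avoid_def)
      then obtain i where "i \<ge> s - k" "x i = v" by (auto simp: set_win)
      then show "\<exists>n\<ge>m. x n = v" using s by (intro exI[of _ i]) auto
    qed
  qed
  then show ?thesis unfolding M_def .
qed

text \<open>One history of positive probability suffices: the visits to \<open>v\<close> that follow
  it have summable probabilities, so the first Borel-Cantelli lemma applies.\<close>

lemma not_recurrentI:
  assumes y: "valid step u t y" "k \<le> t"
    and sum: "summable (\<lambda>n. measure (measure_pmf (kn K n (win k t y))) {\<gamma>. last \<gamma> = v})"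
  shows "\<not> (AE x in walk_law V step u. \<exists>\<^sub>\<infinity>t. x t = v)"
proof
  assume "AE x in walk_law V step u. \<exists>\<^sub>\<infinity>t. x t = v"
  then have inf: "AE x in M. \<exists>\<^sub>\<infinity>t. x t = v" unfolding M_def .
  have "AE x in M. eventually (\<lambda>n. x \<in> space M - (cyl t y \<inter> {x \<in> space M. x (t + n) = v})) sequentially"
  proof (rule borel_cantelli_AE1)
    show "summable (\<lambda>n. measure M (cyl t y \<inter> {x \<in> space M. x (t + n) = v}))"
      unfolding measure_at[OF y] by (intro summable_mult sum)
  qed (auto simp: P.emeasure_eq_measure)
  with inf have "AE x in M. x \<notin> cyl t y"
  proof eventually_elim
    fix x assume i: "\<exists>\<^sub>\<infinity>t. x t = v"
      and e: "eventually (\<lambda>n. x \<in> space M - (cyl t y \<inter> {x \<in> space M. x (t + n) = v})) sequentially"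
    then obtain N where N: "\<And>n. n \<ge> N \<Longrightarrow> x \<in> space M - (cyl t y \<inter> {x \<in> space M. x (t + n) = v})"
      by (auto simp: eventually_sequentially)
    obtain s where s: "s \<ge> t + N" "x s = v" using i unfolding INFM_nat_le by blast
    have "x \<in> space M - (cyl t y \<inter> {x \<in> space M. x (t + (s - t)) = v})"
      by (rule N) (use s in linarith)
    then show "x \<notin> cyl t y" using s by auto
  qed
  then have "measure M (cyl t y) = 0"
    by (subst P.prob_eq_0) auto
  then show False using measure_cyl[of t y] valid_V[OF y(1)] wt_pos[OF y(1)] by simp
qed

end

subsection \<open>Dirichlet energies\<close>

text \<open>Bounding all finite partial sums avoids any summability condition.\<close>

definition energy_le :: "('s \<times> 's) set \<Rightarrow> ('s \<Rightarrow> real) \<Rightarrow> real \<Rightarrow> bool" where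
  "energy_le R f C \<longleftrightarrow> (\<forall>B. finite B \<and> B \<subseteq> R \<longrightarrow> (\<Sum>(x, y)\<in>B. (f x - f y)\<^sup>2) \<le> C)"

text \<open>Both degrees are bounded: in a composition, a pair of the first relation is reused once
  per successor of the midpoint, a pair of the second once per predecessor.\<close>

definition bdeg :: "('s \<times> 's) set \<Rightarrow> nat \<Rightarrow> bool" where
  "bdeg R m \<longleftrightarrow> (\<forall>x. finite (R `` {x}) \<and> card (R `` {x}) \<le> m \<and>
     finite (R\<inverse> `` {x}) \<and> card (R\<inverse> `` {x}) \<le> m)"

lemma bdegD:
  assumes "bdeg R m"
  shows "finite (R `` {x})" "card (R `` {x}) \<le> m" "finite (R\<inverse> `` {x})" "card (R\<inverse> `` {x}) \<le> m"
  using assms unfolding bdeg_def by blast+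

lemma energy_leD: "energy_le R f C \<Longrightarrow> finite B \<Longrightarrow> B \<subseteq> R \<Longrightarrow> (\<Sum>(x, y)\<in>B. (f x - f y)\<^sup>2) \<le> C"
  by (simp add: energy_le_def)

lemma energy_le_nonneg: "energy_le R f C \<Longrightarrow> C \<ge> 0"
  using energy_leD[of R f C "{}"] by simp

lemma energy_le_single: "energy_le R f C \<Longrightarrow> (x, y) \<in> R \<Longrightarrow> (f x - f y)\<^sup>2 \<le> C"
  using energy_leD[of R f C "{(x, y)}"] by simp

lemma energy_le_subset: "energy_le R f C \<Longrightarrow> R' \<subseteq> R \<Longrightarrow> energy_le R' f C"
  unfolding energy_le_def by blast

lemma sum_fibers_le:
  fixes F :: "'j \<Rightarrow> real"
  assumes "finite B" and F: "\<And>j. F j \<ge> 0"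
    and fib: "\<And>j. card {i \<in> B. \<phi> i = j} \<le> m"
  shows "(\<Sum>i\<in>B. F (\<phi> i)) \<le> real m * (\<Sum>j\<in>\<phi> ` B. F j)"
proof -
  have "(\<Sum>i\<in>B. F (\<phi> i)) = (\<Sum>j\<in>\<phi> ` B. \<Sum>i\<in>{i \<in> B. \<phi> i = j}. F (\<phi> i))"
    using assms(1) by (intro sum.group[symmetric]) auto
  also have "\<dots> = (\<Sum>j\<in>\<phi> ` B. real (card {i \<in> B. \<phi> i = j}) * F j)"
    by (intro sum.cong refl) simp
  also have "\<dots> \<le> (\<Sum>j\<in>\<phi> ` B. real m * F j)"
    using fib F by (intro sum_mono mult_right_mono) auto
  finally show ?thesis by (simp add: sum_distrib_left)
qed

lemma energy_fibers_le:
  assumes e: "energy_le R f C" and B: "finite B" "\<phi> ` B \<subseteq> R"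
    and fib: "\<And>j. card {i \<in> B. \<phi> i = j} \<le> m"
  shows "(\<Sum>i\<in>B. (f (fst (\<phi> i)) - f (snd (\<phi> i)))\<^sup>2) \<le> real m * C"
proof -
  have "(\<Sum>i\<in>B. (f (fst (\<phi> i)) - f (snd (\<phi> i)))\<^sup>2)
      \<le> real m * (\<Sum>j\<in>\<phi> ` B. (f (fst j) - f (snd j))\<^sup>2)"
    by (rule sum_fibers_le[OF B(1) _ fib]) simp
  also have "\<dots> \<le> real m * C"
    using energy_leD[OF e, of "\<phi> ` B"] B by (intro mult_left_mono) (auto simp: case_prod_unfold)
  finally show ?thesis .
qed

lemma energy_inj_le:
  assumes e: "energy_le R f C" and B: "finite B" "\<phi> ` B \<subseteq> R" and inj: "inj_on \<phi> B"
  shows "(\<Sum>i\<in>B. (f (fst (\<phi> i)) - f (snd (\<phi> i)))\<^sup>2) \<le> C"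
proof -
  have "card {i \<in> B. \<phi> i = j} \<le> 1" for j
  proof -
    have "{i \<in> B. \<phi> i = j} \<subseteq> {i}" if "i \<in> B" "\<phi> i = j" for i
      using inj that by (auto simp: inj_on_def)
    then have "{i \<in> B. \<phi> i = j} = {} \<or> (\<exists>i. {i \<in> B. \<phi> i = j} \<subseteq> {i})" by blast
    then show ?thesis using card_mono[of "{_}" "{i \<in> B. \<phi> i = j}"] by fastforce
  qed
  from energy_fibers_le[OF e B this] show ?thesis by simp
qed

lemma sq_diff_le: "((a::real) - c)\<^sup>2 \<le> 2 * (a - b)\<^sup>2 + 2 * (b - c)\<^sup>2"
proof -
  have "2 * (a - b)\<^sup>2 + 2 * (b - c)\<^sup>2 - (a - c)\<^sup>2 = (a - 2 * b + c)\<^sup>2"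
    by (simp add: power2_eq_square algebra_simps)
  then show ?thesis using zero_le_power2[of "a - 2 * b + c"] by linarith
qed

lemma sq_add_le: "((a::real) + b)\<^sup>2 \<le> 2 * a\<^sup>2 + 2 * b\<^sup>2"
  using sq_diff_le[of a "- b" 0] by simp

text \<open>Choose a midpoint for each pair. A given pair of \<open>R\<close> then serves at most
  \<open>m\<close> pairs of \<open>B\<close>, one for each possible endpoint, and likewise for
  \<open>S\<close>. The factor 2 comes from the square of a sum of two differences.\<close>

lemma energy_le_comp:
  assumes R: "bdeg R m" and S: "bdeg S m" and e: "energy_le R f C" "energy_le S f D"
  shows "energy_le (R O S) f (2 * real m * (C + D))"
  unfolding energy_le_def
proof (intro allI impI)
  fix B assume B: "finite B \<and> B \<subseteq> R O S"
  then have "\<exists>y. (fst i, y) \<in> R \<and> (y, snd i) \<in> S" if "i \<in> B" for i using that by fastforce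
  then obtain h where h: "\<And>i. i \<in> B \<Longrightarrow> (fst i, h i) \<in> R \<and> (h i, snd i) \<in> S" by metis
  let ?p = "\<lambda>i. (fst i, h i)" and ?q = "\<lambda>i. (h i, snd i)"
  have f1: "card {i \<in> B. ?p i = j} \<le> m" for j
  proof -
    have "{i \<in> B. ?p i = j} \<subseteq> (\<lambda>w. (fst j, w)) ` (S `` {snd j})"
      using h by force
    then have "card {i \<in> B. ?p i = j} \<le> card (S `` {snd j})"
      using S by (intro surj_card_le) (auto simp: bdeg_def)
    then show ?thesis using S by (meson bdeg_def le_trans)
  qed
  have f2: "card {i \<in> B. ?q i = j} \<le> m" for j
  proof -
    have "{i \<in> B. ?q i = j} \<subseteq> (\<lambda>w. (w, snd j)) ` (R\<inverse> `` {fst j})"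
      using h by force
    then have "card {i \<in> B. ?q i = j} \<le> card (R\<inverse> `` {fst j})"
      using R by (intro surj_card_le) (auto simp: bdeg_def)
    then show ?thesis using R by (meson bdeg_def le_trans)
  qed
  have "(\<Sum>(x, y)\<in>B. (f x - f y)\<^sup>2) \<le>
      (\<Sum>i\<in>B. 2 * (f (fst i) - f (h i))\<^sup>2 + 2 * (f (h i) - f (snd i))\<^sup>2)"
    by (intro sum_mono) (auto simp: case_prod_unfold intro: sq_diff_le)
  also have "\<dots> = 2 * (\<Sum>i\<in>B. (f (fst i) - f (h i))\<^sup>2) + 2 * (\<Sum>i\<in>B. (f (h i) - f (snd i))\<^sup>2)"
    by (simp add: sum.distrib sum_distrib_left)
  also have "\<dots> \<le> 2 * (real m * C) + 2 * (real m * D)"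
  proof (intro add_mono mult_left_mono)
    show "(\<Sum>i\<in>B. (f (fst i) - f (h i))\<^sup>2) \<le> real m * C"
      using energy_fibers_le[OF e(1) _ _ f1] B h by fastforce
    show "(\<Sum>i\<in>B. (f (h i) - f (snd i))\<^sup>2) \<le> real m * D"
      using energy_fibers_le[OF e(2) _ _ f2] B h by fastforce
  qed simp_all
  finally show "(\<Sum>(x, y)\<in>B. (f x - f y)\<^sup>2) \<le> 2 * real m * (C + D)"
    by (simp add: algebra_simps)
qed

lemma energy_le_Un:
  assumes "energy_le R f C" "energy_le S f D"
  shows "energy_le (R \<union> S) f (C + D)"
  unfolding energy_le_def
proof (intro allI impI)
  fix B assume B: "finite B \<and> B \<subseteq> R \<union> S"
  have "(\<Sum>(x, y)\<in>B. (f x - f y)\<^sup>2) = (\<Sum>(x, y)\<in>B \<inter> R. (f x - f y)\<^sup>2) + (\<Sum>(x, y)\<in>B - R. (f x - f y)\<^sup>2)"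
    using B by (subst sum.union_disjoint[symmetric]) (auto intro: sum.cong)
  also have "\<dots> \<le> C + D" using B assms by (intro add_mono energy_leD) auto
  finally show "(\<Sum>(x, y)\<in>B. (f x - f y)\<^sup>2) \<le> C + D" .
qed

lemma energy_le_converse:
  assumes "energy_le R f C"
  shows "energy_le (R\<inverse>) f C"
  unfolding energy_le_def
proof (intro allI impI)
  fix B assume B: "finite B \<and> B \<subseteq> R\<inverse>"
  have "(\<Sum>i\<in>B. (f (fst (prod.swap i)) - f (snd (prod.swap i)))\<^sup>2) \<le> C"
    using B by (intro energy_inj_le[OF assms]) auto
  then show "(\<Sum>(x, y)\<in>B. (f x - f y)\<^sup>2) \<le> C"
    by (simp add: case_prod_unfold power2_commute)
qed

lemma bdeg_comp:
  assumes R: "bdeg R m" and S: "bdeg S n"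
  shows "bdeg (R O S) (m * n)"
proof -
  have *: "finite (A `` {x}) \<Longrightarrow> card (A `` {x}) \<le> m \<Longrightarrow> (\<And>y. finite (B `` {y}) \<and> card (B `` {y}) \<le> n)
    \<Longrightarrow> finite ((A O B) `` {x}) \<and> card ((A O B) `` {x}) \<le> m * n" for A B :: "('a \<times> 'a) set" and x m n
  proof -
    assume A: "finite (A `` {x})" "card (A `` {x}) \<le> m"
      and B: "\<And>y. finite (B `` {y}) \<and> card (B `` {y}) \<le> n"
    have e: "(A O B) `` {x} = (\<Union>y\<in>A `` {x}. B `` {y})" by auto
    have "card ((A O B) `` {x}) \<le> (\<Sum>y\<in>A `` {x}. card (B `` {y}))"
      unfolding e by (rule card_UN_le[OF A(1)])
    also have "\<dots> \<le> card (A `` {x}) * n" using B sum_bounded_above[of "A `` {x}" "\<lambda>y. card (B `` {y})" n] by simp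
    also have "\<dots> \<le> m * n" using A by simp
    finally show ?thesis using A B e by auto
  qed
  show ?thesis
    unfolding bdeg_def converse_relcomp
    using *[of R _ m S n] *[of "S\<inverse>" _ n "R\<inverse>" m] R S
    by (simp add: bdeg_def mult.commute)
qed

lemma bdeg_mono: "bdeg R m \<Longrightarrow> m \<le> n \<Longrightarrow> bdeg R n"
  unfolding bdeg_def by (meson le_trans)

lemma bdeg_subset: "bdeg R m \<Longrightarrow> R' \<subseteq> R \<Longrightarrow> bdeg R' m"
  unfolding bdeg_def
  by (meson Image_mono card_mono converse_mono finite_subset le_trans subset_refl)

lemma bdeg_converse: "bdeg R m \<Longrightarrow> bdeg (R\<inverse>) m"
  by (auto simp: bdeg_def)

lemma bdeg_Un:
  assumes "bdeg R m" "bdeg S n"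
  shows "bdeg (R \<union> S) (m + n)"
proof -
  have *: "card A \<le> m \<Longrightarrow> card B \<le> n \<Longrightarrow> card (A \<union> B) \<le> m + n" for A B :: "'a set"
    using card_Un_le[of A B] by linarith
  show ?thesis
    unfolding bdeg_def converse_Un Un_Image
    by (intro allI conjI finite_UnI * bdegD[OF assms(1)] bdegD[OF assms(2)])
qed

text \<open>Uniformity in \<open>f\<close> and \<open>C\<close> is the point: a detour of bounded
  length costs a constant factor in every energy inequality.\<close>

lemma energy_le_steps:
  assumes "bdeg R m"
  shows "\<exists>c n. c \<ge> 0 \<and> bdeg (\<Union>i\<le>N. R ^^ i) n \<and>
    (\<forall>f C. energy_le R f C \<longrightarrow> energy_le (\<Union>i\<le>N. R ^^ i) f (c * C))"
proof (induction N)
  case 0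
  have "bdeg (\<Union>i\<le>0. R ^^ i) 1" by (simp add: bdeg_def)
  moreover have "energy_le (\<Union>i\<le>0. R ^^ i) f (0 * C)" for f C
    by (auto simp: energy_le_def case_prod_unfold intro!: sum_nonpos)
  ultimately show ?case by (intro exI[of _ 0] exI[of _ 1]) auto
next
  case (Suc N)
  let ?U = "\<Union>i\<le>N. R ^^ i"
  obtain c n where c: "c \<ge> 0" and n: "bdeg ?U n"
    and e: "\<And>f C. energy_le R f C \<Longrightarrow> energy_le ?U f (c * C)" using Suc by blast
  have sub: "(\<Union>i\<le>Suc N. R ^^ i) \<subseteq> ?U \<union> ?U O R"
    by (auto simp: atMost_Suc)
  let ?l = "max m n"
  have b: "bdeg (?U \<union> ?U O R) (n + n * m)" by (intro bdeg_Un bdeg_comp n assms)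
  have "energy_le (\<Union>i\<le>Suc N. R ^^ i) f ((c + 2 * real ?l * (c + 1)) * C)" if f: "energy_le R f C" for f C
  proof -
    have "energy_le (?U \<union> ?U O R) f (c * C + 2 * real ?l * (c * C + C))"
      by (intro energy_le_Un energy_le_comp e f bdeg_mono[OF n] bdeg_mono[OF assms]) auto
    then have "energy_le (\<Union>i\<le>Suc N. R ^^ i) f (c * C + 2 * real ?l * (c * C + C))"
      using sub by (rule energy_le_subset)
    then show ?thesis by (simp add: algebra_simps)
  qed
  then show ?case using bdeg_subset[OF b sub] c
    by (intro exI[of _ "c + 2 * real ?l * (c + 1)"] exI[of _ "n + n * m"]) auto
qed

section \<open>Energy of the truncated Green function\<close>

context fin_chain
begin

lemma finite_green_support:
  assumes "bdeg T m"
  shows "finite {x \<in> \<Omega>. green K n x z \<noteq> 0}"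
proof -
  obtain c l where "bdeg (\<Union>i\<le>n. T ^^ i) l" using energy_le_steps[OF assms, of n] by blast
  then have "finite ((\<Union>i\<le>n. T ^^ i)\<inverse> `` {z})" by (simp add: bdeg_def)
  moreover have "{x \<in> \<Omega>. green K n x z \<noteq> 0} \<subseteq> (\<Union>i\<le>n. T ^^ i)\<inverse> `` {z}"
  proof
    fix x assume "x \<in> {x \<in> \<Omega>. green K n x z \<noteq> 0}"
    then have x: "x \<in> \<Omega>" "green K n x z \<noteq> 0" by auto
    then obtain i where "i \<le> n" "pmf (kn K i x) z \<noteq> 0"
      unfolding green_def by (auto elim: sum.not_neutral_contains_not_neutral)
    then have "(x, z) \<in> T ^^ i" using set_kn[OF x(1), of z i] unfolding set_pmf_iff by blast
    then show "x \<in> (\<Union>i\<le>n. T ^^ i)\<inverse> `` {z}" using \<open>i \<le> n\<close> by blast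
  qed
  ultimately show ?thesis by (rule rev_finite_subset)
qed

text \<open>Expanding the square leaves two diagonal terms, each at most the weighted square sum of
  the Green function up to \<eta>, minus twice its pairing with its average. Truncation preserves
  the inequality that the function is at most the indicator of \<open>z\<close> plus its average,
  which bounds this pairing from below. \<eta> measures how far \<pi> is from being
  invariant.\<close>

lemma green_energy:
  assumes z: "z \<in> \<Omega>" and S: "finite S" "S \<subseteq> \<Omega>" "z \<in> S"
    and supp: "{x \<in> \<Omega>. green K n x z \<noteq> 0} \<subseteq> S"
    and \<pi>: "\<And>x. x \<in> S \<Longrightarrow> \<pi> x \<ge> 0"
    and inflow: "\<And>y. y \<in> S \<Longrightarrow> (\<Sum>x\<in>S. \<pi> x * pmf (K x) y) \<le> \<pi> y + \<eta>"
  shows "(\<Sum>x\<in>S. \<Sum>y\<in>S. \<pi> x * pmf (K x) y * (green K n x z - green K n y z)\<^sup>2)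
      \<le> 2 * \<pi> z * green K n z z + \<eta> * (\<Sum>x\<in>S. (green K n x z)\<^sup>2)"
proof -
  let ?f = "\<lambda>x. green K n x z" and ?p = "\<lambda>x y. pmf (K x) y"
  have f0: "?f x \<ge> 0" for x by (rule green_nonneg)
  have "(\<Sum>x\<in>S. \<Sum>y\<in>S. \<pi> x * ?p x y * (?f x - ?f y)\<^sup>2) =
      (\<Sum>x\<in>S. \<Sum>y\<in>S. \<pi> x * (?f x)\<^sup>2 * ?p x y) + (\<Sum>x\<in>S. \<Sum>y\<in>S. (?f y)\<^sup>2 * (\<pi> x * ?p x y))
      - 2 * (\<Sum>x\<in>S. \<Sum>y\<in>S. \<pi> x * ?f x * (?p x y * ?f y))"
    by (simp only: sum_distrib_left sum.distrib[symmetric] sum_subtractf[symmetric])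
      (intro sum.cong refl, simp add: power2_eq_square algebra_simps)
  also have "(\<Sum>x\<in>S. \<Sum>y\<in>S. \<pi> x * (?f x)\<^sup>2 * ?p x y) = (\<Sum>x\<in>S. \<pi> x * (?f x)\<^sup>2 * (\<Sum>y\<in>S. ?p x y))"
    by (simp only: sum_distrib_left)
  also have "\<dots> \<le> (\<Sum>x\<in>S. \<pi> x * (?f x)\<^sup>2)"
    using \<pi> sum_K_le[OF S(1)] by (intro sum_mono mult_left_le) auto
  also have "(\<Sum>x\<in>S. \<Sum>y\<in>S. (?f y)\<^sup>2 * (\<pi> x * ?p x y)) = (\<Sum>y\<in>S. (?f y)\<^sup>2 * (\<Sum>x\<in>S. \<pi> x * ?p x y))"
    by (subst sum.swap) (simp only: sum_distrib_left)
  also have "\<dots> \<le> (\<Sum>y\<in>S. (?f y)\<^sup>2 * (\<pi> y + \<eta>))"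
    using inflow by (intro sum_mono mult_left_mono) auto
  also have "\<dots> = (\<Sum>x\<in>S. \<pi> x * (?f x)\<^sup>2) + \<eta> * (\<Sum>x\<in>S. (?f x)\<^sup>2)"
    by (simp only: sum_distrib_left sum.distrib[symmetric]) (intro sum.cong refl, simp add: algebra_simps)
  finally have 1: "(\<Sum>x\<in>S. \<Sum>y\<in>S. \<pi> x * ?p x y * (?f x - ?f y)\<^sup>2) \<le>
      2 * (\<Sum>x\<in>S. \<pi> x * (?f x)\<^sup>2) + \<eta> * (\<Sum>x\<in>S. (?f x)\<^sup>2)
      - 2 * (\<Sum>x\<in>S. \<Sum>y\<in>S. \<pi> x * ?f x * (?p x y * ?f y))" by simp
  have "(\<Sum>x\<in>S. \<pi> x * (?f x)\<^sup>2) - \<pi> z * ?f z = (\<Sum>x\<in>S. \<pi> x * ?f x * (?f x - indicator {z} x))"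
  proof -
    have "(\<Sum>x\<in>S. \<pi> x * ?f x * indicator {z} x) = \<pi> z * ?f z"
      using S by (subst sum.mono_neutral_right[of _ "{z}"]) auto
    then show ?thesis by (simp add: power2_eq_square right_diff_distrib sum_subtractf mult.assoc)
  qed
  also have "\<dots> \<le> (\<Sum>x\<in>S. \<pi> x * ?f x * (\<Sum>y\<in>S. ?p x y * ?f y))"
  proof (intro sum_mono mult_left_mono)
    fix x assume x: "x \<in> S"
    then have x\<Omega>: "x \<in> \<Omega>" using S by auto
    have "?f x \<le> green K (Suc n) x z" by (rule green_mono) simp
    also have "\<dots> = indicator {z} x + (\<Sum>y\<in>set_pmf (K x). ?p x y * ?f y)" by (rule green_Suc[OF x\<Omega>])
    also have "(\<Sum>y\<in>set_pmf (K x). ?p x y * ?f y) = (\<Sum>y\<in>set_pmf (K x) \<inter> S. ?p x y * ?f y)"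
      using fin[OF x\<Omega>] closed[OF x\<Omega>] supp by (intro sum.mono_neutral_right) auto
    also have "\<dots> \<le> (\<Sum>y\<in>S. ?p x y * ?f y)"
      using S f0 by (intro sum_mono2) auto
    finally show "?f x - indicator {z} x \<le> (\<Sum>y\<in>S. ?p x y * ?f y)" by simp
    show "0 \<le> \<pi> x * ?f x" using \<pi>[OF x] f0 by simp
  qed
  also have "\<dots> = (\<Sum>x\<in>S. \<Sum>y\<in>S. \<pi> x * ?f x * (?p x y * ?f y))" by (simp only: sum_distrib_left)
  finally show ?thesis using 1 by simp
qed

end

lemma weighted_CS:
  fixes w a b :: "'i \<Rightarrow> real"
  assumes "\<And>i. i \<in> I \<Longrightarrow> w i \<ge> 0"
  shows "(\<Sum>i\<in>I. w i * a i * b i)\<^sup>2 \<le> (\<Sum>i\<in>I. w i * (a i)\<^sup>2) * (\<Sum>i\<in>I. w i * (b i)\<^sup>2)"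
proof -
  have "(\<Sum>i\<in>I. w i * a i * b i) = (\<Sum>i\<in>I. (sqrt (w i) * a i) * (sqrt (w i) * b i))"
  proof (intro sum.cong refl)
    fix i assume "i \<in> I"
    then have "w i = sqrt (w i) * sqrt (w i)" using assms by simp
    then show "w i * a i * b i = (sqrt (w i) * a i) * (sqrt (w i) * b i)"
      by (metis mult.assoc mult.left_commute)
  qed
  moreover have "(\<Sum>i\<in>I. w i * (c i)\<^sup>2) = (\<Sum>i\<in>I. (sqrt (w i) * c i)\<^sup>2)" for c :: "'i \<Rightarrow> real"
    using assms by (intro sum.cong refl) (simp add: power_mult_distrib)
  ultimately show ?thesis using Cauchy_Schwarz_ineq_sum[of "\<lambda>i. sqrt (w i) * a i" "\<lambda>i. sqrt (w i) * b i" I]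
    by simp
qed

section \<open>Bounded Green functions and energy inequalities\<close>

lemma (in fin_chain) summable_kn:
  assumes "bounded_green K z" "z \<in> \<Omega>" "x \<in> \<Omega>"
  shows "summable (\<lambda>n. pmf (kn K n x) z)"
proof -
  obtain G where G: "\<And>n. green K n z z \<le> G" using assms(1) by (auto simp: bounded_green_def)
  show ?thesis
  proof (rule bounded_imp_summable)
    fix n
    have "(\<Sum>k\<le>n. pmf (kn K k x) z) = green K n x z" by (simp add: green_def)
    also have "\<dots> \<le> G" using green_le_diag[OF assms(3,2), of n] G[of n] by simp
    finally show "(\<Sum>k\<le>n. pmf (kn K k x) z) \<le> G" .
  qed simp
qed

lemma (in fin_chain) pmf_kn_tendsto_0:
  assumes "bounded_green K z" "z \<in> \<Omega>" "x \<in> \<Omega>"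
  shows "(\<lambda>n. pmf (kn K n x) z) \<longlonglongrightarrow> 0"
  using summable_kn[OF assms] by (rule summable_LIMSEQ_zero)

text \<open>Self-improvement: the Green function is its own test function, so its square at
  \<open>z\<close> is at most a multiple of itself. Division is possible since the visit at time 0
  makes it positive.\<close>

lemma (in fin_chain) bounded_of_energy:
  assumes z: "z \<in> \<Omega>" and deg: "bdeg T m"
    and C: "\<And>f D. finite {x \<in> \<Omega>. f x \<noteq> 0} \<Longrightarrow> (\<And>x. f x \<ge> 0) \<Longrightarrow> energy_le T f D \<Longrightarrow> (f z)\<^sup>2 \<le> C * D"
    and B: "\<And>n. energy_le T (\<lambda>x. green K n x z) (B * green K n z z)"
  shows "bounded_green K z"
proof -
  have "green K n z z \<le> C * B" for n
  proof -
    have "(green K n z z)\<^sup>2 \<le> C * (B * green K n z z)"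
      by (rule C[OF finite_green_support[OF deg] green_nonneg B])
    then have "green K n z z * green K n z z \<le> (C * B) * green K n z z"
      by (simp add: power2_eq_square mult_ac)
    moreover have "green K n z z > 0"
      using green_mono[of 0 n z z] by (simp add: green_def pmf_return)
    ultimately show ?thesis by (rule mult_right_le_imp_le)
  qed
  then show ?thesis by (auto simp: bounded_green_def)
qed

subsection \<open>Chains that are reversible up to an involution\<close>

text \<open>Skew detailed balance: the flow from \<open>x\<close> to \<open>y\<close> equals the
  flow from \<open>J y\<close> to \<open>J x\<close>. This makes \<pi> invariant, and it is the
  natural symmetry for paths, where a transition read backwards leads from the reversed new path to
  the reversed old one. The bounds \<open>lo\<close> and \<open>hi\<close> make the flow comparable
  to counting transitions.\<close>

locale rev_flow = fin_chain K \<Omega> for K :: "'s \<Rightarrow> 's pmf" and \<Omega> +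
  fixes \<pi> :: "'s \<Rightarrow> real" and J :: "'s \<Rightarrow> 's" and lo hi :: real and m :: nat
  assumes J_in: "x \<in> \<Omega> \<Longrightarrow> J x \<in> \<Omega>" and J_J: "x \<in> \<Omega> \<Longrightarrow> J (J x) = x"
    and \<pi>_J: "x \<in> \<Omega> \<Longrightarrow> \<pi> (J x) = \<pi> x"
    and \<pi>_hi: "x \<in> \<Omega> \<Longrightarrow> \<pi> x \<le> hi"
    and lo_pos: "lo > 0"
    and lo: "x \<in> \<Omega> \<Longrightarrow> y \<in> set_pmf (K x) \<Longrightarrow> lo \<le> \<pi> x * pmf (K x) y"
    and balance: "x \<in> \<Omega> \<Longrightarrow> y \<in> \<Omega> \<Longrightarrow>
      \<pi> x * pmf (K x) y = \<pi> (J y) * pmf (K (J y)) (J x)"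
    and T_bdeg: "bdeg T m"
begin

definition c :: "'s \<Rightarrow> 's \<Rightarrow> real" where "c x y = \<pi> x * pmf (K x) y"

lemma \<pi>_pos: "x \<in> \<Omega> \<Longrightarrow> \<pi> x > 0"
proof -
  assume x: "x \<in> \<Omega>"
  obtain y where y: "y \<in> set_pmf (K x)" using set_pmf_not_empty[of "K x"] by blast
  have "0 < \<pi> x * pmf (K x) y" using lo[OF x y] lo_pos by linarith
  then show ?thesis using pmf_nonneg[of "K x" y] by (simp add: zero_less_mult_iff)
qed

lemma c_nonneg: "x \<in> \<Omega> \<Longrightarrow> c x y \<ge> 0"
  using \<pi>_pos[of x] by (simp add: c_def)

lemma c_J: "x \<in> \<Omega> \<Longrightarrow> y \<in> \<Omega> \<Longrightarrow> c (J y) (J x) = c x y"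
  using balance[of x y] by (simp add: c_def)

lemma c_lo: "(x, y) \<in> T \<Longrightarrow> lo \<le> c x y"
  using lo by (simp add: c_def T_def)

lemma c_hi: "x \<in> \<Omega> \<Longrightarrow> c x y \<le> hi"
  using \<pi>_hi[of x] \<pi>_pos[of x] pmf_le_1[of "K x" y]
  unfolding c_def by (meson less_eq_real_def mult_left_le order_trans)

lemma c_zero: "x \<in> \<Omega> \<Longrightarrow> (x, y) \<notin> T \<Longrightarrow> c x y = 0"
  by (simp add: c_def T_def set_pmf_iff)

lemma T_J: "(x, y) \<in> T \<Longrightarrow> (J y, J x) \<in> T"
  using T_in[of x y] c_lo[of x y] c_J[of x y] c_zero[of "J y" "J x"] J_in[of y] lo_pos by force

lemma inj_J: "inj_on J \<Omega>"
  by (rule inj_on_inverseI[of _ J]) (simp add: J_J)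

lemma sum_J:
  assumes "S \<subseteq> \<Omega>" "J ` S \<subseteq> S"
  shows "(\<Sum>x\<in>S. F (J x)) = (\<Sum>x\<in>S. F x)"
proof -
  have "J ` S = S" using assms J_J by (auto simp: image_iff) (metis image_subset_iff subset_iff)
  then show ?thesis
    using sum.reindex[OF inj_on_subset[OF inj_J assms(1)], of F] by simp
qed

lemma sum_J2:
  assumes "S \<subseteq> \<Omega>" "J ` S \<subseteq> S"
  shows "(\<Sum>x\<in>S. \<Sum>y\<in>S. F (J y) (J x)) = (\<Sum>x\<in>S. \<Sum>y\<in>S. F x y)"
proof -
  have "(\<Sum>x\<in>S. \<Sum>y\<in>S. F (J y) (J x)) = (\<Sum>x\<in>S. \<Sum>y\<in>S. F y (J x))"
    by (intro sum.cong refl sum_J[OF assms])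
  also have "\<dots> = (\<Sum>x\<in>S. \<Sum>y\<in>S. F y x)" by (rule sum_J[OF assms])
  also have "\<dots> = (\<Sum>x\<in>S. \<Sum>y\<in>S. F x y)" by (rule sum.swap)
  finally show ?thesis .
qed

lemma outflow: "x \<in> \<Omega> \<Longrightarrow> finite S \<Longrightarrow> set_pmf (K x) \<subseteq> S \<Longrightarrow> (\<Sum>y\<in>S. c x y) = \<pi> x"
  unfolding c_def sum_distrib_left[symmetric] by (simp add: sum_pmf_eq_1)

text \<open>Reversal turns the flow into \<open>y\<close> into the flow out of
  \<open>J y\<close>.\<close>

lemma inflow_le:
  assumes y: "y \<in> \<Omega>" and S: "finite S" "S \<subseteq> \<Omega>"
  shows "(\<Sum>x\<in>S. c x y) \<le> \<pi> y"
proof -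
  have "(\<Sum>x\<in>S. c x y) = (\<Sum>x\<in>S. c (J y) (J x))"
    using y S c_J by (intro sum.cong refl) auto
  also have "\<dots> = (\<Sum>x\<in>J ` S. c (J y) x)"
    using sum.reindex[OF inj_on_subset[OF inj_J S(2)], of "c (J y)"] by simp
  also have "\<dots> \<le> \<pi> (J y) * 1"
    unfolding c_def sum_distrib_left[symmetric]
    using S sum_K_le \<pi>_pos[OF J_in[OF y]] by (intro mult_left_mono) auto
  finally show ?thesis using \<pi>_J[OF y] by simp
qed

lemma inflow:
  assumes y: "y \<in> \<Omega>" and S: "finite S" "S \<subseteq> \<Omega>" "T\<inverse> `` {y} \<subseteq> S"
  shows "(\<Sum>x\<in>S. c x y) = \<pi> y"
proof -
  have "(\<Sum>x\<in>S. c x y) = (\<Sum>x\<in>S. c (J y) (J x))"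
    using y S c_J by (intro sum.cong refl) auto
  also have "\<dots> = (\<Sum>x\<in>J ` S. c (J y) x)"
    using sum.reindex[OF inj_on_subset[OF inj_J S(2)], of "c (J y)"] by simp
  also have "\<dots> = \<pi> (J y)"
  proof (rule outflow)
    show "set_pmf (K (J y)) \<subseteq> J ` S"
    proof
      fix w assume w: "w \<in> set_pmf (K (J y))"
      then have t: "(J y, w) \<in> T" using J_in[OF y] by (simp add: T_def)
      then have "(J w, y) \<in> T" using T_J[OF t] J_J[OF y] by simp
      then have "J w \<in> S" using S by auto
      moreover have "J (J w) = w" using J_J T_in(2)[OF t] by blast
      ultimately show "w \<in> J ` S" by (metis image_eqI)
    qed
  qed (use J_in[OF y] S in auto)
  finally show ?thesis using \<pi>_J[OF y] by simp
qed

lemma green_energy_S: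
  assumes z: "z \<in> \<Omega>" and S: "finite S" "S \<subseteq> \<Omega>" "z \<in> S"
    and supp: "{x \<in> \<Omega>. green K n x z \<noteq> 0} \<subseteq> S"
  shows "(\<Sum>x\<in>S. \<Sum>y\<in>S. c x y * (green K n x z - green K n y z)\<^sup>2) \<le> 2 * \<pi> z * green K n z z"
proof -
  have "\<pi> x \<ge> 0" if "x \<in> S" for x using \<pi>_pos[of x] that S by auto
  moreover have "(\<Sum>x\<in>S. \<pi> x * pmf (K x) y) \<le> \<pi> y + 0" if "y \<in> S" for y
    using inflow_le[of y S] that S by (auto simp: c_def)
  ultimately show ?thesis
    using green_energy[OF z S supp, of \<pi> 0] by (simp add: c_def)
qed

lemma green_energy_le:
  assumes z: "z \<in> \<Omega>"
  shows "energy_le T (\<lambda>x. green K n x z) (2 * \<pi> z * green K n z z / lo)"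
  unfolding energy_le_def
proof (intro allI impI)
  fix B assume B: "finite B \<and> B \<subseteq> T"
  define S where "S = {x \<in> \<Omega>. green K n x z \<noteq> 0} \<union> fst ` B \<union> snd ` B \<union> {z}"
  have S: "finite S" "S \<subseteq> \<Omega>" "z \<in> S"
    using B finite_green_support[OF T_bdeg] z T_in by (auto simp: S_def)
  let ?d = "\<lambda>x y. (green K n x z - green K n y z)\<^sup>2"
  have "lo * (\<Sum>(x, y)\<in>B. ?d x y) \<le> (\<Sum>(x, y)\<in>B. c x y * ?d x y)"
    unfolding sum_distrib_left using B c_lo by (intro sum_mono) (auto intro!: mult_right_mono)
  also have "\<dots> \<le> (\<Sum>(x, y)\<in>S \<times> S. c x y * ?d x y)"
  proof (intro sum_mono2)
    show "B \<subseteq> S \<times> S"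
    proof
      fix i assume "i \<in> B"
      then have "fst i \<in> S" "snd i \<in> S" by (auto simp: S_def)
      then show "i \<in> S \<times> S" by (simp add: mem_Times_iff)
    qed
  qed (use S c_nonneg in \<open>auto simp: subset_iff\<close>)
  also have "\<dots> = (\<Sum>x\<in>S. \<Sum>y\<in>S. c x y * ?d x y)" by (simp add: sum.cartesian_product)
  also have "\<dots> \<le> 2 * \<pi> z * green K n z z"
    by (rule green_energy_S[OF z S]) (auto simp: S_def)
  finally show "(\<Sum>(x, y)\<in>B. ?d x y) \<le> 2 * \<pi> z * green K n z z / lo"
    using lo_pos by (simp add: pos_le_divide_eq mult.commute)
qed

lemma bounded_greenI:
  assumes z: "z \<in> \<Omega>"
    and C: "\<And>f D. finite {x \<in> \<Omega>. f x \<noteq> 0} \<Longrightarrow> (\<And>x. f x \<ge> 0) \<Longrightarrow> energy_le T f D \<Longrightarrow> (f z)\<^sup>2 \<le> C * D"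
  shows "bounded_green K z"
proof (rule bounded_of_energy[OF z T_bdeg, where C = C and B = "2 * \<pi> z / lo"])
  show "energy_le T (\<lambda>x. green K n x z) (2 * \<pi> z / lo * green K n z z)" for n
    using green_energy_le[OF z, of n] by simp
qed (rule C)

text \<open>
  The sector condition: split the Green function \<open>u\<close> into its \<open>J\<close>-even part \<open>s\<close> and its
  \<open>J\<close>-odd part \<open>a\<close>.  Reversing the flow makes the pairing of \<open>f\<close> with \<open>s\<close> symmetric, and the
  odd part is controlled in \<open>\<ell>\<^sup>2\<close>.
\<close>

lemma sector:
  assumes z: "z \<in> \<Omega>" and bg: "bounded_green K z"
    and anti: "\<And>a D. (\<And>x. x \<in> \<Omega> \<Longrightarrow> a (J x) = - a x) \<Longrightarrow> finite {x \<in> \<Omega>. a x \<noteq> 0} \<Longrightarrow>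
      energy_le T a D \<Longrightarrow> (\<Sum>x\<in>{x \<in> \<Omega>. a x \<noteq> 0}. (a x)\<^sup>2) \<le> C1 * D"
    and C1: "C1 \<ge> 0"
  shows "\<exists>C\<ge>0. \<forall>f D. (\<forall>x\<in>\<Omega>. f (J x) = f x) \<longrightarrow> finite {x \<in> \<Omega>. f x \<noteq> 0} \<longrightarrow>
    energy_le T f D \<longrightarrow> (f z)\<^sup>2 \<le> C * D"
proof -
  obtain G where G: "\<And>n. green K n z z \<le> G" using bg by (auto simp: bounded_green_def)
  have G0: "G \<ge> 0" using G[of 0] green_nonneg[of 0 z z] by linarith
  have \<pi>z: "\<pi> z > 0" by (rule \<pi>_pos[OF z])
  have hi0: "hi \<ge> 0" using \<pi>_hi[OF z] \<pi>z by linarith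
  \<comment> \<open>The outer \<open>hi\<close> compares the flow with counting,
    \<open>\<pi> z * G\<close> is half the bound on the Green energy, and the last term is the odd
    part, whose square sum is at most \<open>C1\<close> times the counting energy
    \<open>2 * \<pi> z * G / lo\<close>.\<close>
  define Q where "Q = hi * (\<pi> z * G + 4 * hi * C1 * (\<pi> z * G / lo))"
  have Q0: "Q \<ge> 0" unfolding Q_def using hi0 \<pi>z G0 C1 lo_pos by simp
  have main: "(\<pi> z * f z)\<^sup>2 \<le> Q * D"
    if fJ: "\<And>x. x \<in> \<Omega> \<Longrightarrow> f (J x) = f x" and ff: "finite {x \<in> \<Omega>. f x \<noteq> 0}" and fe: "energy_le T f D" for f D
  proof -
    \<comment> \<open>Because of truncation, the Green function misses its equation by
      \<open>pmf (kn K (Suc n) x) z\<close>. The pairing of this defect with \<open>f\<close> tends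
      to 0 because \<open>z\<close> is transient.\<close>
    define err where "err n = (\<Sum>x\<in>{x \<in> \<Omega>. f x \<noteq> 0}. \<pi> x * f x * pmf (kn K (Suc n) x) z)" for n
    have D0: "D \<ge> 0" by (rule energy_le_nonneg[OF fe])
    have bound: "(\<pi> z * f z - err n)\<^sup>2 \<le> Q * D" for n
    proof -
      define u where "u x = green K n x z" for x
      \<comment> \<open>\<open>N\<close> carries \<open>f\<close> and \<open>u\<close> and is stable
        under \<open>J\<close>; \<open>S\<close> adds all neighbours, so that inflow and outflow at
        points of \<open>N\<close> are complete while sums over \<open>S\<close> stay finite and
        symmetric.\<close>
      define N0 where "N0 = {x \<in> \<Omega>. f x \<noteq> 0} \<union> {x \<in> \<Omega>. u x \<noteq> 0} \<union> {z}"
      define N where "N = N0 \<union> J ` N0"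
      define S0 where "S0 = N \<union> (\<Union>x\<in>N. T `` {x}) \<union> (\<Union>x\<in>N. T\<inverse> `` {x})"
      define S where "S = S0 \<union> J ` S0"
      have "finite N0" "N0 \<subseteq> \<Omega>"
        using ff finite_green_support[OF T_bdeg, of n z] z by (auto simp: N0_def u_def)
      then have finN: "finite N" and N\<Omega>: "N \<subseteq> \<Omega>" using J_in by (auto simp: N_def)
      have JN: "J x \<in> N" if "x \<in> N" for x
        using that \<open>N0 \<subseteq> \<Omega>\<close> J_J by (auto simp: N_def)
      have "finite S0" unfolding S0_def
        by (intro finite_UnI finite_UN_I finN bdegD(1)[OF T_bdeg] bdegD(3)[OF T_bdeg])
      have "S0 \<subseteq> \<Omega>" using N\<Omega> T_in by (auto simp: S0_def)
      have finS: "finite S" using \<open>finite S0\<close> by (simp add: S_def)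
      have S\<Omega>: "S \<subseteq> \<Omega>" using \<open>S0 \<subseteq> \<Omega>\<close> J_in by (auto simp: S_def)
      have JS: "J ` S \<subseteq> S" using \<open>S0 \<subseteq> \<Omega>\<close> J_J by (auto simp: S_def)
      have NS: "N \<subseteq> S" by (auto simp: S_def S0_def)
      have zS: "z \<in> S" using NS by (auto simp: N_def N0_def)
      have out: "(\<Sum>y\<in>S. c x y) = \<pi> x" if "x \<in> N" for x
      proof (rule outflow)
        show "set_pmf (K x) \<subseteq> S" using that N\<Omega> by (auto simp: S_def S0_def T_def)
      qed (use that N\<Omega> finS in auto)
      have inn: "(\<Sum>y\<in>S. c y x) = \<pi> x" if "x \<in> N" for x
      proof (rule inflow)
        show "T\<inverse> `` {x} \<subseteq> S" using that by (auto simp: S_def S0_def)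
      qed (use that N\<Omega> finS S\<Omega> in auto)
      have f0: "f x = 0" if "x \<in> S" "x \<notin> N" for x
        using that S\<Omega> by (auto simp: N_def N0_def)
      have u0: "u x = 0" if "x \<in> S" "x \<notin> N" for x
        using that S\<Omega> by (auto simp: N_def N0_def)
      have Jx: "J x \<in> S" "J x \<notin> N" if "x \<in> S" "x \<notin> N" for x
        using that JS JN[of "J x"] J_J[of x] S\<Omega> by auto
      define s where "s x = (u x + u (J x)) / 2" for x
      define a where "a x = (u x - u (J x)) / 2" for x
      have us: "u x = s x + a x" for x by (simp add: s_def a_def field_simps)
      have sJ: "s (J x) = s x" and aJ: "a (J x) = - a x" if "x \<in> \<Omega>" for x
        using that by (simp_all add: s_def a_def J_J field_simps)
      have a0: "a x = 0" if "x \<in> S" "x \<notin> N" for x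
        using u0[OF that] u0[OF Jx[OF that]] by (simp add: a_def)
      define B where "B g = (\<Sum>x\<in>S. \<Sum>y\<in>S. c x y * (f x * (g x - g y)))" for g :: "'s \<Rightarrow> real"
      define E where "E g = (\<Sum>x\<in>S. \<Sum>y\<in>S. c x y * (g x - g y)\<^sup>2)" for g :: "'s \<Rightarrow> real"
      have Bu: "B u = \<pi> z * f z - err n"
      proof -
        have "B u = (\<Sum>x\<in>S. if x \<in> N then \<pi> x * f x * (indicator {z} x - pmf (kn K (Suc n) x) z) else 0)"
          unfolding B_def
        proof (intro sum.cong refl)
          fix x assume x: "x \<in> S"
          show "(\<Sum>y\<in>S. c x y * (f x * (u x - u y))) =
            (if x \<in> N then \<pi> x * f x * (indicator {z} x - pmf (kn K (Suc n) x) z) else 0)"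
          proof (cases "x \<in> N")
            case False
            then show ?thesis using f0[OF x] by simp
          next
            case True
            then have x\<Omega>: "x \<in> \<Omega>" using N\<Omega> by auto
            have sub: "set_pmf (K x) \<subseteq> S" using True x\<Omega> by (auto simp: S_def S0_def T_def)
            have "(\<Sum>y\<in>S. c x y * u y) = \<pi> x * (\<Sum>y\<in>S. pmf (K x) y * u y)"
              by (simp add: c_def sum_distrib_left mult.assoc)
            also have "(\<Sum>y\<in>S. pmf (K x) y * u y) = (\<Sum>y\<in>set_pmf (K x). pmf (K x) y * u y)"
              using finS sub by (intro sum.mono_neutral_right) (auto simp: set_pmf_iff)
            also have "\<dots> = green K (Suc n) x z - indicator {z} x"
              using green_Suc[OF x\<Omega>, of n z] by (simp add: u_def)
            also have "green K (Suc n) x z = u x + pmf (kn K (Suc n) x) z"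
              by (simp add: u_def green_def)
            finally have w: "(\<Sum>y\<in>S. c x y * u y) = \<pi> x * (u x + pmf (kn K (Suc n) x) z - indicator {z} x)" .
            have "(\<Sum>y\<in>S. c x y * (f x * (u x - u y))) =
                f x * (u x * (\<Sum>y\<in>S. c x y) - (\<Sum>y\<in>S. c x y * u y))"
              by (simp only: sum_distrib_left sum_subtractf[symmetric])
                (intro sum.cong refl, simp add: algebra_simps)
            also have "\<dots> = \<pi> x * f x * (indicator {z} x - pmf (kn K (Suc n) x) z)"
              unfolding w out[OF True] by (simp add: algebra_simps)
            finally show ?thesis using True by simp
          qed
        qed
        also have "\<dots> = (\<Sum>x\<in>N. \<pi> x * f x * (indicator {z} x - pmf (kn K (Suc n) x) z))"
          using finS NS by (intro sum.mono_neutral_cong_right) auto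
        also have "\<dots> = (\<Sum>x\<in>N. \<pi> x * f x * indicator {z} x) - (\<Sum>x\<in>N. \<pi> x * f x * pmf (kn K (Suc n) x) z)"
          by (simp only: right_diff_distrib sum_subtractf)
        also have "(\<Sum>x\<in>N. \<pi> x * f x * indicator {z} x) = \<pi> z * f z"
          using finN by (subst sum.mono_neutral_right[of _ "{z}"]) (auto simp: N_def N0_def)
        also have "(\<Sum>x\<in>N. \<pi> x * f x * pmf (kn K (Suc n) x) z) = err n"
          unfolding err_def using finN N\<Omega>
          by (intro sum.mono_neutral_right) (auto simp: N_def N0_def)
        finally show ?thesis .
      qed
      have Bsplit: "B u = B s + B a"
        unfolding B_def us by (simp only: sum.distrib[symmetric]) (intro sum.cong refl, simp add: algebra_simps)
      have Ef: "E f \<le> hi * D"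
      proof -
        have "E f = (\<Sum>(x, y)\<in>S \<times> S. c x y * (f x - f y)\<^sup>2)" by (simp add: E_def sum.cartesian_product)
        also have "\<dots> = (\<Sum>(x, y)\<in>(S \<times> S) \<inter> T. c x y * (f x - f y)\<^sup>2)"
        proof (intro sum.mono_neutral_right ballI)
          fix i assume i: "i \<in> S \<times> S - (S \<times> S) \<inter> T"
          then have "c (fst i) (snd i) = 0" using S\<Omega> by (intro c_zero) auto
          then show "(case i of (x, y) \<Rightarrow> c x y * (f x - f y)\<^sup>2) = 0" by (simp add: case_prod_unfold)
        qed (use finS in auto)
        also have "\<dots> \<le> (\<Sum>(x, y)\<in>(S \<times> S) \<inter> T. hi * (f x - f y)\<^sup>2)"
          using S\<Omega> c_hi by (intro sum_mono) (auto intro!: mult_right_mono)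
        also have "\<dots> = hi * (\<Sum>(x, y)\<in>(S \<times> S) \<inter> T. (f x - f y)\<^sup>2)"
          by (simp add: sum_distrib_left case_prod_unfold)
        also have "\<dots> \<le> hi * D" using hi0 finS by (intro mult_left_mono energy_leD[OF fe]) auto
        finally show ?thesis .
      qed
      have Ef0: "E f \<ge> 0" unfolding E_def using c_nonneg S\<Omega> by (intro sum_nonneg) (auto intro!: mult_nonneg_nonneg)
      have Eu: "E u \<le> 2 * \<pi> z * G"
      proof -
        have "E u \<le> 2 * \<pi> z * green K n z z"
          unfolding E_def u_def using NS by (intro green_energy_S[OF z finS S\<Omega> zS]) (auto simp: N_def N0_def u_def)
        also have "\<dots> \<le> 2 * \<pi> z * G" using G \<pi>z by simp
        finally show ?thesis .
      qed
      \<comment> \<open>By the symmetry of the flow, \<open>u\<close> and its reflection have equal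
        energy; \<open>s\<close> is their average, and energy is convex.\<close>
      have Es: "E s \<le> E u"
      proof -
        have "E (\<lambda>x. u (J x)) = (\<Sum>x\<in>S. \<Sum>y\<in>S. c (J y) (J x) * (u (J (J y)) - u (J (J x)))\<^sup>2)"
          unfolding E_def by (rule sum_J2[OF S\<Omega> JS, symmetric])
        also have "\<dots> = E u"
          unfolding E_def using S\<Omega> by (intro sum.cong refl) (auto simp: c_J J_J power2_commute subset_iff)
        finally have e: "E (\<lambda>x. u (J x)) = E u" .
        have "E s \<le> (\<Sum>x\<in>S. \<Sum>y\<in>S. c x y * ((u x - u y)\<^sup>2 / 2 + (u (J x) - u (J y))\<^sup>2 / 2))"
          unfolding E_def
        proof (intro sum_mono mult_left_mono)
          fix x y
          have e: "s x - s y = ((u x - u y) + (u (J x) - u (J y))) / 2" by (simp add: s_def field_simps)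
          have "(s x - s y)\<^sup>2 = ((u x - u y) + (u (J x) - u (J y)))\<^sup>2 / 4"
            unfolding e by (simp add: power_divide)
          then show "(s x - s y)\<^sup>2 \<le> (u x - u y)\<^sup>2 / 2 + (u (J x) - u (J y))\<^sup>2 / 2"
            using sq_add_le[of "u x - u y" "u (J x) - u (J y)"] by simp
        qed (use c_nonneg S\<Omega> in auto)
        also have "\<dots> = E u / 2 + E (\<lambda>x. u (J x)) / 2"
          unfolding E_def by (simp add: distrib_left sum.distrib sum_divide_distrib)
        finally show ?thesis using e by simp
      qed
      have Es0: "E s \<ge> 0" unfolding E_def using c_nonneg S\<Omega> by (intro sum_nonneg) (auto intro!: mult_nonneg_nonneg)
      \<comment> \<open>Reflecting the sum exchanges \<open>x\<close> and \<open>y\<close> and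
        leaves \<open>f\<close> and \<open>s\<close> unchanged. Adding both forms symmetrizes the
        pairing, so Cauchy-Schwarz applies.\<close>
      have Bs: "(2 * B s)\<^sup>2 \<le> E f * E s"
      proof -
        have "B s = (\<Sum>x\<in>S. \<Sum>y\<in>S. c (J y) (J x) * (f (J y) * (s (J y) - s (J x))))"
          unfolding B_def by (rule sum_J2[OF S\<Omega> JS, symmetric])
        also have "\<dots> = (\<Sum>x\<in>S. \<Sum>y\<in>S. c x y * (f y * (s y - s x)))"
          using S\<Omega> by (intro sum.cong refl) (auto simp: c_J sJ fJ subset_iff)
        finally have "2 * B s = (\<Sum>x\<in>S. \<Sum>y\<in>S. c x y * (f x * (s x - s y))) + (\<Sum>x\<in>S. \<Sum>y\<in>S. c x y * (f y * (s y - s x)))"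
          unfolding B_def by simp
        also have "\<dots> = (\<Sum>x\<in>S. \<Sum>y\<in>S. c x y * (f x - f y) * (s x - s y))"
          by (simp only: sum.distrib[symmetric]) (intro sum.cong refl, simp add: algebra_simps)
        also have "\<dots> = (\<Sum>i\<in>S \<times> S. c (fst i) (snd i) * (f (fst i) - f (snd i)) * (s (fst i) - s (snd i)))"
          by (simp add: sum.cartesian_product case_prod_unfold)
        finally show ?thesis
          using weighted_CS[of "S \<times> S" "\<lambda>i. c (fst i) (snd i)" "\<lambda>i. f (fst i) - f (snd i)" "\<lambda>i. s (fst i) - s (snd i)"]
            c_nonneg S\<Omega> unfolding E_def by (auto simp: sum.cartesian_product case_prod_unfold subset_iff)
      qed
      have asum: "(\<Sum>y\<in>S. (a y)\<^sup>2) \<le> C1 * (2 * \<pi> z * G / lo)"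
      proof -
        have eu: "energy_le T u (2 * \<pi> z * green K n z z / lo)" unfolding u_def by (rule green_energy_le[OF z])
        let ?Ku = "2 * \<pi> z * green K n z z / lo"
        have ea: "energy_le T a ?Ku"
          unfolding energy_le_def
        proof (intro allI impI)
          fix A assume A: "finite A \<and> A \<subseteq> T"
          have i1: "(\<Sum>i\<in>A. (u (fst i) - u (snd i))\<^sup>2) \<le> ?Ku"
            using energy_leD[OF eu, of A] A by (simp add: case_prod_unfold)
          have i2: "(\<Sum>i\<in>A. (u (fst (J (snd i), J (fst i))) - u (snd (J (snd i), J (fst i))))\<^sup>2) \<le> ?Ku"
          proof (rule energy_inj_le[OF eu])
            show "(\<lambda>i. (J (snd i), J (fst i))) ` A \<subseteq> T" using A T_J by (auto simp: subset_iff)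
            show "inj_on (\<lambda>i. (J (snd i), J (fst i))) A"
            proof (rule inj_onI)
              fix i j assume ij: "i \<in> A" "j \<in> A" and e: "(J (snd i), J (fst i)) = (J (snd j), J (fst j))"
              have "fst i \<in> \<Omega>" "snd i \<in> \<Omega>" "fst j \<in> \<Omega>" "snd j \<in> \<Omega>"
                using ij A T_in[of "fst i" "snd i"] T_in[of "fst j" "snd j"] by auto
              then show "i = j" using e inj_J by (auto simp: inj_on_def prod_eq_iff)
            qed
          qed (use A in auto)
          have "(\<Sum>(x, y)\<in>A. (a x - a y)\<^sup>2) \<le> (\<Sum>i\<in>A. (u (fst i) - u (snd i))\<^sup>2 / 2
               + (u (fst (J (snd i), J (fst i))) - u (snd (J (snd i), J (fst i))))\<^sup>2 / 2)"
            unfolding case_prod_unfold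
          proof (rule sum_mono)
            fix i :: "'s \<times> 's"
            let ?x = "fst i" and ?y = "snd i"
            have e: "a ?x - a ?y = ((u ?x - u ?y) + (u (J ?y) - u (J ?x))) / 2" by (simp add: a_def field_simps)
            have "(a ?x - a ?y)\<^sup>2 = ((u ?x - u ?y) + (u (J ?y) - u (J ?x)))\<^sup>2 / 4"
              unfolding e by (simp add: power_divide)
            then show "(a ?x - a ?y)\<^sup>2 \<le> (u ?x - u ?y)\<^sup>2 / 2
               + (u (fst (J (snd i), J (fst i))) - u (snd (J (snd i), J (fst i))))\<^sup>2 / 2"
              using sq_add_le[of "u ?x - u ?y" "u (J ?y) - u (J ?x)"] by simp
          qed
          also have "\<dots> = (\<Sum>i\<in>A. (u (fst i) - u (snd i))\<^sup>2) / 2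
               + (\<Sum>i\<in>A. (u (fst (J (snd i), J (fst i))) - u (snd (J (snd i), J (fst i))))\<^sup>2) / 2"
            by (simp add: sum.distrib sum_divide_distrib)
          also have "\<dots> \<le> ?Ku" using i1 i2 by linarith
          finally show "(\<Sum>(x, y)\<in>A. (a x - a y)\<^sup>2) \<le> ?Ku" .
        qed
        have sub: "{x \<in> \<Omega>. a x \<noteq> 0} \<subseteq> N"
        proof
          fix x assume x: "x \<in> {x \<in> \<Omega>. a x \<noteq> 0}"
          then have "u x \<noteq> 0 \<or> u (J x) \<noteq> 0" "x \<in> \<Omega>" by (auto simp: a_def)
          then have "x \<in> N0 \<or> J x \<in> N0" using J_in by (auto simp: N0_def)
          moreover have "x = J (J x)" using J_J[OF \<open>x \<in> \<Omega>\<close>] by simp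
          ultimately show "x \<in> N" unfolding N_def by (metis UnI1 UnI2 image_eqI)
        qed
        have "(\<Sum>y\<in>S. (a y)\<^sup>2) = (\<Sum>x\<in>{x \<in> \<Omega>. a x \<noteq> 0}. (a x)\<^sup>2)"
          using finS sub NS S\<Omega> by (intro sum.mono_neutral_right) auto
        also have "\<dots> \<le> C1 * ?Ku"
          by (rule anti[OF aJ finite_subset[OF sub finN] ea])
        also have "\<dots> \<le> C1 * (2 * \<pi> z * G / lo)"
          using C1 G[of n] \<pi>z lo_pos by (intro mult_left_mono divide_right_mono) auto
        finally show ?thesis .
      qed
      \<comment> \<open>The pairing with the odd part cannot be symmetrized. Equal inflow and
        outflow on \<open>N\<close> move the difference onto \<open>f\<close>, so that
        \<open>a\<close> enters undifferentiated and its square sum bound can be used.\<close>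
      have Ba: "(B a)\<^sup>2 \<le> E f * (hi * (C1 * (2 * \<pi> z * G / lo)))"
      proof -
        have "(\<Sum>x\<in>S. \<Sum>y\<in>S. c x y * (f x * a x)) = (\<Sum>x\<in>S. f x * a x * (\<Sum>y\<in>S. c x y))"
          by (simp add: sum_distrib_left mult_ac)
        also have "\<dots> = (\<Sum>x\<in>S. f x * a x * (\<Sum>y\<in>S. c y x))"
        proof (intro sum.cong refl)
          fix x assume "x \<in> S"
          then show "f x * a x * (\<Sum>y\<in>S. c x y) = f x * a x * (\<Sum>y\<in>S. c y x)"
            using f0[of x] out[of x] inn[of x] by (cases "x \<in> N") auto
        qed
        also have "\<dots> = (\<Sum>x\<in>S. \<Sum>y\<in>S. c y x * (f x * a x))"
          by (simp add: sum_distrib_left mult_ac)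
        also have "\<dots> = (\<Sum>x\<in>S. \<Sum>y\<in>S. c x y * (f y * a y))" by (rule sum.swap)
        finally have e: "(\<Sum>x\<in>S. \<Sum>y\<in>S. c x y * (f x * a x)) = (\<Sum>x\<in>S. \<Sum>y\<in>S. c x y * (f y * a y))" .
        have "B a = (\<Sum>x\<in>S. \<Sum>y\<in>S. c x y * (f x * a x)) - (\<Sum>x\<in>S. \<Sum>y\<in>S. c x y * (f x * a y))"
          unfolding B_def by (simp only: sum_subtractf[symmetric]) (intro sum.cong refl, simp add: algebra_simps)
        also have "\<dots> = (\<Sum>x\<in>S. \<Sum>y\<in>S. c x y * (f y - f x) * a y)"
          unfolding e by (simp only: sum_subtractf[symmetric]) (intro sum.cong refl, simp add: algebra_simps)
        also have "\<dots> = (\<Sum>i\<in>S \<times> S. c (fst i) (snd i) * (f (snd i) - f (fst i)) * a (snd i))"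
          by (simp add: sum.cartesian_product case_prod_unfold)
        finally have "(B a)\<^sup>2 \<le> (\<Sum>i\<in>S \<times> S. c (fst i) (snd i) * (f (snd i) - f (fst i))\<^sup>2) *
            (\<Sum>i\<in>S \<times> S. c (fst i) (snd i) * (a (snd i))\<^sup>2)"
          using weighted_CS[of "S \<times> S" "\<lambda>i. c (fst i) (snd i)" "\<lambda>i. f (snd i) - f (fst i)" "\<lambda>i. a (snd i)"]
            c_nonneg S\<Omega> by (auto simp: subset_iff)
        also have "(\<Sum>i\<in>S \<times> S. c (fst i) (snd i) * (f (snd i) - f (fst i))\<^sup>2) = E f"
          by (simp add: E_def sum.cartesian_product case_prod_unfold power2_commute)
        also have "(\<Sum>i\<in>S \<times> S. c (fst i) (snd i) * (a (snd i))\<^sup>2) = (\<Sum>x\<in>S. \<Sum>y\<in>S. c x y * (a y)\<^sup>2)"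
          by (simp add: sum.cartesian_product case_prod_unfold)
        also have "\<dots> = (\<Sum>y\<in>S. (\<Sum>x\<in>S. c x y) * (a y)\<^sup>2)"
          by (subst sum.swap) (simp add: sum_distrib_right)
        also have "\<dots> \<le> (\<Sum>y\<in>S. hi * (a y)\<^sup>2)"
        proof (intro sum_mono mult_right_mono)
          fix y assume "y \<in> S"
          then have y: "y \<in> \<Omega>" using S\<Omega> by auto
          show "(\<Sum>x\<in>S. c x y) \<le> hi" using inflow_le[OF y finS S\<Omega>] \<pi>_hi[OF y] by linarith
        qed simp
        also have "\<dots> = hi * (\<Sum>y\<in>S. (a y)\<^sup>2)" by (simp add: sum_distrib_left)
        also have "\<dots> \<le> hi * (C1 * (2 * \<pi> z * G / lo))" using asum hi0 by (rule mult_left_mono)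
        finally show ?thesis using Ef0 by (simp add: mult_left_mono)
      qed
      have "(B u)\<^sup>2 \<le> 2 * (B s)\<^sup>2 + 2 * (B a)\<^sup>2" unfolding Bsplit by (rule sq_add_le)
      also have "\<dots> \<le> E f * E s / 2 + 2 * (E f * (hi * (C1 * (2 * \<pi> z * G / lo))))"
        using Bs Ba by (simp add: power_mult_distrib)
      also have "\<dots> = E f * (E s / 2 + 2 * (hi * (C1 * (2 * \<pi> z * G / lo))))" by (simp add: algebra_simps)
      also have "\<dots> \<le> (hi * D) * (\<pi> z * G + 2 * (hi * (C1 * (2 * \<pi> z * G / lo))))"
        using Ef Ef0 Es Eu Es0 hi0 C1 \<pi>z G0 lo_pos D0
        by (intro mult_mono add_mono) auto
      also have "\<dots> = Q * D" by (simp add: Q_def algebra_simps)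
      finally show ?thesis using Bu by simp
    qed
    have "err \<longlonglongrightarrow> (\<Sum>x\<in>{x \<in> \<Omega>. f x \<noteq> 0}. \<pi> x * f x * 0)"
      unfolding err_def
    proof (intro tendsto_sum tendsto_mult tendsto_const)
      fix x assume "x \<in> {x \<in> \<Omega>. f x \<noteq> 0}"
      then have "(\<lambda>n. pmf (kn K n x) z) \<longlonglongrightarrow> 0" by (intro pmf_kn_tendsto_0[OF bg z]) simp
      then show "(\<lambda>n. pmf (kn K (Suc n) x) z) \<longlonglongrightarrow> 0" by (rule LIMSEQ_Suc)
    qed
    then have "err \<longlonglongrightarrow> 0" by simp
    then have "(\<lambda>n. (\<pi> z * f z - err n)\<^sup>2) \<longlonglongrightarrow> (\<pi> z * f z - 0)\<^sup>2" by (intro tendsto_intros)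
    then have "(\<pi> z * f z - 0)\<^sup>2 \<le> Q * D" by (rule LIMSEQ_le_const2) (use bound in auto)
    then show ?thesis by simp
  qed
  show ?thesis
  proof (intro exI[of _ "Q / (\<pi> z)\<^sup>2"] conjI allI impI)
    fix f D assume "\<forall>x\<in>\<Omega>. f (J x) = f x" "finite {x \<in> \<Omega>. f x \<noteq> 0}" "energy_le T f D"
    then have "(\<pi> z * f z)\<^sup>2 \<le> Q * D" by (intro main) auto
    then show "(f z)\<^sup>2 \<le> Q / (\<pi> z)\<^sup>2 * D" using \<pi>z by (simp add: power_mult_distrib field_simps)
  qed (use Q0 in simp)
qed

end

subsection \<open>Paths in graphs of bounded degree\<close>

definition adj :: "'a set set \<Rightarrow> ('a \<times> 'a) set" where
  "adj E = {(x, y). {x, y} \<in> E}"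

lemma adj_sym: "(x, y) \<in> adj E \<longleftrightarrow> (y, x) \<in> adj E"
  by (simp add: adj_def insert_commute)

lemma paths_iff:
  "\<gamma> \<in> paths V E k \<longleftrightarrow> length \<gamma> = Suc k \<and> set \<gamma> \<subseteq> V \<and> successively (\<lambda>x y. {x, y} \<in> E) \<gamma>"
  unfolding paths_def image_Suc_lessThan[symmetric] by (auto simp: successively_conv_nth)

lemma successively_relpow:
  "\<gamma> \<noteq> [] \<Longrightarrow> successively (\<lambda>x y. (x, y) \<in> R) \<gamma> \<Longrightarrow> (hd \<gamma>, last \<gamma>) \<in> R ^^ (length \<gamma> - 1)"
proof (induction \<gamma>)
  case (Cons x \<gamma>)
  show ?case
  proof (cases "\<gamma> = []")
    case False
    then have "(x, hd \<gamma>) \<in> R" "(hd \<gamma>, last \<gamma>) \<in> R ^^ (length \<gamma> - 1)"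
      using Cons by (auto simp: successively_Cons)
    then have "(x, last \<gamma>) \<in> R ^^ Suc (length \<gamma> - 1)" by (rule relpow_Suc_I2)
    then show ?thesis using False by simp
  qed simp
qed simp

text \<open>Bounded degree makes the ball of radius \<open>k\<close> finite, so an infinite
  component contains a point farther away, and a shortest path to it has distinct vertices. The
  relation is left general in order to apply the lemma also to the graph with a path
  removed.\<close>

lemma geodesic_segment:
  assumes deg: "bdeg R m" and inf: "infinite (R\<^sup>* `` {v})"
  shows "\<exists>\<beta>. length \<beta> = Suc k \<and> hd \<beta> = v \<and> distinct \<beta> \<and> successively (\<lambda>x y. (x, y) \<in> R) \<beta>"
proof -
  obtain l where "bdeg (\<Union>i\<le>k. R ^^ i) l" using energy_le_steps[OF deg, of k] by blast
  then have fin: "finite ((\<Union>i\<le>k. R ^^ i) `` {v})" by (rule bdegD)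
  have "\<not> R\<^sup>* `` {v} \<subseteq> (\<Union>i\<le>k. R ^^ i) `` {v}"
    using inf finite_subset[OF _ fin] by blast
  then obtain z where z: "(v, z) \<in> R\<^sup>*" "\<And>i. i \<le> k \<Longrightarrow> (v, z) \<notin> R ^^ i" by auto
  define n where "n = (LEAST n. (v, z) \<in> R ^^ n)"
  have "\<exists>n. (v, z) \<in> R ^^ n" using z(1) by (simp add: rtrancl_power)
  then have n: "(v, z) \<in> R ^^ n" unfolding n_def by (rule LeastI_ex)
  have nmin: "n \<le> i" if "(v, z) \<in> R ^^ i" for i unfolding n_def using that by (rule Least_le)
  have kn: "k < n" using z(2)[of n] n by (meson not_le)
  obtain f where f: "f 0 = v" "f n = z" "\<And>i. i < n \<Longrightarrow> (f i, f (Suc i)) \<in> R"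
    using n unfolding relpow_fun_conv by blast
  have seg: "(f i, f j) \<in> R ^^ (j - i)" if "i \<le> j" "j \<le> n" for i j
    unfolding relpow_fun_conv using that f(3) by (intro exI[of _ "\<lambda>l. f (i + l)"]) auto
  have short: "j \<le> i" if "(v, f j) \<in> R ^^ i" "j \<le> n" for i j
  proof -
    have "(f j, z) \<in> R ^^ (n - j)" using that seg[of j n] f(2) by simp
    then have "(v, z) \<in> R ^^ (i + (n - j))" using that(1) unfolding relpow_add by blast
    from nmin[OF this] that(2) show ?thesis by linarith
  qed
  have inj: "inj_on f {..n}"
  proof (rule inj_onI)
    fix i j assume ij: "i \<in> {..n}" "j \<in> {..n}" "f i = f j"
    then have "j \<le> i" using short[of j i] seg[of 0 i] f(1) by simp
    moreover have "i \<le> j" using ij short[of i j] seg[of 0 j] f(1) by simp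
    ultimately show "i = j" by simp
  qed
  let ?b = "map f [0..<Suc k]"
  have "inj_on f (set [0..<Suc k])" by (rule inj_on_subset[OF inj]) (use kn in auto)
  then have "distinct ?b" by (simp only: distinct_map distinct_upt simp_thms)
  moreover have "hd ?b = v" using f(1) by (simp del: upt_Suc add: hd_map)
  moreover have "successively (\<lambda>x y. (x, y) \<in> R) ?b"
    unfolding successively_conv_nth using f(3) kn by (auto simp del: upt_Suc)
  ultimately show ?thesis by (intro exI[of _ ?b]) (auto simp del: upt_Suc)
qed

text \<open>A connected graph with an isolated vertex has only that vertex; excluding it lets every
  walk move to a neighbour at each step.\<close>

locale bgraph =
  fixes V :: "'a set" and E :: "'a set set" and \<Delta> :: nat
  assumes simple: "simple_graph V E" and conn: "connected_graph V E"
    and deg_fin: "v \<in> V \<Longrightarrow> finite (nbrs E v)" and deg_le: "v \<in> V \<Longrightarrow> card (nbrs E v) \<le> \<Delta>"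
    and deg_pos: "v \<in> V \<Longrightarrow> nbrs E v \<noteq> {}"
begin

lemma edge_V: "{x, y} \<in> E \<Longrightarrow> x \<in> V \<and> y \<in> V \<and> x \<noteq> y"
  using simple unfolding simple_graph_def by (metis card_1_singleton_iff insert_absorb2 insert_subset one_eq_numeral_iff numeral_One semiring_norm(85) is_singletonI is_singleton_altdef)

lemma adj_V: "(x, y) \<in> adj E \<Longrightarrow> x \<in> V \<and> y \<in> V \<and> x \<noteq> y"
  using edge_V by (simp add: adj_def)

lemma nbrs_adj: "nbrs E x = adj E `` {x}"
  by (auto simp: nbrs_def adj_def)

lemma nbrs_V: "nbrs E x \<subseteq> V"
  using edge_V by (auto simp: nbrs_def)

lemma nbrs_sym: "y \<in> nbrs E x \<longleftrightarrow> x \<in> nbrs E y"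
  by (simp add: nbrs_def insert_commute)

lemma bdeg_adj: "bdeg (adj E) \<Delta>"
proof -
  have "(adj E)\<inverse> = adj E" by (auto simp: adj_def insert_commute)
  moreover have "finite (nbrs E x) \<and> card (nbrs E x) \<le> \<Delta>" for x
  proof (cases "x \<in> V")
    case False
    then have "nbrs E x = {}" using edge_V by (auto simp: nbrs_def)
    then show ?thesis by simp
  qed (use deg_fin deg_le in auto)
  ultimately show ?thesis by (simp add: bdeg_def nbrs_adj)
qed

lemma reach_V:
  assumes "x \<in> V" "y \<in> V"
  shows "(x, y) \<in> (adj E)\<^sup>*"
proof -
  obtain n \<gamma> where \<gamma>: "\<gamma> \<in> paths V E n" "hd \<gamma> = x" "last \<gamma> = y"
    using conn assms unfolding connected_graph_def by blast
  have "(hd \<gamma>, last \<gamma>) \<in> adj E ^^ (length \<gamma> - 1)"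
    using \<gamma>(1) by (intro successively_relpow) (auto simp: paths_iff adj_def)
  then show ?thesis using \<gamma> relpow_imp_rtrancl by blast
qed

lemma reach_eq_V:
  assumes "x \<in> V"
  shows "(adj E)\<^sup>* `` {x} = V"
proof -
  have "y \<in> V" if "(x, y) \<in> (adj E)\<^sup>*" for y
    using that assms by (induction rule: rtrancl_induct) (auto dest: adj_V)
  then show ?thesis using reach_V assms by auto
qed

lemma countable_V: "countable V"
proof (cases "V = {}")
  case False
  then obtain x where x: "x \<in> V" by auto
  have "finite ((adj E ^^ n) `` {x})" for n
  proof -
    obtain l where "bdeg (\<Union>i\<le>n. adj E ^^ i) l" using energy_le_steps[OF bdeg_adj, of n] by blast
    then have "finite ((\<Union>i\<le>n. adj E ^^ i) `` {x})" by (rule bdegD)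
    then show ?thesis by (rule finite_subset[rotated]) auto
  qed
  then have "countable (\<Union>n. (adj E ^^ n) `` {x})" by (intro countable_UN) (auto intro: countable_finite)
  moreover have "(\<Union>n. (adj E ^^ n) `` {x}) = (adj E)\<^sup>* `` {x}" by (auto simp: rtrancl_power)
  ultimately show ?thesis using reach_eq_V[OF x] by simp
qed simp

lemma \<Delta>_pos: "v \<in> V \<Longrightarrow> \<Delta> \<ge> 1"
  using deg_pos[of v] deg_le[of v] deg_fin[of v] by (metis One_nat_def Suc_leI card_gt_0_iff le_trans)

lemma paths_v_iff: "\<gamma> \<in> paths_v V E k \<longleftrightarrow> \<gamma> \<in> paths V E k \<and> distinct \<gamma>"
  by (auto simp: paths_v_def paths_iff card_distinct distinct_card)

lemma ex_paths_v:
  assumes "infinite V" "v \<in> V"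
  shows "\<exists>\<gamma>\<in>paths_v V E k. hd \<gamma> = v"
proof -
  have inf: "infinite ((adj E)\<^sup>* `` {v})" using reach_eq_V assms by simp
  obtain \<beta> where \<beta>: "length \<beta> = Suc k" "hd \<beta> = v" "distinct \<beta>" "successively (\<lambda>x y. (x, y) \<in> adj E) \<beta>"
    using geodesic_segment[OF bdeg_adj inf, of k] by blast
  have "set \<beta> \<subseteq> V"
  proof
    fix x assume "x \<in> set \<beta>"
    then obtain i where i: "i < length \<beta>" "x = \<beta> ! i" by (metis in_set_conv_nth)
    show "x \<in> V"
    proof (cases i)
      case 0
      then show ?thesis using i \<beta>(1,2) assms(2) by (cases \<beta>) auto
    next
      case (Suc j)
      then have "(\<beta> ! j, \<beta> ! i) \<in> adj E" using \<beta>(4) i by (auto simp: successively_conv_nth)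
      then show ?thesis using i adj_V by blast
    qed
  qed
  then show ?thesis using \<beta> by (intro bexI[of _ \<beta>]) (auto simp: paths_v_iff paths_iff adj_def)
qed

text \<open>If a self-avoiding path from \<open>v\<close> misses \<open>w\<close>, put
  \<open>w\<close> in front and drop the last vertex; \<open>k \<ge> 1\<close> keeps
  \<open>v\<close> on the path.\<close>

lemma ex_paths_v_edge:
  assumes "infinite V" "(v, w) \<in> adj E" "k \<ge> 1"
  shows "\<exists>\<gamma>\<in>paths_v V E k. v \<in> set \<gamma> \<and> w \<in> set \<gamma>"
proof -
  have vw: "v \<in> V" "w \<in> V" "v \<noteq> w" using adj_V assms(2) by auto
  obtain \<beta> where "\<beta> \<in> paths_v V E k" "hd \<beta> = v" using ex_paths_v[OF assms(1) vw(1)] by blast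
  then have \<beta>: "length \<beta> = Suc k" "hd \<beta> = v" "distinct \<beta>" and inV: "set \<beta> \<subseteq> V"
    and s: "successively (\<lambda>x y. {x, y} \<in> E) \<beta>"
    by (auto simp: paths_v_iff paths_iff)
  show ?thesis
  proof (cases "w \<in> set \<beta>")
    case True
    have "v \<in> set \<beta>" using \<beta>(1,2) by (cases \<beta>) auto
    then show ?thesis using True \<beta> inV s by (intro bexI[of _ \<beta>]) (auto simp: paths_v_iff paths_iff)
  next
    case False
    obtain \<beta>' where b: "\<beta> = v # \<beta>'" using \<beta>(1,2) by (cases \<beta>) auto
    then have ne: "\<beta>' \<noteq> []" using \<beta>(1) assms(3) by auto
    let ?g = "w # butlast \<beta>"
    have bl: "butlast \<beta> = v # butlast \<beta>'" using b ne by simp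
    have "successively (\<lambda>x y. {x, y} \<in> E) (butlast \<beta> @ [last \<beta>])" using s b by simp
    then have "successively (\<lambda>x y. {x, y} \<in> E) (butlast \<beta>)"
      unfolding successively_append_iff by blast
    then have "successively (\<lambda>x y. {x, y} \<in> E) ?g"
      using assms(2) bl by (auto simp: successively_Cons adj_def insert_commute)
    moreover have "distinct ?g" using \<beta>(3) False by (auto simp: distinct_butlast dest: in_set_butlastD)
    moreover have "set ?g \<subseteq> V" using inV vw by (auto dest: in_set_butlastD)
    moreover have "length ?g = Suc k" using \<beta>(1) by simp
    ultimately have "?g \<in> paths_v V E k" by (simp add: paths_v_iff paths_iff)
    then show ?thesis using bl by (intro bexI[of _ ?g]) auto
  qed
qed

lemma paths_ne: "\<gamma> \<in> paths V E k \<Longrightarrow> \<gamma> \<noteq> []"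
  by (auto simp: paths_iff)

lemma paths_last: "\<gamma> \<in> paths V E k \<Longrightarrow> last \<gamma> \<in> V" "\<gamma> \<in> paths V E k \<Longrightarrow> hd \<gamma> \<in> V"
  using paths_ne[of \<gamma> k] last_in_set[of \<gamma>] hd_in_set[of \<gamma>] by (auto simp: paths_iff)

lemma paths_snoc:
  assumes "\<gamma> \<in> paths V E k" "v \<in> nbrs E (last \<gamma>)"
  shows "tl \<gamma> @ [v] \<in> paths V E k"
proof -
  obtain x \<beta> where \<gamma>: "\<gamma> = x # \<beta>" using paths_ne[OF assms(1)] by (cases \<gamma>) auto
  have "v \<in> V" using assms(2) nbrs_V by auto
  then show ?thesis using assms unfolding \<gamma> paths_iff
    by (cases "\<beta> = []") (auto simp: successively_append_iff successively_Cons nbrs_def)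
qed

lemma paths_rev: "\<gamma> \<in> paths V E k \<Longrightarrow> rev \<gamma> \<in> paths V E k"
  by (auto simp: paths_iff insert_commute)

lemma finite_paths_at: "finite {\<gamma> \<in> paths V E k. v \<in> set \<gamma>}"
proof -
  obtain l where l: "bdeg (\<Union>i\<le>k. adj E ^^ i) l" using energy_le_steps[OF bdeg_adj, of k] by blast
  define S where "S = (\<Union>i\<le>k. adj E ^^ i) `` {v} \<union> (\<Union>i\<le>k. adj E ^^ i)\<inverse> `` {v}"
  have "finite S" unfolding S_def using l by (simp only: finite_Un bdegD simp_thms)
  have "set \<gamma> \<subseteq> S" if \<gamma>: "\<gamma> \<in> paths V E k" "v \<in> set \<gamma>" for \<gamma>
  proof
    fix x assume "x \<in> set \<gamma>"
    then obtain i where i: "i < Suc k" "x = \<gamma> ! i" using \<gamma>(1) by (metis in_set_conv_nth paths_iff)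
    obtain j where j: "j < Suc k" "v = \<gamma> ! j" using \<gamma> by (metis in_set_conv_nth paths_iff)
    have seg: "(\<gamma> ! i, \<gamma> ! j) \<in> adj E ^^ (j - i)" if "i \<le> j" "j \<le> k" for i j
      unfolding relpow_fun_conv using \<gamma>(1) that
      by (intro exI[of _ "\<lambda>l. \<gamma> ! (i + l)"]) (auto simp: paths_iff successively_conv_nth adj_def)
    show "x \<in> S"
    proof (cases "i \<le> j")
      case True
      then have "(x, v) \<in> adj E ^^ (j - i)" using seg i j by simp
      then show ?thesis using j by (auto simp: S_def intro!: bexI[of _ "j - i"])
    next
      case False
      then have "(v, x) \<in> adj E ^^ (i - j)" using seg[of j i] i j by simp
      then show ?thesis using i by (auto simp: S_def intro!: bexI[of _ "i - j"])
    qed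
  qed
  then have "{\<gamma> \<in> paths V E k. v \<in> set \<gamma>} \<subseteq> {\<gamma>. set \<gamma> \<subseteq> S \<and> length \<gamma> = Suc k}"
    by (auto simp: paths_iff)
  then show ?thesis using finite_lists_length_eq[OF \<open>finite S\<close>] by (rule finite_subset)
qed

definition opt :: "('a list \<Rightarrow> 'a set) \<Rightarrow> 'a list \<Rightarrow> 'a set" where
  "opt F \<gamma> = (if F \<gamma> = {} then nbrs E (last \<gamma>) else F \<gamma>)"

end

text \<open>The set \<Omega> may be any set of paths that the chain cannot leave: all paths, where
  the chain follows the walk including its stuck moves, or trails and self-avoiding paths, to which
  the reachability hypotheses refer.\<close>

locale pchain = bgraph V E \<Delta> for V :: "'a set" and E \<Delta> +
  fixes k :: nat and F :: "'a list \<Rightarrow> 'a set" and \<Omega> :: "'a list set"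
  assumes \<Omega>_paths: "\<Omega> \<subseteq> paths V E k"
    and F_sub: "\<gamma> \<in> \<Omega> \<Longrightarrow> F \<gamma> \<subseteq> nbrs E (last \<gamma>)"
    and opt_closed: "\<gamma> \<in> \<Omega> \<Longrightarrow> v \<in> opt F \<gamma> \<Longrightarrow> tl \<gamma> @ [v] \<in> \<Omega>"
begin

abbreviation "K \<equiv> path_chain E F"

lemma opt_props:
  assumes "\<gamma> \<in> \<Omega>"
  shows "finite (opt F \<gamma>)" "opt F \<gamma> \<noteq> {}" "opt F \<gamma> \<subseteq> nbrs E (last \<gamma>)" "card (opt F \<gamma>) \<le> \<Delta>"
    "card (opt F \<gamma>) > 0"
proof -
  have l: "last \<gamma> \<in> V" using assms \<Omega>_paths paths_last by blast
  show s: "opt F \<gamma> \<subseteq> nbrs E (last \<gamma>)" using F_sub[OF assms] by (simp add: opt_def)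
  show f: "finite (opt F \<gamma>)" using s deg_fin[OF l] by (rule finite_subset)
  show n: "opt F \<gamma> \<noteq> {}" using deg_pos[OF l] by (simp add: opt_def)
  show "card (opt F \<gamma>) \<le> \<Delta>" using card_mono[OF deg_fin[OF l] s] deg_le[OF l] by linarith
  show "card (opt F \<gamma>) > 0" using f n by (simp add: card_gt_0_iff)
qed

lemma K_eq: "\<gamma> \<in> \<Omega> \<Longrightarrow> K \<gamma> = map_pmf (\<lambda>v. tl \<gamma> @ [v]) (pmf_of_set (opt F \<gamma>))"
  using deg_pos[of "last \<gamma>"] \<Omega>_paths paths_last(1)
  by (auto simp: path_chain_def uniform_or_def uniform_nbr_def opt_def)

lemma set_K: "\<gamma> \<in> \<Omega> \<Longrightarrow> set_pmf (K \<gamma>) = (\<lambda>v. tl \<gamma> @ [v]) ` opt F \<gamma>"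
  using opt_props by (simp add: K_eq set_pmf_of_set)

lemma pmf_K: "\<gamma> \<in> \<Omega> \<Longrightarrow> \<gamma>' \<in> set_pmf (K \<gamma>) \<Longrightarrow> pmf (K \<gamma>) \<gamma>' = 1 / real (card (opt F \<gamma>))"
proof -
  assume \<gamma>: "\<gamma> \<in> \<Omega>" "\<gamma>' \<in> set_pmf (K \<gamma>)"
  then obtain v where v: "v \<in> opt F \<gamma>" "\<gamma>' = tl \<gamma> @ [v]" by (auto simp: set_K)
  have "inj (\<lambda>v. tl \<gamma> @ [v])" by (auto simp: inj_def)
  then have "pmf (K \<gamma>) \<gamma>' = pmf (pmf_of_set (opt F \<gamma>)) v"
    unfolding K_eq[OF \<gamma>(1)] v(2) by (rule pmf_map_inj')
  then show ?thesis using v opt_props[OF \<gamma>(1)] by simp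
qed

lemma pmf_K_ge: "\<gamma> \<in> \<Omega> \<Longrightarrow> \<gamma>' \<in> set_pmf (K \<gamma>) \<Longrightarrow> pmf (K \<gamma>) \<gamma>' \<ge> 1 / real \<Delta>"
  using pmf_K[of \<gamma> \<gamma>'] opt_props(4,5)[of \<gamma>] by (simp add: frac_le)

sublocale fin_chain "path_chain E F" \<Omega>
  by standard (use opt_props opt_closed in \<open>auto simp: set_K\<close>)

lemma T_iff: "(\<gamma>, \<gamma>') \<in> T \<longleftrightarrow> \<gamma> \<in> \<Omega> \<and> (\<exists>v\<in>opt F \<gamma>. \<gamma>' = tl \<gamma> @ [v])"
  by (auto simp: T_def set_K)

text \<open>A predecessor of \<open>\<gamma>'\<close> is \<open>butlast \<gamma>'\<close> with one
  vertex put in front, and this vertex is a neighbour of \<open>hd \<gamma>'\<close>.\<close>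

lemma T_bdeg: "bdeg T \<Delta>"
proof -
  have "finite (T `` {\<gamma>}) \<and> card (T `` {\<gamma>}) \<le> \<Delta>" for \<gamma>
  proof (cases "\<gamma> \<in> \<Omega>")
    case True
    then have "T `` {\<gamma>} = (\<lambda>v. tl \<gamma> @ [v]) ` opt F \<gamma>" by (auto simp: T_iff)
    then show ?thesis using opt_props[OF True] card_image_le[of "opt F \<gamma>" "\<lambda>v. tl \<gamma> @ [v]"] by simp
  next
    case False
    then have "T `` {\<gamma>} = {}" by (auto simp: T_iff)
    then show ?thesis by simp
  qed
  moreover have "finite (T\<inverse> `` {\<gamma>'}) \<and> card (T\<inverse> `` {\<gamma>'}) \<le> \<Delta>" for \<gamma>'
  proof -
    have sub: "T\<inverse> `` {\<gamma>'} \<subseteq> (\<lambda>u. u # butlast \<gamma>') ` nbrs E (hd \<gamma>')"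
    proof
      fix \<gamma> assume "\<gamma> \<in> T\<inverse> `` {\<gamma>'}"
      then obtain v where \<gamma>: "\<gamma> \<in> \<Omega>" "v \<in> opt F \<gamma>" "\<gamma>' = tl \<gamma> @ [v]" by (auto simp: T_iff)
      then obtain x \<beta> where c: "\<gamma> = x # \<beta>" using \<Omega>_paths paths_ne by (cases \<gamma>) auto
      have "hd \<gamma>' \<in> nbrs E x"
      proof (cases \<beta>)
        case Nil
        then show ?thesis using \<gamma> c opt_props(3)[OF \<gamma>(1)] by auto
      next
        case (Cons y \<beta>')
        then have "{x, y} \<in> E" using \<gamma>(1) \<Omega>_paths c by (auto simp: paths_iff)
        then show ?thesis using \<gamma> c Cons by (simp add: nbrs_def)
      qed
      then have "x \<in> nbrs E (hd \<gamma>')" using nbrs_sym by auto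
      then show "\<gamma> \<in> (\<lambda>u. u # butlast \<gamma>') ` nbrs E (hd \<gamma>')" using \<gamma>(3) c by auto
    qed
    have d: "finite (nbrs E (hd \<gamma>'))" "card (nbrs E (hd \<gamma>')) \<le> \<Delta>"
      using bdegD[OF bdeg_adj] by (auto simp: nbrs_adj)
    then show ?thesis using surj_card_le[OF _ sub] finite_subset[OF sub] by (meson finite_imageI le_trans)
  qed
  ultimately show ?thesis unfolding bdeg_def by blast
qed

lemma T_adj: "(\<gamma>, \<gamma>') \<in> T \<Longrightarrow> (last \<gamma>, last \<gamma>') \<in> adj E"
  using opt_props(3)[of \<gamma>] by (auto simp: T_iff nbrs_adj)

lemma T_adj_hd: "(\<gamma>, \<gamma>') \<in> T \<Longrightarrow> (hd \<gamma>, hd \<gamma>') \<in> adj E"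
proof -
  assume t: "(\<gamma>, \<gamma>') \<in> T"
  then obtain v where \<gamma>: "\<gamma> \<in> \<Omega>" "v \<in> opt F \<gamma>" "\<gamma>' = tl \<gamma> @ [v]" by (auto simp: T_iff)
  then obtain x \<beta> where c: "\<gamma> = x # \<beta>" using \<Omega>_paths paths_ne by (cases \<gamma>) auto
  show ?thesis
  proof (cases \<beta>)
    case Nil
    then show ?thesis using \<gamma> c opt_props(3)[OF \<gamma>(1)] by (auto simp: nbrs_adj)
  next
    case (Cons y \<beta>')
    then have "{x, y} \<in> E" using \<gamma>(1) \<Omega>_paths c by (auto simp: paths_iff)
    then show ?thesis using \<gamma> c Cons by (simp add: adj_def)
  qed
qed

end

subsection \<open>Edges of a path\<close>

text \<open>The crossed edges in order and with multiplicity, so that being a trail becomes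
  distinctness of this list.\<close>

fun elist :: "'a list \<Rightarrow> 'a set list" where
  "elist [] = []"
| "elist [x] = []"
| "elist (x # y # xs) = {x, y} # elist (y # xs)"

lemma length_elist [simp]: "length (elist \<gamma>) = length \<gamma> - 1"
  by (induction \<gamma> rule: elist.induct) auto

lemma nth_elist: "Suc i < length \<gamma> \<Longrightarrow> elist \<gamma> ! i = {\<gamma> ! i, \<gamma> ! Suc i}"
  by (induction \<gamma> arbitrary: i rule: elist.induct) (auto simp: nth_Cons split: nat.splits)

lemma path_edges_elist: "path_edges \<gamma> = set (elist \<gamma>)"
proof -
  have "path_edges \<gamma> = {elist \<gamma> ! i |i. i < length (elist \<gamma>)}"
  proof (intro equalityI subsetI)
    fix e assume "e \<in> path_edges \<gamma>"
    then obtain i where "1 \<le> i" "i < length \<gamma>" "e = {\<gamma> ! (i - 1), \<gamma> ! i}" by (auto simp: path_edges_def)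
    then show "e \<in> {elist \<gamma> ! i |i. i < length (elist \<gamma>)}"
      using nth_elist[of "i - 1" \<gamma>] by (intro CollectI exI[of _ "i - 1"]) auto
  next
    fix e assume "e \<in> {elist \<gamma> ! i |i. i < length (elist \<gamma>)}"
    then obtain i where "i < length \<gamma> - 1" "e = elist \<gamma> ! i" by auto
    then show "e \<in> path_edges \<gamma>"
      using nth_elist[of i \<gamma>] unfolding path_edges_def by (intro CollectI exI[of _ "Suc i"]) auto
  qed
  then show ?thesis by (simp add: set_conv_nth)
qed

lemma elist_Cons: "xs \<noteq> [] \<Longrightarrow> elist (x # xs) = {x, hd xs} # elist xs"
  by (cases xs) auto

lemma elist_snoc: "xs \<noteq> [] \<Longrightarrow> elist (xs @ [x]) = elist xs @ [{last xs, x}]"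
  by (induction xs rule: elist.induct) auto

lemma elist_rev: "elist (rev xs) = rev (elist xs)"
proof (induction xs rule: elist.induct)
  case (3 x y xs)
  have "elist (rev (x # y # xs)) = elist (rev (y # xs)) @ [{last (rev (y # xs)), x}]"
    using elist_snoc[of "rev (y # xs)" x] by simp
  then show ?case using 3 by (simp add: insert_commute)
qed auto

lemma elist_subset: "e \<in> set (elist xs) \<Longrightarrow> e \<subseteq> set xs"
  by (induction xs rule: elist.induct) auto

lemma distinct_elist: "distinct xs \<Longrightarrow> distinct (elist xs)"
  by (induction xs rule: elist.induct) (auto dest: elist_subset)

text \<open>An occurrence of \<open>z\<close> in the interior meets two edges of the path, one at an
  end meets a single edge. Consecutive vertices must differ, as a loop would be counted once instead
  of twice.\<close>

lemma incidence_count: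
  "xs \<noteq> [] \<Longrightarrow> successively (\<noteq>) xs \<Longrightarrow>
    length (filter (\<lambda>e. z \<in> e) (elist xs)) + (if hd xs = z then 1 else 0) + (if last xs = z then 1 else 0)
      = 2 * count_list xs z"
  by (induction xs rule: elist.induct) auto

lemma energy_le_map:
  assumes e: "energy_le R f D" and inj: "inj_on \<phi> R'" and sub: "\<phi> ` R' \<subseteq> R"
    and g: "\<And>x y. (x, y) \<in> R' \<Longrightarrow> (g x - g y)\<^sup>2 = (f (fst (\<phi> (x, y))) - f (snd (\<phi> (x, y))))\<^sup>2"
  shows "energy_le R' g D"
  unfolding energy_le_def
proof (intro allI impI)
  fix B assume B: "finite B \<and> B \<subseteq> R'"
  have "(\<Sum>(x, y)\<in>B. (g x - g y)\<^sup>2) = (\<Sum>i\<in>B. (f (fst (\<phi> i)) - f (snd (\<phi> i)))\<^sup>2)"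
    using B g by (intro sum.cong refl) auto
  also have "\<dots> \<le> D"
  proof (rule energy_inj_le[OF e])
    show "\<phi> ` B \<subseteq> R" using B sub by blast
    show "inj_on \<phi> B" by (rule inj_on_subset[OF inj]) (use B in blast)
  qed (use B in simp)
  finally show "(\<Sum>(x, y)\<in>B. (g x - g y)\<^sup>2) \<le> D" .
qed

context bgraph
begin

lemma paths_e_iff: "\<gamma> \<in> paths_e V E k \<longleftrightarrow> \<gamma> \<in> paths V E k \<and> distinct (elist \<gamma>)"
proof -
  have "card (set (elist \<gamma>)) = length (elist \<gamma>) \<longleftrightarrow> distinct (elist \<gamma>)"
    using card_distinct distinct_card by blast
  then show ?thesis by (auto simp: paths_e_def path_edges_elist paths_iff)
qed

lemma paths_v_subset_e: "paths_v V E k \<subseteq> paths_e V E k"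
  by (auto simp: paths_e_iff paths_v_iff distinct_elist)

lemma paths_0: "paths V E 0 = (\<lambda>v. [v]) ` V"
  by (auto simp: paths_iff length_Suc_conv)

lemma elist_E: "\<gamma> \<in> paths V E k \<Longrightarrow> set (elist \<gamma>) \<subseteq> E"
  unfolding paths_iff set_conv_nth[of "elist \<gamma>"]
  by (auto simp: nth_elist successively_conv_nth)

text \<open>The edges used at the end vertex are given by the incidence count; distinctness of the
  crossed edges allows subtracting them from the degree.\<close>

lemma card_edge_free:
  assumes \<gamma>: "\<gamma> \<in> paths V E k" and d: "distinct (elist \<gamma>)"
  shows "card (edge_free E \<gamma>) + 2 * count_list \<gamma> (last \<gamma>) =
    card (nbrs E (last \<gamma>)) + 1 + (if hd \<gamma> = last \<gamma> then 1 else 0)"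
proof -
  let ?b = "last \<gamma>"
  let ?I = "{e \<in> set (elist \<gamma>). ?b \<in> e}"
  have ne: "\<gamma> \<noteq> []" by (rule paths_ne[OF \<gamma>])
  have s: "successively (\<noteq>) \<gamma>"
    using \<gamma> edge_V unfolding paths_iff by (auto elim!: successively_mono)
  have "card ?I = length (filter (\<lambda>e. ?b \<in> e) (elist \<gamma>))"
    using d distinct_card[of "filter (\<lambda>e. ?b \<in> e) (elist \<gamma>)"] by simp
  then have I: "card ?I + (if hd \<gamma> = ?b then 1 else 0) + 1 = 2 * count_list \<gamma> ?b"
    using incidence_count[OF ne s, of ?b] by simp
  have fin: "finite (nbrs E ?b)" using \<gamma> deg_fin paths_last by blast
  let ?U = "{v \<in> nbrs E ?b. {?b, v} \<in> set (elist \<gamma>)}"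
  have "bij_betw (\<lambda>v. {?b, v}) ?U ?I"
  proof (rule bij_betwI')
    fix e assume e: "e \<in> ?I"
    then have "e \<in> E" using elist_E[OF \<gamma>] by auto
    then obtain x y where "e = {x, y}" using simple unfolding simple_graph_def
      by (metis card_2_iff)
    then obtain v where "e = {?b, v}" using e by auto
    then show "\<exists>x\<in>?U. e = {?b, x}" using e \<open>e \<in> E\<close> by (auto simp: nbrs_def)
  qed (auto simp: doubleton_eq_iff)
  then have "card ?U = card ?I" by (rule bij_betw_same_card)
  moreover have "card (nbrs E ?b) = card (edge_free E \<gamma>) + card ?U"
  proof -
    have a: "edge_free E \<gamma> \<union> ?U = nbrs E ?b" by (auto simp: edge_free_def path_edges_elist)
    have "edge_free E \<gamma> \<inter> ?U = {}" by (auto simp: edge_free_def path_edges_elist)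
    moreover have "finite (edge_free E \<gamma>)" "finite ?U" using fin a by (auto intro: finite_subset)
    ultimately have "card (edge_free E \<gamma> \<union> ?U) = card (edge_free E \<gamma>) + card ?U"
      by (intro card_Un_disjoint)
    then show ?thesis unfolding a .
  qed
  ultimately show ?thesis using I by simp
qed

lemma card_paths_hd: "finite {\<gamma> \<in> paths V E k. hd \<gamma> = v} \<and> card {\<gamma> \<in> paths V E k. hd \<gamma> = v} \<le> \<Delta> ^ k"
proof (induction k arbitrary: v)
  case 0
  have "{\<gamma> \<in> paths V E 0. hd \<gamma> = v} \<subseteq> {[v]}" by (auto simp: paths_0)
  from card_mono[OF _ this] finite_subset[OF this] show ?case by simp
next
  case (Suc k)
  have sub: "{\<gamma> \<in> paths V E (Suc k). hd \<gamma> = v} \<subseteq> (\<Union>w\<in>nbrs E v. (#) v ` {\<gamma> \<in> paths V E k. hd \<gamma> = w})"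
    (is "_ \<subseteq> ?U")
  proof
    fix \<gamma> assume "\<gamma> \<in> {\<gamma> \<in> paths V E (Suc k). hd \<gamma> = v}"
    then obtain y \<beta> where "\<gamma> = v # y # \<beta>" "y # \<beta> \<in> paths V E k" "{v, y} \<in> E"
      by (auto simp: paths_iff length_Suc_conv)
    then show "\<gamma> \<in> ?U" by (auto simp: nbrs_def)
  qed
  have n: "finite (nbrs E v)" "card (nbrs E v) \<le> \<Delta>" using bdegD[OF bdeg_adj] by (auto simp: nbrs_adj)
  have "card ?U \<le> (\<Sum>w\<in>nbrs E v. card ((#) v ` {\<gamma> \<in> paths V E k. hd \<gamma> = w}))"
    by (rule card_UN_le[OF n(1)])
  also have "\<dots> \<le> (\<Sum>w\<in>nbrs E v. \<Delta> ^ k)"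
    using Suc by (intro sum_mono) (meson card_image_le le_trans)
  also have "\<dots> \<le> \<Delta> ^ Suc k" using n by simp
  finally have "card ?U \<le> \<Delta> ^ Suc k" .
  moreover have "finite ?U" using n Suc by auto
  ultimately show ?case using sub by (meson card_mono finite_subset le_trans)
qed

text \<open>Evaluation at \<open>x\<close> is bounded in the Dirichlet seminorm on finitely
  supported functions, that is, \<open>x\<close> has positive capacity.\<close>

definition srw_ineq :: "'a \<Rightarrow> real \<Rightarrow> bool" where
  "srw_ineq x C \<longleftrightarrow> (\<forall>g D. finite {v \<in> V. g v \<noteq> 0} \<longrightarrow> energy_le (adj E) g D \<longrightarrow> (g x)\<^sup>2 \<le> C * D)"

text \<open>With an empty set of free moves every move is uniform over all neighbours, so on
  one-vertex paths this is the simple random walk.\<close>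

abbreviation "K0 \<equiv> path_chain E (\<lambda>_. {})"

lemma srw_pchain: "pchain V E \<Delta> 0 (\<lambda>_. {}) (paths V E 0)"
proof
  show "tl \<gamma> @ [v] \<in> paths V E 0" if "\<gamma> \<in> paths V E 0" "v \<in> opt (\<lambda>_. {}) \<gamma>" for \<gamma> v
    using that paths_snoc by (simp add: opt_def)
qed auto

end

section \<open>Transport of energy inequalities between vertices and paths\<close>

context pchain
begin

text \<open>The number of moves in the weight cancels the uniform step probability, so the flow
  along a transition is \<open>W (tl \<gamma>)\<close>. As \<open>tl \<gamma>\<close> is also
  \<open>butlast \<gamma>'\<close>, the flow depends on the shared part only and inherits the
  symmetry of \<open>W\<close> under reversal.\<close>

lemma rev_flow_weight:
  fixes W :: "'a list \<Rightarrow> real"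
  assumes rev_in: "\<And>\<gamma>. \<gamma> \<in> \<Omega> \<Longrightarrow> rev \<gamma> \<in> \<Omega>"
    and W_rev: "\<And>\<gamma>. \<gamma> \<in> \<Omega> \<Longrightarrow> W (rev (tl \<gamma>)) = W (tl \<gamma>)"
    and T_rev: "\<And>\<gamma> \<gamma>'. (\<gamma>, \<gamma>') \<in> T \<Longrightarrow> (rev \<gamma>', rev \<gamma>) \<in> T"
    and lo: "lo > 0" "\<And>\<gamma>. \<gamma> \<in> \<Omega> \<Longrightarrow> lo \<le> W (tl \<gamma>)"
    and hi: "\<And>\<gamma>. \<gamma> \<in> \<Omega> \<Longrightarrow> W (tl \<gamma>) \<le> 1"
    and sym: "\<And>\<gamma>. \<gamma> \<in> \<Omega> \<Longrightarrow>
      real (card (opt F (rev \<gamma>))) * W (tl (rev \<gamma>)) = real (card (opt F \<gamma>)) * W (tl \<gamma>)"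
  shows "rev_flow K \<Omega> (\<lambda>\<gamma>. real (card (opt F \<gamma>)) * W (tl \<gamma>)) rev lo \<Delta> \<Delta>"
proof
  let ?\<pi> = "\<lambda>\<gamma>. real (card (opt F \<gamma>)) * W (tl \<gamma>)"
  have c: "?\<pi> x * pmf (K x) y = (if (x, y) \<in> T then W (tl x) else 0)" if "x \<in> \<Omega>" for x y
  proof (cases "y \<in> set_pmf (K x)")
    case True
    then show ?thesis using that pmf_K[OF that True] opt_props(5)[OF that] by (simp add: T_def)
  next
    case False
    then show ?thesis by (simp add: T_def set_pmf_iff)
  qed
  show "?\<pi> x \<le> real \<Delta>" if "x \<in> \<Omega>" for x
  proof -
    have "?\<pi> x \<le> real \<Delta> * 1"
      using opt_props(4)[OF that] hi[OF that] lo(1) lo(2)[OF that] by (intro mult_mono) auto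
    then show ?thesis by simp
  qed
  show "lo \<le> ?\<pi> x * pmf (K x) y" if "x \<in> \<Omega>" "y \<in> set_pmf (K x)" for x y
    unfolding c[OF that(1)] using that lo(2) by (simp add: T_def)
  show "?\<pi> x * pmf (K x) y = ?\<pi> (rev y) * pmf (K (rev y)) (rev x)" if xy: "x \<in> \<Omega>" "y \<in> \<Omega>" for x y
  proof -
    have i: "(rev y, rev x) \<in> T \<longleftrightarrow> (x, y) \<in> T" using T_rev[of x y] T_rev[of "rev y" "rev x"] by auto
    have "W (tl (rev y)) = W (tl x)" if "(x, y) \<in> T"
    proof -
      obtain v where "y = tl x @ [v]" using \<open>(x, y) \<in> T\<close> by (auto simp: T_iff)
      then have "tl (rev y) = rev (tl x)" by simp
      then show ?thesis using W_rev[OF xy(1)] by simp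
    qed
    then show ?thesis using c[OF xy(1), of y] c[OF rev_in[OF xy(2)], of "rev x"] i by auto
  qed
qed (use assms T_bdeg in auto)

text \<open>Sample \<open>f\<close> on one self-avoiding path \<open>s v\<close> from each vertex.
  For adjacent \<open>v\<close> and \<open>w\<close>, the paths \<open>s v\<close> and
  \<open>s w\<close> are linked through a third path containing both vertices, so the sampled
  function has energy controlled by that of \<open>f\<close>. One more link leads from
  \<open>s (hd z)\<close> to \<open>z\<close>.\<close>

lemma compare_srw:
  assumes inf: "infinite V" and k: "k \<ge> 1" and sub: "paths_v V E k \<subseteq> \<Omega>"
    and reach: "\<And>\<gamma> \<gamma>'. \<gamma> \<in> \<Omega> \<Longrightarrow> \<gamma>' \<in> \<Omega> \<Longrightarrow> set \<gamma> \<inter> set \<gamma>' \<noteq> {} \<Longrightarrow> (\<gamma>, \<gamma>') \<in> (\<Union>n\<le>N. T ^^ n)"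
    and z: "z \<in> \<Omega>" and C: "srw_ineq (hd z) C" "C \<ge> 0"
  shows "\<exists>C'\<ge>0. \<forall>f D. finite {x \<in> \<Omega>. f x \<noteq> 0} \<longrightarrow> energy_le T f D \<longrightarrow> (f z)\<^sup>2 \<le> C' * D"
proof -
  let ?U = "\<Union>n\<le>N. T ^^ n"
  obtain c n where c: "c \<ge> 0" and n: "bdeg ?U n"
    and e: "\<And>f D. energy_le T f D \<Longrightarrow> energy_le ?U f (c * D)" using energy_le_steps[OF T_bdeg] by blast
  have "\<exists>\<gamma>. v \<in> V \<longrightarrow> \<gamma> \<in> paths_v V E k \<and> hd \<gamma> = v" for v using ex_paths_v[OF inf, of v k] by auto
  then obtain s where s: "\<And>v. v \<in> V \<Longrightarrow> s v \<in> paths_v V E k" "\<And>v. v \<in> V \<Longrightarrow> hd (s v) = v" by metis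
  have s\<Omega>: "s v \<in> \<Omega>" if "v \<in> V" for v using s(1)[OF that] sub by auto
  have vs: "v \<in> set (s v)" if "v \<in> V" for v
    using s[OF that] s\<Omega>[OF that] \<Omega>_paths paths_ne hd_in_set by (metis subsetD)
  have inU: "(s v, s w) \<in> ?U O ?U" if vw: "(v, w) \<in> adj E" for v w
  proof -
    have V: "v \<in> V" "w \<in> V" using adj_V[OF vw] by auto
    obtain \<tau> where \<tau>: "\<tau> \<in> \<Omega>" "v \<in> set \<tau>" "w \<in> set \<tau>"
      using ex_paths_v_edge[OF inf vw k] sub by auto
    have "(s v, \<tau>) \<in> ?U" using reach[OF s\<Omega>[OF V(1)] \<tau>(1)] vs[OF V(1)] \<tau> by blast
    moreover have "(\<tau>, s w) \<in> ?U" using reach[OF \<tau>(1) s\<Omega>[OF V(2)]] vs[OF V(2)] \<tau> by blast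
    ultimately show ?thesis by blast
  qed
  have "(f z)\<^sup>2 \<le> (2 * c + 2 * C * (4 * real n * c)) * D"
    if f: "finite {x \<in> \<Omega>. f x \<noteq> 0}" and fe: "energy_le T f D" for f D
  proof -
    define g where "g v = f (s v)" for v
    have eU: "energy_le ?U f (c * D)" by (rule e[OF fe])
    have "energy_le (?U O ?U) f (2 * real n * (c * D + c * D))"
      by (rule energy_le_comp[OF n n eU eU])
    then have "energy_le (adj E) g (2 * real n * (c * D + c * D))"
    proof (rule energy_le_map[where \<phi> = "\<lambda>i. (s (fst i), s (snd i))"])
      show "inj_on (\<lambda>i. (s (fst i), s (snd i))) (adj E)"
        by (rule inj_on_inverseI[of _ "\<lambda>i. (hd (fst i), hd (snd i))"]) (auto dest!: adj_V simp: s)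
    qed (use inU in \<open>auto simp: g_def\<close>)
    moreover have "finite {v \<in> V. g v \<noteq> 0}"
    proof (rule finite_subset[OF _ finite_imageI[OF f, of hd]])
      show "{v \<in> V. g v \<noteq> 0} \<subseteq> hd ` {x \<in> \<Omega>. f x \<noteq> 0}"
        using s\<Omega> s(2) by (force simp: g_def)
    qed
    ultimately have gz: "(g (hd z))\<^sup>2 \<le> C * (2 * real n * (c * D + c * D))"
      using C(1) unfolding srw_ineq_def by blast
    have hz: "hd z \<in> V" using z \<Omega>_paths paths_last by blast
    have "(z, s (hd z)) \<in> ?U"
      using reach[OF z s\<Omega>[OF hz]] vs[OF hz] z \<Omega>_paths paths_ne hd_in_set by (metis IntI emptyE subsetD)
    then have "(f z - g (hd z))\<^sup>2 \<le> c * D" unfolding g_def by (rule energy_le_single[OF eU])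
    moreover have "(f z)\<^sup>2 \<le> 2 * (f z - g (hd z))\<^sup>2 + 2 * (g (hd z))\<^sup>2"
      using sq_diff_le[of "f z" 0 "g (hd z)"] by simp
    ultimately show ?thesis using gz by (simp add: algebra_simps)
  qed
  then show ?thesis using c C(2) by (intro exI[of _ "2 * c + 2 * C * (4 * real n * c)"]) auto
qed

text \<open>An odd function satisfies \<open>a x - a (rev x) = 2 * a x\<close>, so its square sum is
  an energy along the links from \<open>x\<close> to \<open>rev x\<close>. These may also use
  transitions backwards, since energy ignores direction.\<close>

lemma anti_of_reach:
  assumes reach: "\<And>\<gamma>. \<gamma> \<in> \<Omega> \<Longrightarrow> (\<gamma>, rev \<gamma>) \<in> (\<Union>n\<le>N. (T \<union> T\<inverse>) ^^ n)"
  shows "\<exists>C1\<ge>0. \<forall>a D. (\<forall>x\<in>\<Omega>. a (rev x) = - a x) \<longrightarrow> finite {x \<in> \<Omega>. a x \<noteq> 0} \<longrightarrow>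
      energy_le T a D \<longrightarrow> (\<Sum>x\<in>{x \<in> \<Omega>. a x \<noteq> 0}. (a x)\<^sup>2) \<le> C1 * D"
proof -
  let ?U = "\<Union>n\<le>N. (T \<union> T\<inverse>) ^^ n"
  obtain c where c: "c \<ge> 0" and e: "\<And>f D. energy_le (T \<union> T\<inverse>) f D \<Longrightarrow> energy_le ?U f (c * D)"
    using energy_le_steps[OF bdeg_Un[OF T_bdeg bdeg_converse[OF T_bdeg]]] by blast
  have "(\<Sum>x\<in>{x \<in> \<Omega>. a x \<noteq> 0}. (a x)\<^sup>2) \<le> c * D"
    if anti: "\<forall>x\<in>\<Omega>. a (rev x) = - a x" and fin: "finite {x \<in> \<Omega>. a x \<noteq> 0}" and ea: "energy_le T a D" for a D
  proof -
    let ?S = "{x \<in> \<Omega>. a x \<noteq> 0}"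
    have "energy_le ?U a (c * (D + D))" by (intro e energy_le_Un ea energy_le_converse)
    then have "(\<Sum>(x, y)\<in>(\<lambda>x. (x, rev x)) ` ?S. (a x - a y)\<^sup>2) \<le> c * (D + D)"
      using fin reach by (intro energy_leD) auto
    also have "(\<Sum>(x, y)\<in>(\<lambda>x. (x, rev x)) ` ?S. (a x - a y)\<^sup>2) = (\<Sum>x\<in>?S. 4 * (a x)\<^sup>2)"
      using anti by (subst sum.reindex) (auto simp: inj_on_def power2_eq_square intro!: sum.cong)
    finally have "4 * (\<Sum>x\<in>?S. (a x)\<^sup>2) \<le> 2 * (c * D)" by (simp add: sum_distrib_left)
    moreover have "(\<Sum>x\<in>?S. (a x)\<^sup>2) \<ge> 0" by (simp add: sum_nonneg)
    ultimately show ?thesis by linarith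
  qed
  then show ?thesis using c by blast
qed

text \<open>Using both ends makes the lifted function invariant under reversal. A transition is a
  path with \<open>Suc k\<close> edges; at most \<open>\<Delta> ^ Suc k\<close> of these start at a
  given vertex, which bounds how often an edge is reused at either end.\<close>

lemma energy_ends:
  assumes g: "energy_le (adj E) g D"
  shows "energy_le T (\<lambda>\<gamma>. g (hd \<gamma>) + g (last \<gamma>)) (4 * real (\<Delta> ^ Suc k) * D)"
  unfolding energy_le_def
proof (intro allI impI)
  fix B assume B: "finite B \<and> B \<subseteq> T"
  let ?l = "\<lambda>i. fst i @ [last (snd i)]"
  have l: "?l i \<in> paths V E (Suc k)" if "i \<in> B" for i
  proof -
    have t: "(fst i, snd i) \<in> T" using B that by auto
    have "fst i \<in> paths V E k" using T_in(1)[OF t] \<Omega>_paths by auto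
    then show ?thesis using T_adj[OF t] adj_V[OF T_adj[OF t]]
      by (auto simp: paths_iff successively_append_iff adj_def)
  qed
  have inj: "inj_on ?l B"
  proof (rule inj_onI)
    fix i j assume ij: "i \<in> B" "j \<in> B" and e: "?l i = ?l j"
    have "\<exists>v. snd i = tl (fst i) @ [v]" "\<exists>v. snd j = tl (fst j) @ [v]"
      using ij B T_iff[of "fst i" "snd i"] T_iff[of "fst j" "snd j"] by auto
    then show "i = j" using e by (auto simp: prod_eq_iff)
  qed
  have h: "hd (?l i) = hd (fst i)" if "i \<in> B" for i
  proof -
    have "fst i \<noteq> []" using B that T_in(1)[of "fst i" "snd i"] \<Omega>_paths paths_ne by auto
    then show ?thesis by simp
  qed
  have f1: "card {i \<in> B. (hd (fst i), hd (snd i)) = j} \<le> \<Delta> ^ Suc k" for j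
  proof -
    have sub: "?l ` {i \<in> B. (hd (fst i), hd (snd i)) = j} \<subseteq> {\<gamma> \<in> paths V E (Suc k). hd \<gamma> = fst j}"
      using l h by auto
    have "card (?l ` {i \<in> B. (hd (fst i), hd (snd i)) = j}) = card {i \<in> B. (hd (fst i), hd (snd i)) = j}"
      by (intro card_image inj_on_subset[OF inj]) auto
    then show ?thesis
      using card_paths_hd[of "Suc k" "fst j"] card_mono[OF conjunct1[OF card_paths_hd[of "Suc k" "fst j"]] sub]
      by linarith
  qed
  have f2: "card {i \<in> B. (last (fst i), last (snd i)) = j} \<le> \<Delta> ^ Suc k" for j
  proof -
    have sub: "(rev \<circ> ?l) ` {i \<in> B. (last (fst i), last (snd i)) = j} \<subseteq> {\<gamma> \<in> paths V E (Suc k). hd \<gamma> = snd j}"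
      using l paths_rev[of _ "Suc k"] by (auto simp del: rev_append) (auto simp: hd_rev)
    have "card ((rev \<circ> ?l) ` {i \<in> B. (last (fst i), last (snd i)) = j}) = card {i \<in> B. (last (fst i), last (snd i)) = j}"
      by (intro card_image comp_inj_on inj_on_subset[OF inj]) auto
    then show ?thesis
      using card_paths_hd[of "Suc k" "snd j"] card_mono[OF conjunct1[OF card_paths_hd[of "Suc k" "snd j"]] sub]
      by linarith
  qed
  have "(\<Sum>(x, y)\<in>B. (g (hd x) + g (last x) - (g (hd y) + g (last y)))\<^sup>2)
      \<le> (\<Sum>i\<in>B. 2 * (g (hd (fst i)) - g (hd (snd i)))\<^sup>2 + 2 * (g (last (fst i)) - g (last (snd i)))\<^sup>2)"
    unfolding case_prod_unfold
  proof (rule sum_mono)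
    fix i :: "'a list \<times> 'a list"
    show "(g (hd (fst i)) + g (last (fst i)) - (g (hd (snd i)) + g (last (snd i))))\<^sup>2
      \<le> 2 * (g (hd (fst i)) - g (hd (snd i)))\<^sup>2 + 2 * (g (last (fst i)) - g (last (snd i)))\<^sup>2"
      using sq_add_le[of "g (hd (fst i)) - g (hd (snd i))" "g (last (fst i)) - g (last (snd i))"]
      by (simp add: algebra_simps)
  qed
  also have "\<dots> = 2 * (\<Sum>i\<in>B. (g (hd (fst i)) - g (hd (snd i)))\<^sup>2) + 2 * (\<Sum>i\<in>B. (g (last (fst i)) - g (last (snd i)))\<^sup>2)"
    by (simp add: sum.distrib sum_distrib_left)
  also have "\<dots> \<le> 2 * (real (\<Delta> ^ Suc k) * D) + 2 * (real (\<Delta> ^ Suc k) * D)"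
  proof (intro add_mono mult_left_mono)
    show "(\<Sum>i\<in>B. (g (hd (fst i)) - g (hd (snd i)))\<^sup>2) \<le> real (\<Delta> ^ Suc k) * D"
      using energy_fibers_le[OF g _ _ f1] B T_adj_hd by fastforce
    show "(\<Sum>i\<in>B. (g (last (fst i)) - g (last (snd i)))\<^sup>2) \<le> real (\<Delta> ^ Suc k) * D"
      using energy_fibers_le[OF g _ _ f2] B T_adj by fastforce
  qed simp_all
  finally show "(\<Sum>(x, y)\<in>B. (g (hd x) + g (last x) - (g (hd y) + g (last y)))\<^sup>2) \<le> 4 * real (\<Delta> ^ Suc k) * D"
    by (simp add: mult_ac)
qed

end

section \<open>The simple random walk as a path chain\<close>

context bgraph
begin

lemma srw_T: "fin_chain.T K0 (paths V E 0) = (\<lambda>(v, w). ([v], [w])) ` adj E"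
proof -
  interpret S: pchain V E \<Delta> 0 "\<lambda>_. {}" "paths V E 0" by (rule srw_pchain)
  have "(\<gamma>, \<gamma>') \<in> S.T \<longleftrightarrow> (\<gamma>, \<gamma>') \<in> (\<lambda>(v, w). ([v], [w])) ` adj E" for \<gamma> \<gamma>'
    unfolding S.T_iff using adj_V by (auto simp: paths_0 opt_def nbrs_adj)
  then show ?thesis by auto
qed

lemma srw_rev_flow: "rev_flow K0 (paths V E 0) (\<lambda>\<gamma>. real (card (opt (\<lambda>_. {}) \<gamma>)) * 1) rev 1 \<Delta> \<Delta>"
proof -
  interpret S: pchain V E \<Delta> 0 "\<lambda>_. {}" "paths V E 0" by (rule srw_pchain)
  have "(rev \<gamma>', rev \<gamma>) \<in> S.T" if t: "(\<gamma>, \<gamma>') \<in> S.T" for \<gamma> \<gamma>'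
  proof -
    obtain v w where vw: "\<gamma> = [v]" "\<gamma>' = [w]" "(v, w) \<in> adj E" using t by (auto simp: srw_T)
    then have "(w, v) \<in> adj E" using adj_sym by fast
    then show ?thesis using vw by (force simp: srw_T)
  qed
  then show ?thesis by (intro S.rev_flow_weight) (auto simp: paths_0)
qed

text \<open>On one-vertex paths reversal is the identity: every function is even, odd functions
  vanish, and the sector estimate applies with odd constant 0.\<close>

lemma srw_ineqI:
  assumes x: "x \<in> V" and bg: "bounded_green K0 [x]"
  shows "\<exists>C\<ge>0. srw_ineq x C"
proof -
  interpret R: rev_flow K0 "paths V E 0" "\<lambda>\<gamma>. real (card (opt (\<lambda>_. {}) \<gamma>)) * 1" rev 1 \<Delta> \<Delta>
    by (rule srw_rev_flow)
  have rev0: "rev \<gamma> = \<gamma>" if "\<gamma> \<in> paths V E 0" for \<gamma> using that by (auto simp: paths_0)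
  have "\<exists>C\<ge>0. \<forall>f D. (\<forall>\<gamma>\<in>paths V E 0. f (rev \<gamma>) = f \<gamma>) \<longrightarrow> finite {x \<in> paths V E 0. f x \<noteq> 0} \<longrightarrow>
    energy_le R.T f D \<longrightarrow> (f [x])\<^sup>2 \<le> C * D"
  proof (rule R.sector[OF _ bg, of 0])
    fix a :: "'a list \<Rightarrow> real" and D
    assume "\<And>\<gamma>. \<gamma> \<in> paths V E 0 \<Longrightarrow> a (rev \<gamma>) = - a \<gamma>"
    then have "a \<gamma> = 0" if "\<gamma> \<in> paths V E 0" for \<gamma> using rev0[OF that] that by fastforce
    then show "(\<Sum>x\<in>{x \<in> paths V E 0. a x \<noteq> 0}. (a x)\<^sup>2) \<le> 0 * D" by (intro eq_refl) (auto intro: sum.neutral)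
  qed (use x in \<open>auto simp: paths_0\<close>)
  then obtain C where C: "C \<ge> 0" "\<And>f D. finite {x \<in> paths V E 0. f x \<noteq> 0} \<Longrightarrow>
    energy_le R.T f D \<Longrightarrow> (f [x])\<^sup>2 \<le> C * D" using rev0 by auto
  have "srw_ineq x C"
    unfolding srw_ineq_def
  proof (intro allI impI)
    fix g :: "'a \<Rightarrow> real" and D assume f: "finite {v \<in> V. g v \<noteq> 0}" and e: "energy_le (adj E) g D"
    have "energy_le R.T (\<lambda>\<gamma>. g (hd \<gamma>)) D"
      using e by (rule energy_le_map[where \<phi> = "\<lambda>i. (hd (fst i), hd (snd i))"]) (auto simp: srw_T inj_on_def)
    moreover have "finite {\<gamma> \<in> paths V E 0. g (hd \<gamma>) \<noteq> 0}"
      by (rule finite_subset[OF _ finite_imageI[OF f, of "\<lambda>v. [v]"]]) (auto simp: paths_0)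
    ultimately show "(g x)\<^sup>2 \<le> C * D" using C(2)[of "\<lambda>\<gamma>. g (hd \<gamma>)"] by simp
  qed
  then show ?thesis using C(1) by blast
qed

lemma srw_bounded_greenI:
  assumes x: "x \<in> V"
    and C: "\<And>g D. finite {v \<in> V. g v \<noteq> 0} \<Longrightarrow> (\<And>v. g v \<ge> 0) \<Longrightarrow> energy_le (adj E) g D \<Longrightarrow> (g x)\<^sup>2 \<le> C * D"
  shows "bounded_green K0 [x]"
proof -
  interpret R: rev_flow K0 "paths V E 0" "\<lambda>\<gamma>. real (card (opt (\<lambda>_. {}) \<gamma>)) * 1" rev 1 \<Delta> \<Delta>
    by (rule srw_rev_flow)
  show ?thesis
  proof (rule R.bounded_greenI)
    fix f :: "'a list \<Rightarrow> real" and D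
    assume f: "finite {x \<in> paths V E 0. f x \<noteq> 0}" "\<And>x. f x \<ge> 0" and e: "energy_le R.T f D"
    have "energy_le (adj E) (\<lambda>v. f [v]) D"
      using e by (rule energy_le_map[where \<phi> = "\<lambda>(v, w). ([v], [w])"]) (auto simp: srw_T inj_on_def)
    moreover have "finite {v \<in> V. f [v] \<noteq> 0}"
      by (rule finite_subset[OF _ finite_imageI[OF f(1), of hd]]) (force simp: paths_0)
    ultimately show "(f [x])\<^sup>2 \<le> C * D" using C[of "\<lambda>v. f [v]"] f(2) by blast
  qed (use x in \<open>auto simp: paths_0\<close>)
qed

text \<open>On a finite graph the constant 1 would be an admissible test function of energy
  0.\<close>

lemma srw_bounded_infinite:
  assumes x: "x \<in> V" and bg: "bounded_green K0 [x]"
  shows "infinite V"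
proof
  assume fin: "finite V"
  obtain C where C: "srw_ineq x C" using srw_ineqI[OF x bg] by blast
  have "energy_le (adj E) (\<lambda>_. 1) 0" by (auto simp: energy_le_def)
  moreover have "finite {v \<in> V. (1::real) \<noteq> 0}" using fin by simp
  ultimately have "(1::real)\<^sup>2 \<le> C * 0"
    using C[unfolded srw_ineq_def, rule_format, of "\<lambda>_. 1" 0] by blast
  then show False by simp
qed

lemma srw_bounded_all:
  assumes "x \<in> V" "y \<in> V" "bounded_green K0 [x]"
  shows "bounded_green K0 [y]"
proof -
  interpret S: pchain V E \<Delta> 0 "\<lambda>_. {}" "paths V E 0" by (rule srw_pchain)
  have r: "([v], [w]) \<in> S.T\<^sup>*" if "(v, w) \<in> (adj E)\<^sup>*" for v w
    using that
  proof (induction rule: rtrancl_induct)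
    case (step w u)
    then have "([w], [u]) \<in> S.T" by (auto simp: srw_T)
    with step.IH show ?case by (rule rtrancl_into_rtrancl)
  qed simp
  show ?thesis
    by (rule S.bounded_green_transfer[OF _ assms(3) r[OF reach_V] r[OF reach_V]])
      (use assms in \<open>auto simp: paths_0\<close>)
qed

end

context pchain
begin

text \<open>Functions on \<open>V\<close> are lifted through both ends to even functions on paths.
  Restricting to nonnegative ones, which suffices for the Green function, prevents cancellation
  between the two ends of \<open>z\<close>.\<close>

lemma backward:
  assumes R: "rev_flow K \<Omega> \<pi> rev lo hi m"
    and reach: "\<And>\<gamma>. \<gamma> \<in> \<Omega> \<Longrightarrow> (\<gamma>, rev \<gamma>) \<in> (\<Union>n\<le>N. (T \<union> T\<inverse>) ^^ n)"
    and z: "z \<in> \<Omega>" and bg: "bounded_green K z"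
  shows "bounded_green K0 [hd z]"
proof -
  interpret R: rev_flow K \<Omega> \<pi> rev lo hi m by (rule R)
  obtain C1 where C1: "C1 \<ge> 0" "\<And>a D. (\<And>x. x \<in> \<Omega> \<Longrightarrow> a (rev x) = - a x) \<Longrightarrow> finite {x \<in> \<Omega>. a x \<noteq> 0} \<Longrightarrow>
      energy_le T a D \<Longrightarrow> (\<Sum>x\<in>{x \<in> \<Omega>. a x \<noteq> 0}. (a x)\<^sup>2) \<le> C1 * D"
    using anti_of_reach[OF reach] by blast
  obtain C where C: "C \<ge> 0" "\<And>f D. (\<forall>x\<in>\<Omega>. f (rev x) = f x) \<Longrightarrow> finite {x \<in> \<Omega>. f x \<noteq> 0} \<Longrightarrow>
    energy_le T f D \<Longrightarrow> (f z)\<^sup>2 \<le> C * D"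
    using R.sector[OF z bg C1(2) C1(1)] by blast
  have hz: "hd z \<in> V" using z \<Omega>_paths paths_last by blast
  show ?thesis
  proof (rule srw_bounded_greenI[OF hz])
    fix g :: "'a \<Rightarrow> real" and D
    assume fin: "finite {v \<in> V. g v \<noteq> 0}" and g0: "\<And>v. g v \<ge> 0" and e: "energy_le (adj E) g D"
    let ?f = "\<lambda>\<gamma>. g (hd \<gamma>) + g (last \<gamma>)"
    have "\<forall>x\<in>\<Omega>. ?f (rev x) = ?f x"
      using \<Omega>_paths paths_ne by (auto simp: hd_rev last_rev)
    moreover have "finite {x \<in> \<Omega>. ?f x \<noteq> 0}"
    proof (rule finite_subset)
      show "{x \<in> \<Omega>. ?f x \<noteq> 0} \<subseteq> (\<Union>v\<in>{v \<in> V. g v \<noteq> 0}. {\<gamma> \<in> paths V E k. v \<in> set \<gamma>})"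
      proof
        fix \<gamma> assume \<gamma>: "\<gamma> \<in> {x \<in> \<Omega>. ?f x \<noteq> 0}"
        then have p: "\<gamma> \<in> paths V E k" using \<Omega>_paths by auto
        have "g (hd \<gamma>) \<noteq> 0 \<or> g (last \<gamma>) \<noteq> 0" using \<gamma> by auto
        then show "\<gamma> \<in> (\<Union>v\<in>{v \<in> V. g v \<noteq> 0}. {\<gamma> \<in> paths V E k. v \<in> set \<gamma>})"
          using p paths_last[OF p] paths_ne[OF p] by auto
      qed
    qed (use fin finite_paths_at in auto)
    ultimately have "(?f z)\<^sup>2 \<le> C * (4 * real (\<Delta> ^ Suc k) * D)"
      by (rule C(2)[OF _ _ energy_ends[OF e]])
    moreover have "(g (hd z))\<^sup>2 \<le> (?f z)\<^sup>2" using g0 by (intro power_mono) auto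
    ultimately show "(g (hd z))\<^sup>2 \<le> (C * 4 * real (\<Delta> ^ Suc k)) * D" by (simp add: mult_ac)
  qed
qed

end

section \<open>Closed sets of paths for the edge and vertex chains\<close>

context bgraph
begin

lemma edge_pchain: "pchain V E \<Delta> k (edge_free E) (paths V E k)"
proof
  show "tl \<gamma> @ [v] \<in> paths V E k" if "\<gamma> \<in> paths V E k" "v \<in> opt (edge_free E) \<gamma>" for \<gamma> v
    using that by (intro paths_snoc) (auto simp: opt_def edge_free_def split: if_splits)
qed (auto simp: edge_free_def)

lemma vertex_pchain: "pchain V E \<Delta> k (vertex_free E) (paths V E k)"
proof
  show "tl \<gamma> @ [v] \<in> paths V E k" if "\<gamma> \<in> paths V E k" "v \<in> opt (vertex_free E) \<gamma>" for \<gamma> v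
    using that by (intro paths_snoc) (auto simp: opt_def vertex_free_def split: if_splits)
qed (auto simp: vertex_free_def)

lemma edge_pchain_e:
  assumes "cannot_get_stuck (edge_free E) (paths_e V E k)" "k \<ge> 1"
  shows "pchain V E \<Delta> k (edge_free E) (paths_e V E k)"
proof
  fix \<gamma> v assume \<gamma>: "\<gamma> \<in> paths_e V E k" and v: "v \<in> opt (edge_free E) \<gamma>"
  then have v: "v \<in> edge_free E \<gamma>" using assms by (auto simp: opt_def cannot_get_stuck_def)
  have p: "\<gamma> \<in> paths V E k" "distinct (elist \<gamma>)" using \<gamma> by (auto simp: paths_e_iff)
  obtain x y \<beta> where c: "\<gamma> = x # y # \<beta>" using p(1) assms(2)
    by (cases \<gamma>; cases "tl \<gamma>") (auto simp: paths_iff)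
  have "elist (tl \<gamma> @ [v]) = elist (tl \<gamma>) @ [{last \<gamma>, v}]" using c elist_snoc[of "tl \<gamma>" v] by simp
  moreover have "set (elist (tl \<gamma>)) \<subseteq> set (elist \<gamma>)" "distinct (elist (tl \<gamma>))" using c p by auto
  ultimately have "distinct (elist (tl \<gamma> @ [v]))"
    using v by (auto simp: edge_free_def path_edges_elist)
  moreover have "tl \<gamma> @ [v] \<in> paths V E k" using p(1) v by (intro paths_snoc) (auto simp: edge_free_def)
  ultimately show "tl \<gamma> @ [v] \<in> paths_e V E k" by (simp add: paths_e_iff)
qed (auto simp: edge_free_def paths_e_iff)

lemma vertex_pchain_v:
  assumes "cannot_get_stuck (vertex_free E) (paths_v V E k)"
  shows "pchain V E \<Delta> k (vertex_free E) (paths_v V E k)"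
proof
  fix \<gamma> v assume \<gamma>: "\<gamma> \<in> paths_v V E k" and v: "v \<in> opt (vertex_free E) \<gamma>"
  then have v: "v \<in> vertex_free E \<gamma>" using assms by (auto simp: opt_def cannot_get_stuck_def)
  have p: "\<gamma> \<in> paths V E k" "distinct \<gamma>" using \<gamma> by (auto simp: paths_v_iff)
  have "distinct (tl \<gamma> @ [v])" using p v by (auto simp: vertex_free_def distinct_tl dest: list.set_sel(2)[rotated])
      (metis list.set_sel(2) tl_Nil list.set(1) empty_iff)
  moreover have "tl \<gamma> @ [v] \<in> paths V E k" using p(1) v by (intro paths_snoc) (auto simp: vertex_free_def)
  ultimately show "tl \<gamma> @ [v] \<in> paths_v V E k" by (simp add: paths_v_iff)
qed (auto simp: vertex_free_def paths_v_iff)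

subsection \<open>The non-backtracking walk\<close>

abbreviation "K1 \<equiv> path_chain E (edge_free E)"

lemma paths_1: "\<gamma> \<in> paths V E 1 \<longleftrightarrow> (\<exists>x y. \<gamma> = [x, y] \<and> (x, y) \<in> adj E)"
proof -
  have "(x, y) \<in> adj E \<Longrightarrow> x \<in> V \<and> y \<in> V" for x y using adj_V by blast
  then show ?thesis by (auto simp: paths_iff length_Suc_conv adj_def)
qed

lemma edge_free_1: "edge_free E [x, y] = nbrs E y - {x}"
  by (auto simp: edge_free_def path_edges_elist doubleton_eq_iff)

lemma nb_T:
  assumes "(x, y) \<in> adj E" "(y, z) \<in> adj E" "x \<noteq> z"
  shows "([x, y], [y, z]) \<in> fin_chain.T K1 (paths V E 1)"
proof -
  interpret P: pchain V E \<Delta> 1 "edge_free E" "paths V E 1" by (rule edge_pchain)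
  have "z \<in> opt (edge_free E) [x, y]"
    using assms by (auto simp: opt_def edge_free_1 nbrs_adj)
  then show ?thesis using assms(1) by (auto simp: P.T_iff paths_1 simp del: One_nat_def)
qed

text \<open>The number of moves at the last vertex is its degree minus one, but at least 1, as the
  walk turns back at a dead end. Weighting by the inverse makes \<pi> identically 1 on directed
  edges. A turn at a dead end is its own reverse.\<close>

lemma nb_rev_flow:
  "\<exists>\<pi> lo. rev_flow K1 (paths V E 1) \<pi> rev lo \<Delta> \<Delta>"
proof -
  interpret P: pchain V E \<Delta> 1 "edge_free E" "paths V E 1" by (rule edge_pchain)
  define W where "W \<beta> = 1 / real (max 1 (card (nbrs E (hd \<beta>)) - 1))" for \<beta> :: "'a list"
  have opt: "card (opt (edge_free E) [x, y]) = max 1 (card (nbrs E y) - 1)" if "(x, y) \<in> adj E" for x y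
  proof -
    have x: "x \<in> nbrs E y" using that adj_sym by (fastforce simp: nbrs_adj)
    have fin: "finite (nbrs E y)" using that adj_V deg_fin by blast
    show ?thesis
    proof (cases "nbrs E y - {x} = {}")
      case True
      then have "nbrs E y = {x}" using x by auto
      then show ?thesis by (simp add: opt_def edge_free_1)
    next
      case False
      then have "card (nbrs E y - {x}) \<ge> 1" using fin by (simp add: Suc_leI card_gt_0_iff)
      then show ?thesis using False x fin by (simp add: opt_def edge_free_1 max_def)
    qed
  qed
  have "(rev \<gamma>', rev \<gamma>) \<in> P.T" if t: "(\<gamma>, \<gamma>') \<in> P.T" for \<gamma> \<gamma>'
  proof -
    obtain x y z where e: "\<gamma> = [x, y]" "\<gamma>' = [y, z]" "(x, y) \<in> adj E" and z: "z \<in> opt (edge_free E) [x, y]"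
      using t by (auto simp: P.T_iff paths_1 simp del: One_nat_def)
    have yz: "(y, z) \<in> adj E" using z by (auto simp: opt_def edge_free_1 nbrs_adj split: if_splits)
    have s: "(y, x) \<in> adj E" "(z, y) \<in> adj E" using e yz adj_sym by fast+
    show ?thesis
    proof (cases "x = z")
      case False
      then show ?thesis using nb_T[OF s(2,1)] e by simp
    next
      case True
      then show ?thesis using t e by simp
    qed
  qed
  moreover have "rev \<gamma> \<in> paths V E 1" if "\<gamma> \<in> paths V E 1" for \<gamma> by (rule paths_rev[OF that])
  moreover have "1 / real (max 1 \<Delta>) \<le> W (tl \<gamma>)" "W (tl \<gamma>) \<le> 1" "W (rev (tl \<gamma>)) = W (tl \<gamma>)" if g: "\<gamma> \<in> paths V E 1" for \<gamma>
  proof -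
    obtain x y where e: "\<gamma> = [x, y]" "(x, y) \<in> adj E" using g unfolding paths_1 by blast
    then have y: "y \<in> V" using adj_V by auto
    have "max 1 (card (nbrs E y) - 1) \<le> max 1 \<Delta>" using deg_le[OF y] by auto
    then show "1 / real (max 1 \<Delta>) \<le> W (tl \<gamma>)" unfolding W_def e by (intro frac_le) auto
    show "W (tl \<gamma>) \<le> 1" unfolding W_def by (simp add: divide_le_eq)
    show "W (rev (tl \<gamma>)) = W (tl \<gamma>)" using e by simp
  qed
  moreover have "real (card (opt (edge_free E) (rev \<gamma>))) * W (tl (rev \<gamma>)) =
      real (card (opt (edge_free E) \<gamma>)) * W (tl \<gamma>)" if g: "\<gamma> \<in> paths V E 1" for \<gamma>
  proof -
    obtain x y where e: "\<gamma> = [x, y]" "(x, y) \<in> adj E" using g unfolding paths_1 by blast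
    have s: "(y, x) \<in> adj E" using e adj_sym by fast
    show ?thesis using opt[OF e(2)] opt[OF s] by (simp add: e W_def)
  qed
  moreover have "1 / real (max 1 \<Delta>) > 0" by simp
  ultimately have "rev_flow K1 (paths V E 1) (\<lambda>\<gamma>. real (card (opt (edge_free E) \<gamma>)) * W (tl \<gamma>)) rev
      (1 / real (max 1 \<Delta>)) \<Delta> \<Delta>"
    by (intro P.rev_flow_weight)
  then show ?thesis by blast
qed

text \<open>
  Two distinct edges at a vertex are traversed in succession in both directions by the
  non-backtracking walk, so the sum of \<open>f\<close> over the two orientations of an edge varies slowly.
\<close>

lemma nb_forward:
  assumes z: "z \<in> paths V E 1" and C: "srw_ineq (hd z) C"
  shows "bounded_green K1 z"
proof -
  interpret P: pchain V E \<Delta> 1 "edge_free E" "paths V E 1" by (rule edge_pchain)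
  obtain \<pi> lo where "rev_flow K1 (paths V E 1) \<pi> rev lo \<Delta> \<Delta>" using nb_rev_flow by blast
  then interpret R: rev_flow K1 "paths V E 1" \<pi> rev lo \<Delta> \<Delta> .
  obtain x0 y0 where z0: "z = [x0, y0]" "(x0, y0) \<in> adj E" using z unfolding paths_1 by blast
  have "\<exists>w. v \<in> V \<longrightarrow> (v, w) \<in> adj E" for v using deg_pos[of v] by (auto simp: nbrs_adj)
  then obtain nb0 where nb0: "\<And>v. v \<in> V \<Longrightarrow> (v, nb0 v) \<in> adj E" by metis
  \<comment> \<open>Prescribing \<open>y0\<close> at \<open>x0\<close> makes \<open>g (hd z)\<close>
    dominate \<open>f z\<close>.\<close>
  define nb where "nb = nb0(x0 := y0)"
  have nb: "(v, nb v) \<in> adj E" "(nb v, v) \<in> adj E" if "v \<in> V" for v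
    using nb0[OF that] z0 adj_sym by (auto simp: nb_def split: if_splits) (fast+)
  show ?thesis
  proof (rule R.bounded_greenI[OF z])
    fix f :: "'a list \<Rightarrow> real" and D
    assume fin: "finite {x \<in> paths V E 1. f x \<noteq> 0}" and f0: "\<And>x. f x \<ge> 0" and e: "energy_le P.T f D"
    have D0: "D \<ge> 0" by (rule energy_le_nonneg[OF e])
    define h where "h x y = f [x, y] + f [y, x]" for x y
    define g where "g v = h v (nb v)" for v
    have "energy_le (adj E) g (16 * D)"
      unfolding energy_le_def
    proof (intro allI impI)
      fix B assume B: "finite B \<and> B \<subseteq> adj E"
      define B1 where "B1 = {i \<in> B. nb (fst i) \<noteq> snd i}"
      define B2 where "B2 = {i \<in> B. nb (snd i) \<noteq> fst i}"
      have fB: "finite B1" "finite B2" using B by (auto simp: B1_def B2_def)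
      have bound: "(\<Sum>i\<in>B'. (f (fst (\<phi> i)) - f (snd (\<phi> i)))\<^sup>2) \<le> D"
        if "B' \<subseteq> B" "\<And>i. i \<in> B' \<Longrightarrow> \<phi> i \<in> P.T" "inj_on \<phi> B'" for B' \<phi>
        using that B finite_subset by (intro energy_inj_le[OF e]) auto
      let ?a = "\<lambda>i. ([nb (fst i), fst i], [fst i, snd i])"
      let ?b = "\<lambda>i. ([snd i, fst i], [fst i, nb (fst i)])"
      let ?c = "\<lambda>i. ([fst i, snd i], [snd i, nb (snd i)])"
      let ?d = "\<lambda>i. ([nb (snd i), snd i], [snd i, fst i])"
      let ?q = "\<lambda>\<phi> i. (f (fst (\<phi> i)) - f (snd (\<phi> i)))\<^sup>2"
      have V: "fst i \<in> V" "snd i \<in> V" "(fst i, snd i) \<in> adj E" "(snd i, fst i) \<in> adj E" if "i \<in> B" for i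
        using that B adj_V[of "fst i" "snd i"] adj_sym[of "fst i" "snd i"] by auto
      have s1: "(\<Sum>i\<in>B1. ?q ?a i) \<le> D"
      proof (rule bound)
        show "?a i \<in> P.T" if "i \<in> B1" for i
          using that V[of i] nb[of "fst i"] unfolding B1_def by (intro nb_T) auto
      qed (auto simp: B1_def inj_on_def)
      have s2: "(\<Sum>i\<in>B1. ?q ?b i) \<le> D"
      proof (rule bound)
        show "?b i \<in> P.T" if "i \<in> B1" for i
          using that V[of i] nb[of "fst i"] unfolding B1_def by (intro nb_T) auto
      qed (auto simp: B1_def inj_on_def)
      have s3: "(\<Sum>i\<in>B2. ?q ?c i) \<le> D"
      proof (rule bound)
        show "?c i \<in> P.T" if "i \<in> B2" for i
          using that V[of i] nb[of "snd i"] unfolding B2_def by (intro nb_T) auto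
      qed (auto simp: B2_def inj_on_def)
      have s4: "(\<Sum>i\<in>B2. ?q ?d i) \<le> D"
      proof (rule bound)
        show "?d i \<in> P.T" if "i \<in> B2" for i
          using that V[of i] nb[of "snd i"] unfolding B2_def by (intro nb_T) auto
      qed (auto simp: B2_def inj_on_def)
      have p1: "(g (fst i) - h (fst i) (snd i))\<^sup>2 \<le> 2 * ?q ?a i + 2 * ?q ?b i" for i
      proof -
        have "(g (fst i) - h (fst i) (snd i)) =
          (f (fst (?a i)) - f (snd (?a i))) + - (f (fst (?b i)) - f (snd (?b i)))"
          by (simp add: g_def h_def)
        then show ?thesis using sq_add_le[of "f (fst (?a i)) - f (snd (?a i))" "- (f (fst (?b i)) - f (snd (?b i)))"]
          by (simp only: power2_minus)
      qed
      have p2: "(h (fst i) (snd i) - g (snd i))\<^sup>2 \<le> 2 * ?q ?c i + 2 * ?q ?d i" for i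
      proof -
        have "(h (fst i) (snd i) - g (snd i)) =
          (f (fst (?c i)) - f (snd (?c i))) + - (f (fst (?d i)) - f (snd (?d i)))"
          by (simp add: g_def h_def)
        then show ?thesis using sq_add_le[of "f (fst (?c i)) - f (snd (?c i))" "- (f (fst (?d i)) - f (snd (?d i)))"]
          by (simp only: power2_minus)
      qed
      have "(\<Sum>(x, y)\<in>B. (g x - g y)\<^sup>2)
          \<le> (\<Sum>i\<in>B. 2 * (g (fst i) - h (fst i) (snd i))\<^sup>2 + 2 * (h (fst i) (snd i) - g (snd i))\<^sup>2)"
        unfolding case_prod_unfold by (intro sum_mono sq_diff_le)
      also have "\<dots> = 2 * (\<Sum>i\<in>B. (g (fst i) - h (fst i) (snd i))\<^sup>2) + 2 * (\<Sum>i\<in>B. (h (fst i) (snd i) - g (snd i))\<^sup>2)"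
        by (simp add: sum.distrib sum_distrib_left)
      also have "(\<Sum>i\<in>B. (g (fst i) - h (fst i) (snd i))\<^sup>2) = (\<Sum>i\<in>B1. (g (fst i) - h (fst i) (snd i))\<^sup>2)"
        using B by (intro sum.mono_neutral_right) (auto simp: B1_def g_def)
      also have "\<dots> \<le> (\<Sum>i\<in>B1. 2 * ?q ?a i + 2 * ?q ?b i)" by (intro sum_mono p1)
      also have "\<dots> = 2 * (\<Sum>i\<in>B1. ?q ?a i) + 2 * (\<Sum>i\<in>B1. ?q ?b i)"
        by (simp add: sum.distrib sum_distrib_left)
      also have "\<dots> \<le> 2 * D + 2 * D" by (intro add_mono mult_left_mono s1 s2) auto
      also have "(\<Sum>i\<in>B. (h (fst i) (snd i) - g (snd i))\<^sup>2) = (\<Sum>i\<in>B2. (h (fst i) (snd i) - g (snd i))\<^sup>2)"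
        using B by (intro sum.mono_neutral_right) (auto simp: B2_def g_def h_def)
      also have "\<dots> \<le> (\<Sum>i\<in>B2. 2 * ?q ?c i + 2 * ?q ?d i)" by (intro sum_mono p2)
      also have "\<dots> = 2 * (\<Sum>i\<in>B2. ?q ?c i) + 2 * (\<Sum>i\<in>B2. ?q ?d i)"
        by (simp add: sum.distrib sum_distrib_left)
      also have "\<dots> \<le> 2 * D + 2 * D" by (intro add_mono mult_left_mono s3 s4) auto
      finally show "(\<Sum>(x, y)\<in>B. (g x - g y)\<^sup>2) \<le> 16 * D" by simp
    qed
    moreover have "finite {v \<in> V. g v \<noteq> 0}"
    proof (rule finite_subset)
      show "{v \<in> V. g v \<noteq> 0} \<subseteq> hd ` {x \<in> paths V E 1. f x \<noteq> 0} \<union> last ` {x \<in> paths V E 1. f x \<noteq> 0}"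
      proof
        fix v assume v: "v \<in> {v \<in> V. g v \<noteq> 0}"
        then have "[v, nb v] \<in> paths V E 1" "[nb v, v] \<in> paths V E 1" using nb paths_1 by auto
        moreover have "f [v, nb v] \<noteq> 0 \<or> f [nb v, v] \<noteq> 0" using v by (auto simp: g_def h_def)
        ultimately show "v \<in> hd ` {x \<in> paths V E 1. f x \<noteq> 0} \<union> last ` {x \<in> paths V E 1. f x \<noteq> 0}"
          by force
      qed
    qed (use fin in auto)
    ultimately have "(g (hd z))\<^sup>2 \<le> C * (16 * D)" using C unfolding srw_ineq_def by blast
    moreover have "(f z)\<^sup>2 \<le> (g (hd z))\<^sup>2"
      using f0 by (intro power_mono) (auto simp: z0 g_def h_def nb_def)
    ultimately show "(f z)\<^sup>2 \<le> C * 16 * D" by simp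
  qed
qed

lemma relpow_sym: "sym R \<Longrightarrow> (x, y) \<in> R ^^ n \<Longrightarrow> (y, x) \<in> R ^^ n"
proof (induction n arbitrary: y)
  case (Suc n)
  then obtain w where "(x, w) \<in> R ^^ n" "(w, y) \<in> R" by auto
  then have "(y, w) \<in> R" "(w, x) \<in> R ^^ n" using Suc by (auto dest: symD)
  then show ?case by (rule relpow_Suc_I2)
qed simp

text \<open>At a vertex of degree at least three a directed edge is turned around in three moves of
  alternating direction with the help of two further neighbours: forward to \<open>[y, z]\<close>,
  backward to \<open>[u, y]\<close>, forward to \<open>[y, x]\<close>. From elsewhere, go
  \<open>i\<close> edges to such a vertex, turn there and come back.\<close>

lemma nb_reverse:
  defines "S \<equiv> fin_chain.T K1 (paths V E 1) \<union> (fin_chain.T K1 (paths V E 1))\<inverse>"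
  assumes w: "card (nbrs E w) \<ge> 3"
  shows "(x, y) \<in> adj E \<Longrightarrow> (y, w) \<in> adj E ^^ i \<Longrightarrow> ([x, y], [y, x]) \<in> (\<Union>n\<le>2 * i + 3. S ^^ n)"
proof (induction i arbitrary: x y)
  case 0
  then have yw: "y = w" by simp
  have fin: "finite (nbrs E w)" using w by (metis card.infinite not_numeral_le_zero)
  have "card (nbrs E w - {x}) \<ge> 2" using w fin by (auto simp: card_Diff_singleton_if)
  then obtain A where A: "A \<subseteq> nbrs E w - {x}" "card A = 2" by (meson obtain_subset_with_card_n)
  then obtain z u where zu: "z \<in> nbrs E w" "u \<in> nbrs E w" "z \<noteq> u" "z \<noteq> x" "u \<noteq> x"
    by (auto simp: card_2_iff)
  have a: "(y, z) \<in> adj E" "(y, u) \<in> adj E" using zu yw by (auto simp: nbrs_adj)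
  have s: "(u, y) \<in> adj E" "(y, x) \<in> adj E" using a 0 adj_sym by fast+
  have "([x, y], [y, z]) \<in> S" "([y, z], [u, y]) \<in> S" "([u, y], [y, x]) \<in> S"
    using nb_T[OF 0(1) a(1)] nb_T[OF s(1) a(1)] nb_T[OF s(1) s(2)] zu by (auto simp: S_def)
  then have "([x, y], [y, x]) \<in> S ^^ 3" by (auto simp: eval_nat_numeral)
  then show ?case by auto
next
  case (Suc i)
  have symS: "sym S" by (auto simp: S_def sym_def)
  obtain z where z: "(y, z) \<in> adj E" "(z, w) \<in> adj E ^^ i" using Suc.prems(2) by (meson relpow_Suc_E2)
  have yx: "(y, x) \<in> adj E" and zy: "(z, y) \<in> adj E" using Suc.prems(1) z adj_sym by fast+
  show ?case
  \<comment> \<open>If the route to \<open>w\<close> begins by backtracking, \<open>[y, x]\<close>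
    is turned around instead, and symmetry of \<open>S\<close> reads this backwards.\<close>
  proof (cases "z = x")
    case True
    then obtain n where "n \<le> 2 * i + 3" "([y, x], [x, y]) \<in> S ^^ n" using Suc.IH[OF yx] z by auto
    then show ?thesis using relpow_sym[OF symS] by fastforce
  next
    case False
    obtain n where n: "n \<le> 2 * i + 3" "([y, z], [z, y]) \<in> S ^^ n" using Suc.IH[OF z] by auto
    have "([x, y], [y, z]) \<in> S" "([z, y], [y, x]) \<in> S"
      using nb_T[OF Suc.prems(1) z(1)] nb_T[OF zy yx] False by (auto simp: S_def)
    then have "([x, y], [y, x]) \<in> S ^^ Suc (Suc n)"
      using n(2) by (meson relpow_Suc_I relpow_Suc_I2)
    then show ?thesis using n(1) by (intro UN_I[of "Suc (Suc n)"]) auto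
  qed
qed

text \<open>If all vertices of a cycle had degree at most two, their neighbours would all lie on the
  cycle, and by connectedness the graph would be this finite cycle.\<close>

lemma cycle_branch:
  assumes inf: "infinite V" and x: "x \<in> V" and cyc: "contains_cycle E (graph_ball V E x R)"
  shows "\<exists>w i. i \<le> nat \<lfloor>R\<rfloor> \<and> (x, w) \<in> adj E ^^ i \<and> card (nbrs E w) \<ge> 3"
proof -
  obtain c where c: "is_cycle E c" "set c \<subseteq> graph_ball V E x R"
    using cyc unfolding contains_cycle_def by blast
  have l: "length c \<ge> 3" "distinct c" "\<And>i. i < length c \<Longrightarrow> {c ! i, c ! (Suc i mod length c)} \<in> E"
    using c(1) unfolding is_cycle_def by auto
  have cV: "set c \<subseteq> V" using c(2) by (auto simp: graph_ball_def)
  have "\<exists>w\<in>set c. card (nbrs E w) \<ge> 3"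
  proof (rule ccontr)
    assume no: "\<not> (\<exists>w\<in>set c. card (nbrs E w) \<ge> 3)"
    have nb: "nbrs E w \<subseteq> set c" if w: "w \<in> set c" for w
    proof -
      obtain i where i: "i < length c" "w = c ! i" using w by (metis in_set_conv_nth)
      let ?n = "length c"
      \<comment> \<open>The cyclic predecessor of \<open>i\<close>; it differs from the cyclic
        successor since the cycle has length at least three.\<close>
      define j where "j = (if i = 0 then ?n - 1 else i - 1)"
      have j: "j < ?n" "Suc j mod ?n = i" using i l(1) by (auto simp: j_def)
      have si: "Suc i mod ?n < ?n" using l(1) by (intro mod_less_divisor) auto
      have ij: "j \<noteq> Suc i mod ?n"
        using i l(1) by (cases "Suc i = ?n") (auto simp: j_def)
      have "c ! j \<in> nbrs E w" "c ! (Suc i mod ?n) \<in> nbrs E w"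
        using l(3)[OF j(1)] l(3)[OF i(1)] i j by (auto simp: nbrs_def insert_commute)
      moreover have "c ! j \<noteq> c ! (Suc i mod ?n)" using l(2) ij j si by (simp add: nth_eq_iff_index_eq)
      moreover have fin: "finite (nbrs E w)" and "card (nbrs E w) \<le> 2"
        using w cV deg_fin no by force+
      ultimately have "nbrs E w = {c ! j, c ! (Suc i mod ?n)}"
        by (intro card_seteq[symmetric]) auto
      then show ?thesis using j si by auto
    qed
    obtain v where v: "v \<in> set c" using l(1) by (cases c) auto
    have "y \<in> set c" if "(v, y) \<in> (adj E)\<^sup>*" for y
      using that v nb by (induction rule: rtrancl_induct) (auto simp: nbrs_adj)
    then have "V \<subseteq> set c" using reach_V v cV by blast
    then show False using inf finite_subset by blast
  qed
  then obtain w where w: "w \<in> set c" "card (nbrs E w) \<ge> 3" by blast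
  have wV: "w \<in> V" and d: "real (graph_dist V E x w) \<le> R" using w(1) c(2) by (auto simp: graph_ball_def)
  let ?P = "\<lambda>n. \<exists>\<gamma>\<in>paths V E n. hd \<gamma> = x \<and> last \<gamma> = w"
  have "\<exists>n. ?P n" using conn x wV unfolding connected_graph_def by blast
  then have "?P (graph_dist V E x w)" unfolding graph_dist_def by (rule LeastI_ex)
  then obtain \<gamma> where \<gamma>: "\<gamma> \<in> paths V E (graph_dist V E x w)" "hd \<gamma> = x" "last \<gamma> = w" by blast
  have "(hd \<gamma>, last \<gamma>) \<in> adj E ^^ (length \<gamma> - 1)"
    using \<gamma>(1) by (intro successively_relpow) (auto simp: paths_iff adj_def)
  then have "(x, w) \<in> adj E ^^ graph_dist V E x w" using \<gamma> by (simp add: paths_iff)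
  moreover have "graph_dist V E x w \<le> nat \<lfloor>R\<rfloor>" using d by (simp add: le_nat_floor)
  ultimately show ?thesis using w(2) by blast
qed

lemma nb_backward:
  assumes inf: "infinite V" and R: "\<And>x. x \<in> V \<Longrightarrow> contains_cycle E (graph_ball V E x R)"
    and z: "z \<in> paths V E 1" and bg: "bounded_green K1 z"
  shows "bounded_green K0 [hd z]"
proof -
  interpret P: pchain V E \<Delta> 1 "edge_free E" "paths V E 1" by (rule edge_pchain)
  obtain \<pi> lo where fl: "rev_flow K1 (paths V E 1) \<pi> rev lo \<Delta> \<Delta>" using nb_rev_flow by blast
  show ?thesis
  proof (rule P.backward[OF fl _ z bg, where N = "2 * nat \<lfloor>R\<rfloor> + 3"])
    fix \<gamma> assume "\<gamma> \<in> paths V E 1"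
    then obtain x y where e: "\<gamma> = [x, y]" "(x, y) \<in> adj E" unfolding paths_1 by blast
    have y: "y \<in> V" using e adj_V by auto
    obtain w i where w: "i \<le> nat \<lfloor>R\<rfloor>" "(y, w) \<in> adj E ^^ i" "card (nbrs E w) \<ge> 3"
      using cycle_branch[OF inf y R[OF y]] by blast
    show "(\<gamma>, rev \<gamma>) \<in> (\<Union>n\<le>2 * nat \<lfloor>R\<rfloor> + 3. (P.T \<union> P.T\<inverse>) ^^ n)"
      using nb_reverse[OF w(3) e(2) w(2)] w(1) e(1) by (auto intro: order_trans)
  qed
qed

end

context bgraph
begin

subsection \<open>A reversible weight for trails\<close>

definition trail_weight :: "'a list \<Rightarrow> real" where
  "trail_weight \<beta> = (\<Prod>z\<in>set \<beta>. \<Prod>j<count_list \<beta> z. 1 / (real (card (nbrs E z)) - 1 - 2 * real j))"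

lemma trail_weight_Cons:
  "trail_weight (x # \<beta>) = trail_weight \<beta> / (real (card (nbrs E x)) - 1 - 2 * real (count_list \<beta> x))"
proof -
  let ?g = "\<lambda>z j. 1 / (real (card (nbrs E z)) - 1 - 2 * real j)"
  let ?S = "insert x (set \<beta>)"
  have "trail_weight (x # \<beta>) = (\<Prod>z\<in>?S. \<Prod>j<count_list (x # \<beta>) z. ?g z j)"
    unfolding trail_weight_def list.set(2) ..
  also have "\<dots> = (\<Prod>j<count_list (x # \<beta>) x. ?g x j) * (\<Prod>z\<in>?S - {x}. \<Prod>j<count_list (x # \<beta>) z. ?g z j)"
    by (rule prod.remove) auto
  also have "(\<Prod>z\<in>?S - {x}. \<Prod>j<count_list (x # \<beta>) z. ?g z j) = (\<Prod>z\<in>?S - {x}. \<Prod>j<count_list \<beta> z. ?g z j)"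
    by (intro prod.cong refl) auto
  also have "(\<Prod>j<count_list (x # \<beta>) x. ?g x j) = (\<Prod>j<count_list \<beta> x. ?g x j) * ?g x (count_list \<beta> x)"
    by simp
  finally have "trail_weight (x # \<beta>) = ((\<Prod>j<count_list \<beta> x. ?g x j) *
      (\<Prod>z\<in>?S - {x}. \<Prod>j<count_list \<beta> z. ?g z j)) * ?g x (count_list \<beta> x)"
    by (simp only: mult_ac)
  also have "(\<Prod>j<count_list \<beta> x. ?g x j) * (\<Prod>z\<in>?S - {x}. \<Prod>j<count_list \<beta> z. ?g z j) =
      (\<Prod>z\<in>?S. \<Prod>j<count_list \<beta> z. ?g z j)"
    by (rule prod.remove[symmetric]) auto
  also have "\<dots> = trail_weight \<beta>"
    unfolding trail_weight_def by (rule prod.mono_neutral_right) auto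
  finally show ?thesis by simp
qed

lemma trail_weight_rev: "trail_weight (rev \<beta>) = trail_weight \<beta>"
  by (simp add: trail_weight_def)

text \<open>The degree condition keeps every denominator between 1 and
  \<open>max 1 \<Delta>\<close>.\<close>

lemma trail_weight_bounds:
  "(\<And>z. z \<in> set \<beta> \<Longrightarrow> z \<in> V \<and> 2 * count_list \<beta> z \<le> card (nbrs E z)) \<Longrightarrow>
    (1 / real (max 1 \<Delta>)) ^ length \<beta> \<le> trail_weight \<beta> \<and> trail_weight \<beta> \<le> 1"
proof (induction \<beta>)
  case Nil
  then show ?case by (simp add: trail_weight_def)
next
  case (Cons x \<beta>)
  have "z \<in> V \<and> 2 * count_list \<beta> z \<le> card (nbrs E z)" if "z \<in> set \<beta>" for z
    using Cons.prems[of z] that by (auto split: if_splits)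
  then have IH: "(1 / real (max 1 \<Delta>)) ^ length \<beta> \<le> trail_weight \<beta>" "trail_weight \<beta> \<le> 1"
    using Cons.IH by auto
  let ?d = "real (card (nbrs E x)) - 1 - 2 * real (count_list \<beta> x)"
  have x: "x \<in> V" "2 * Suc (count_list \<beta> x) \<le> card (nbrs E x)" using Cons.prems[of x] by auto
  then have "real (2 * Suc (count_list \<beta> x)) \<le> real (card (nbrs E x))" by (simp only: of_nat_le_iff)
  then have d1: "?d \<ge> 1" by simp
  have d2: "?d \<le> real (max 1 \<Delta>)" using deg_le[OF x(1)] by auto
  have w0: "trail_weight \<beta> \<ge> 0" by (rule order_trans[OF _ IH(1)]) simp
  have "(1 / real (max 1 \<Delta>)) ^ length (x # \<beta>) = (1 / real (max 1 \<Delta>)) ^ length \<beta> / real (max 1 \<Delta>)"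
    by (simp only: list.size add_Suc_right add_0_right power_Suc times_divide_eq_left mult_1_left)
  also have "\<dots> \<le> trail_weight \<beta> / ?d"
    using IH d1 d2 w0 by (intro frac_le) auto
  finally have "(1 / real (max 1 \<Delta>)) ^ length (x # \<beta>) \<le> trail_weight (x # \<beta>)"
    unfolding trail_weight_Cons .
  moreover have "trail_weight (x # \<beta>) \<le> 1"
    unfolding trail_weight_Cons using IH(2) d1 w0 by (simp add: divide_le_eq)
  ultimately show ?case by blast
qed

lemma incidence_le_degree:
  assumes \<gamma>: "\<gamma> \<in> paths V E k" and d: "distinct (elist \<gamma>)" and z: "z \<in> V"
  shows "length (filter (\<lambda>e. z \<in> e) (elist \<gamma>)) \<le> card (nbrs E z)"
proof -
  have "length (filter (\<lambda>e. z \<in> e) (elist \<gamma>)) = card (set (filter (\<lambda>e. z \<in> e) (elist \<gamma>)))"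
    using d distinct_card[of "filter (\<lambda>e. z \<in> e) (elist \<gamma>)"] by simp
  also have "\<dots> \<le> card (nbrs E z)"
  proof (rule surj_card_le[OF deg_fin[OF z]])
    show "set (filter (\<lambda>e. z \<in> e) (elist \<gamma>)) \<subseteq> (\<lambda>v. {z, v}) ` nbrs E z"
    proof
      fix e assume "e \<in> set (filter (\<lambda>e. z \<in> e) (elist \<gamma>))"
      then have e: "e \<in> E" "z \<in> e" using elist_E[OF \<gamma>] by auto
      then obtain x y where "e = {x, y}" using simple unfolding simple_graph_def by (metis card_2_iff)
      then obtain v where "e = {z, v}" using e by auto
      then show "e \<in> (\<lambda>v. {z, v}) ` nbrs E z" using e by (auto simp: nbrs_def)
    qed
  qed
  finally show ?thesis .
qed

text \<open>For a trail \<open>a # \<mu> @ [b]\<close> with \<open>a \<noteq> b\<close>, the number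
  of free edges cancels the factor of \<open>b\<close> in the weight and leaves
  \<open>trail_weight \<mu>\<close>, which is symmetric. A closed trail has one free edge fewer, but
  then both orientations give the same expression.\<close>

lemma edge_rev_flow:
  assumes stuck: "cannot_get_stuck (edge_free E) (paths_e V E k)" and k: "k \<ge> 1"
  shows "\<exists>\<pi> lo. rev_flow K1 (paths_e V E k) \<pi> rev lo \<Delta> \<Delta>"
proof -
  interpret P: pchain V E \<Delta> k "edge_free E" "paths_e V E k" by (rule edge_pchain_e[OF stuck k])
  have opt: "opt (edge_free E) \<gamma> = edge_free E \<gamma>" if "\<gamma> \<in> paths_e V E k" for \<gamma>
    using stuck that by (auto simp: opt_def cannot_get_stuck_def)
  have rev_in: "rev \<gamma> \<in> paths_e V E k" if "\<gamma> \<in> paths_e V E k" for \<gamma>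
    using that paths_rev by (auto simp: paths_e_iff elist_rev)
  have split: "\<exists>a \<mu> b. \<gamma> = a # \<mu> @ [b]" if "\<gamma> \<in> paths_e V E k" for \<gamma>
  proof -
    have l: "length \<gamma> = Suc k" using that by (simp add: paths_e_iff paths_iff)
    then obtain a \<beta> where a: "\<gamma> = a # \<beta>" by (cases \<gamma>) auto
    then have "\<beta> \<noteq> []" using l k by auto
    then show ?thesis using a by (metis rev_exhaust)
  qed
  have free: "real (card (edge_free E \<gamma>)) =
      real (card (nbrs E b)) - 1 - 2 * real (count_list \<mu> b) - (if a = b then 1 else 0)"
    if \<gamma>: "\<gamma> \<in> paths_e V E k" and e: "\<gamma> = a # \<mu> @ [b]" for \<gamma> a \<mu> b
  proof -
    have "card (edge_free E \<gamma>) + 2 * count_list \<gamma> (last \<gamma>) =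
        card (nbrs E (last \<gamma>)) + 1 + (if hd \<gamma> = last \<gamma> then 1 else 0)"
      using \<gamma> by (intro card_edge_free) (auto simp: paths_e_iff)
    then show ?thesis unfolding e by (auto simp: count_list_append split: if_splits)
  qed
  have free_pos: "real (card (edge_free E \<gamma>)) > 0" if "\<gamma> \<in> paths_e V E k" for \<gamma>
    using P.opt_props(5)[OF that] opt[OF that] by simp
  have T_rev: "(rev \<gamma>', rev \<gamma>) \<in> P.T" if t: "(\<gamma>, \<gamma>') \<in> P.T" for \<gamma> \<gamma>'
  proof -
    obtain v where \<gamma>: "\<gamma> \<in> paths_e V E k" and v: "v \<in> edge_free E \<gamma>" "\<gamma>' = tl \<gamma> @ [v]"
      using t opt unfolding P.T_iff by auto
    have \<gamma>': "\<gamma>' \<in> paths_e V E k" using P.T_in[OF t] by blast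
    obtain a \<mu> b where e: "\<gamma> = a # \<mu> @ [b]" using split[OF \<gamma>] by blast
    let ?\<beta> = "\<mu> @ [b]"
    have r: "rev \<gamma>' = v # rev ?\<beta>" "rev \<gamma> = tl (rev \<gamma>') @ [a]" using v(2) e by auto
    have ne: "?\<beta> \<noteq> []" by simp
    have el: "elist \<gamma> = {a, hd ?\<beta>} # elist ?\<beta>" unfolding e by (rule elist_Cons[OF ne])
    have "a \<in> edge_free E (rev \<gamma>')"
    proof -
      have l: "last (rev \<gamma>') = hd ?\<beta>" unfolding r(1) using ne by (simp add: last_rev)
      have "{a, hd ?\<beta>} \<in> E" using el elist_E[of \<gamma> k] \<gamma> by (auto simp: paths_e_iff)
      moreover have "{a, hd ?\<beta>} \<notin> set (elist \<gamma>')"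
      proof -
        have "elist \<gamma>' = elist ?\<beta> @ [{b, v}]" using elist_snoc[OF ne, of v] v(2) e by simp
        moreover have "{a, hd ?\<beta>} \<notin> set (elist ?\<beta>)" using \<gamma> el by (auto simp: paths_e_iff)
        moreover have "{b, v} \<noteq> {a, hd ?\<beta>}"
          using v(1) el e by (auto simp: edge_free_def path_edges_elist)
        ultimately show ?thesis by auto
      qed
      ultimately show ?thesis
        unfolding edge_free_def path_edges_elist elist_rev l by (auto simp: nbrs_def insert_commute)
    qed
    then show ?thesis unfolding P.T_iff using rev_in[OF \<gamma>'] opt[OF rev_in[OF \<gamma>']] r(2) by auto
  qed
  have deg: "z \<in> V \<and> 2 * count_list (tl \<gamma>) z \<le> card (nbrs E z)" if \<gamma>: "\<gamma> \<in> paths_e V E k" and z: "z \<in> set (tl \<gamma>)" for \<gamma> z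
  proof -
    obtain a \<mu> b where e: "\<gamma> = a # \<mu> @ [b]" using split[OF \<gamma>] by blast
    have p: "\<gamma> \<in> paths V E k" "distinct (elist \<gamma>)" using \<gamma> by (auto simp: paths_e_iff)
    have zV: "z \<in> V" using p(1) z e by (auto simp: paths_iff)
    have "2 * count_list (tl \<gamma>) z \<le> card (nbrs E z)"
    \<comment> \<open>At the last vertex the bound uses that a free edge exists; elsewhere the
      incidence count suffices, where an occurrence at the start is removed by
      \<open>tl\<close>.\<close>
    proof (cases "z = b")
      case True
      have "card (edge_free E \<gamma>) + 2 * count_list \<gamma> (last \<gamma>) =
          card (nbrs E (last \<gamma>)) + 1 + (if hd \<gamma> = last \<gamma> then 1 else 0)"
        by (rule card_edge_free[OF p])
      then show ?thesis using free_pos[OF \<gamma>] True unfolding e by (auto split: if_splits)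
    next
      case False
      have s: "successively (\<noteq>) \<gamma>"
        using p(1) edge_V unfolding paths_iff by (auto elim!: successively_mono)
      show ?thesis
        using incidence_count[OF paths_ne[OF p(1)] s, of z] incidence_le_degree[OF p zV] False
        unfolding e by (auto split: if_splits)
    qed
    then show ?thesis using zV by blast
  qed
  have bounds: "(1 / real (max 1 \<Delta>)) ^ k \<le> trail_weight (tl \<gamma>)" "trail_weight (tl \<gamma>) \<le> 1"
    if "\<gamma> \<in> paths_e V E k" for \<gamma>
    using trail_weight_bounds[of "tl \<gamma>"] deg[OF that] that by (auto simp: paths_e_iff paths_iff)
  have sym: "real (card (opt (edge_free E) (rev \<gamma>))) * trail_weight (tl (rev \<gamma>)) =
      real (card (opt (edge_free E) \<gamma>)) * trail_weight (tl \<gamma>)" if \<gamma>: "\<gamma> \<in> paths_e V E k" for \<gamma>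
  proof -
    obtain a \<mu> b where e: "\<gamma> = a # \<mu> @ [b]" using split[OF \<gamma>] by blast
    have e': "rev \<gamma> = b # rev \<mu> @ [a]" using e by simp
    have w1: "trail_weight (tl \<gamma>) = trail_weight \<mu> / (real (card (nbrs E b)) - 1 - 2 * real (count_list \<mu> b))"
      using trail_weight_rev[of "\<mu> @ [b]"] trail_weight_Cons[of b "rev \<mu>"] by (simp add: e trail_weight_rev)
    have w2: "trail_weight (tl (rev \<gamma>)) = trail_weight \<mu> / (real (card (nbrs E a)) - 1 - 2 * real (count_list \<mu> a))"
      using trail_weight_rev[of "rev \<mu> @ [a]"] trail_weight_Cons[of a \<mu>] by (simp add: e trail_weight_rev)
    show ?thesis
      unfolding opt[OF \<gamma>] opt[OF rev_in[OF \<gamma>]] w1 w2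
      using free[OF \<gamma> e] free[OF rev_in[OF \<gamma>] e'] free_pos[OF \<gamma>] free_pos[OF rev_in[OF \<gamma>]]
      by (cases "a = b") auto
  qed
  have "rev_flow K1 (paths_e V E k) (\<lambda>\<gamma>. real (card (opt (edge_free E) \<gamma>)) * trail_weight (tl \<gamma>)) rev
      ((1 / real (max 1 \<Delta>)) ^ k) \<Delta> \<Delta>"
    by (rule P.rev_flow_weight[OF rev_in trail_weight_rev T_rev _ bounds sym]) simp_all
  then show ?thesis by blast
qed

end

subsection \<open>Exploration by the edge walk\<close>

lemma elist_append_cases: "e \<in> set (elist (xs @ ys)) \<Longrightarrow> e \<inter> set xs \<noteq> {} \<or> e \<in> set (elist ys)"
proof (induction xs)
  case (Cons x xs)
  then show ?case by (cases "xs @ ys") auto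
qed simp

context pchain
begin

lemma pmf_kn_ge: "(x, y) \<in> T ^^ n \<Longrightarrow> x \<in> \<Omega> \<Longrightarrow> (1 / real \<Delta>) ^ n \<le> pmf (kn K n x) y"
proof (induction n arbitrary: x)
  case (Suc n)
  then obtain w where w: "(x, w) \<in> T" "(w, y) \<in> T ^^ n" by (meson relpow_Suc_E2)
  have "(1 / real \<Delta>) ^ Suc n \<le> pmf (K x) w * pmf (kn K n w) y"
    unfolding power_Suc
    using Suc.IH[OF w(2) T_in(2)[OF w(1)]] pmf_K_ge[of x w] w(1) by (intro mult_mono) (auto simp: T_def)
  also have "\<dots> = pmf (kn K 1 x) w * pmf (kn K n w) y" by simp
  also have "\<dots> \<le> pmf (kn K (1 + n) x) y" by (rule pmf_kn_add_ge[OF Suc.prems(2)])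
  finally show ?case by simp
qed (auto simp: pmf_return)

lemma T_total: "\<gamma> \<in> \<Omega> \<Longrightarrow> \<exists>\<gamma>'. (\<gamma>, \<gamma>') \<in> T"
  using opt_props(2) by (fastforce simp: T_iff)

lemma steps_total: "\<gamma> \<in> \<Omega> \<Longrightarrow> \<exists>\<gamma>'. (\<gamma>, \<gamma>') \<in> T ^^ n"
proof (induction n)
  case (Suc n)
  then obtain \<gamma>' where g: "(\<gamma>, \<gamma>') \<in> T ^^ n" by auto
  then have "\<gamma>' \<in> \<Omega>" using rtrancl_T_in[OF relpow_imp_rtrancl Suc.prems] by blast
  then obtain \<gamma>'' where "(\<gamma>', \<gamma>'') \<in> T" using T_total by blast
  then show ?case using g by auto
qed auto

text \<open>Separates what remains of the initial path from what was added. For \<open>n > k\<close>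
  nothing of the initial path survives, so the current path consists of endpoints of reachable
  paths.\<close>

lemma steps_list:
  assumes "\<gamma> \<in> \<Omega>"
  shows "(\<gamma>, \<gamma>') \<in> T ^^ n \<Longrightarrow> \<exists>l. length l = n \<and> \<gamma>' = drop n (\<gamma> @ l) \<and> set l \<subseteq> last ` {\<zeta>. (\<gamma>, \<zeta>) \<in> T\<^sup>*}"
proof (induction n arbitrary: \<gamma>')
  case (Suc n)
  then obtain \<xi> where x: "(\<gamma>, \<xi>) \<in> T ^^ n" "(\<xi>, \<gamma>') \<in> T" by auto
  obtain l where l: "length l = n" "\<xi> = drop n (\<gamma> @ l)" "set l \<subseteq> last ` {\<zeta>. (\<gamma>, \<zeta>) \<in> T\<^sup>*}"
    using Suc.IH[OF x(1)] by blast
  obtain v where v: "\<gamma>' = tl \<xi> @ [v]" using x(2) by (auto simp: T_iff)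
  have ne: "\<gamma> \<noteq> []" using assms \<Omega>_paths paths_ne by blast
  have "(\<gamma>, \<gamma>') \<in> T\<^sup>*" using Suc.prems by (rule relpow_imp_rtrancl)
  then have "v \<in> last ` {\<zeta>. (\<gamma>, \<zeta>) \<in> T\<^sup>*}" using v by force
  moreover have "\<gamma>' = drop (Suc n) (\<gamma> @ l @ [v])"
  proof -
    have "tl \<xi> = drop (Suc n) (\<gamma> @ l)" by (simp only: l(2) drop_Suc tl_drop)
    moreover have "Suc n \<le> length (\<gamma> @ l)" using ne l(1) by (cases \<gamma>) auto
    ultimately show ?thesis using v by (metis append_assoc drop_append diff_is_0_eq' drop_0)
  qed
  ultimately show ?case using l by (intro exI[of _ "l @ [v]"]) auto
qed simp

end

context bgraph
begin

text \<open>An edge that has not been crossed recently is always available.\<close>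

lemma edge_reach_outside:
  assumes \<eta>: "\<eta> \<in> paths V E k" and F: "finite F" "F \<subseteq> V" "F \<noteq> V"
  shows "\<exists>\<zeta>. (\<eta>, \<zeta>) \<in> (fin_chain.T K1 (paths V E k))\<^sup>* \<and> last \<zeta> \<notin> F"
proof (rule ccontr)
  interpret P: pchain V E \<Delta> k "edge_free E" "paths V E k" by (rule edge_pchain)
  define Reach where "Reach \<zeta> = {\<xi>. (\<zeta>, \<xi>) \<in> P.T\<^sup>*}" for \<zeta>
  assume "\<not> ?thesis"
  then have lastF: "last \<zeta> \<in> F" if "\<zeta> \<in> Reach \<eta>" for \<zeta> using that by (auto simp: Reach_def)
  have set: "set \<zeta> \<subseteq> set \<eta> \<union> F \<and> \<zeta> \<in> paths V E k" if "\<zeta> \<in> Reach \<eta>" for \<zeta>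
  proof -
    have "(\<eta>, \<zeta>) \<in> P.T\<^sup>*" using that by (simp add: Reach_def)
    then show ?thesis
    proof (induction rule: rtrancl_induct)
      case (step \<zeta> \<zeta>')
      obtain v where v: "\<zeta>' = tl \<zeta> @ [v]" using step(2) by (auto simp: P.T_iff)
      have "(\<eta>, \<zeta>') \<in> P.T\<^sup>*" using step by simp
      then have "v \<in> F" using lastF[of \<zeta>'] v by (auto simp: Reach_def)
      moreover have "set (tl \<zeta>) \<subseteq> set \<zeta>" by (cases \<zeta>) auto
      ultimately show ?case using step v P.T_in by auto
    qed (use \<eta> in auto)
  qed
  have fin\<eta>: "finite (Reach \<eta>)"
  proof (rule finite_subset)
    show "Reach \<eta> \<subseteq> {\<zeta>. set \<zeta> \<subseteq> set \<eta> \<union> F \<and> length \<zeta> = Suc k}" using set by (auto simp: paths_iff)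
  qed (use F finite_lists_length_eq[of "set \<eta> \<union> F" "Suc k"] in auto)
  have "\<eta> \<in> Reach \<eta>" by (simp add: Reach_def)
  \<comment> \<open>A smallest reachable set is a closed communicating class: every path in it
    reaches the same paths.\<close>
  then obtain \<zeta> where \<zeta>: "\<zeta> \<in> Reach \<eta>" and min: "\<And>\<xi>. \<xi> \<in> Reach \<eta> \<Longrightarrow> card (Reach \<zeta>) \<le> card (Reach \<xi>)"
    using ex_has_least_nat[of "\<lambda>\<xi>. \<xi> \<in> Reach \<eta>" \<eta> "\<lambda>\<xi>. card (Reach \<xi>)"] by blast
  have sub: "Reach \<xi> \<subseteq> Reach \<zeta>'" if "\<xi> \<in> Reach \<zeta>'" for \<xi> \<zeta>'
    using that by (auto simp: Reach_def)
  have fin\<zeta>: "finite (Reach \<zeta>)" using sub[OF \<zeta>] fin\<eta> finite_subset by blast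
  have same: "Reach \<xi> = Reach \<zeta>" if "\<xi> \<in> Reach \<zeta>" for \<xi>
  proof -
    have "\<xi> \<in> Reach \<eta>" using that sub[OF \<zeta>] by blast
    then show ?thesis using card_seteq[OF fin\<zeta> sub[OF that]] min by simp
  qed
  define W where "W = last ` Reach \<zeta>"
  have "W \<subseteq> F" using sub[OF \<zeta>] lastF by (auto simp: W_def)
  have "last \<zeta> \<in> W" by (auto simp: W_def Reach_def)
  have "\<exists>w w'. (w, w') \<in> adj E \<and> w \<in> W \<and> w' \<notin> W"
  proof (rule ccontr)
    assume no: "\<not> ?thesis"
    have "y \<in> W" if "(last \<zeta>, y) \<in> (adj E)\<^sup>*" for y
      using that \<open>last \<zeta> \<in> W\<close> no by (induction rule: rtrancl_induct) auto
    moreover have "last \<zeta> \<in> V" using \<open>last \<zeta> \<in> W\<close> \<open>W \<subseteq> F\<close> F by auto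
    ultimately have "V \<subseteq> W" using reach_V by blast
    then show False using \<open>W \<subseteq> F\<close> F by auto
  qed
  then obtain w w' where w: "(w, w') \<in> adj E" "w \<in> W" "w' \<notin> W" by blast
  obtain \<zeta>' where \<zeta>': "\<zeta>' \<in> Reach \<zeta>" "last \<zeta>' = w" using w(2) by (auto simp: W_def)
  have p': "\<zeta>' \<in> paths V E k" using \<zeta>'(1) sub[OF \<zeta>] set by blast
  \<comment> \<open>Returning to \<open>\<zeta>'\<close> after at least \<open>k + 1\<close> steps
    replaces its whole content by endpoints from the class, so \<open>\<zeta>'\<close> lies inside
    \<open>W\<close> and cannot have crossed an edge leaving \<open>W\<close>.\<close>
  obtain \<xi> where \<xi>: "(\<zeta>', \<xi>) \<in> P.T ^^ Suc k" using P.steps_total[OF p'] by blast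
  have "\<xi> \<in> Reach \<zeta>'" using relpow_imp_rtrancl[OF \<xi>] by (simp add: Reach_def)
  then have "\<xi> \<in> Reach \<zeta>" using same[OF \<zeta>'(1)] by simp
  then have "\<zeta>' \<in> Reach \<xi>" using same \<zeta>'(1) by simp
  then obtain j where "(\<xi>, \<zeta>') \<in> P.T ^^ j" by (auto simp: Reach_def rtrancl_power)
  with \<xi> have "(\<zeta>', \<zeta>') \<in> P.T ^^ (Suc k + j)" unfolding relpow_add by (rule relcompI)
  then obtain l where l: "length l = Suc k + j" "\<zeta>' = drop (Suc k + j) (\<zeta>' @ l)"
    "set l \<subseteq> last ` {\<xi>. (\<zeta>', \<xi>) \<in> P.T\<^sup>*}" using P.steps_list[OF p'] by blast
  have "length \<zeta>' = Suc k" using p' by (simp add: paths_iff)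
  then have "\<zeta>' = drop j l" using l(2) by simp
  then have "set \<zeta>' \<subseteq> set l" using set_drop_subset[of j l] by metis
  also have "\<dots> \<subseteq> W" using l(3) same[OF \<zeta>'(1)] by (simp add: Reach_def W_def)
  finally have setW: "set \<zeta>' \<subseteq> W" .
  have "{w, w'} \<notin> path_edges \<zeta>'"
    using elist_subset[of "{w, w'}" \<zeta>'] setW w(3) by (auto simp: path_edges_elist)
  then have "w' \<in> edge_free E \<zeta>'" using w(1) \<zeta>'(2) by (simp add: edge_free_def nbrs_adj)
  then have "(\<zeta>', tl \<zeta>' @ [w']) \<in> P.T" using p' by (auto simp: P.T_iff opt_def)
  then have "tl \<zeta>' @ [w'] \<in> Reach \<zeta>" using \<zeta>'(1) by (auto simp: Reach_def)
  then have "w' \<in> W" unfolding W_def by (metis imageI last_snoc)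
  then show False using w(3) by simp
qed

text \<open>Take all vertices except \<open>v\<close> as the set to be left; finiteness of the path
  space makes the hitting chance uniform.\<close>

lemma edge_dead_finite:
  assumes fin: "finite V" and v: "v \<in> V" and \<eta>: "\<eta> \<in> paths V E k"
  shows "dead K1 {\<gamma>. v \<in> set \<gamma>} \<eta>"
proof -
  interpret P: pchain V E \<Delta> k "edge_free E" "paths V E k" by (rule edge_pchain)
  show ?thesis
  proof (rule P.dead_finite[where X = "paths V E k"])
    show "finite (paths V E k)"
      by (rule finite_subset[OF _ finite_lists_length_eq[OF fin, of "Suc k"]]) (auto simp: paths_iff)
    fix \<gamma> assume \<gamma>: "\<gamma> \<in> paths V E k"
    \<comment> \<open>One step is made in advance, because hitting has to occur at a positive
      time.\<close>
    obtain \<gamma>1 where g1: "(\<gamma>, \<gamma>1) \<in> P.T" using P.T_total[OF \<gamma>] by blast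
    have p1: "\<gamma>1 \<in> paths V E k" using P.T_in[OF g1] by blast
    obtain \<zeta> where z: "(\<gamma>1, \<zeta>) \<in> P.T\<^sup>*" "last \<zeta> \<notin> V - {v}"
      using edge_reach_outside[OF p1, of "V - {v}"] fin v by auto
    have "\<zeta> \<in> paths V E k" using P.rtrancl_T_in[OF z(1) p1] .
    then have "v \<in> set \<zeta>" using z(2) paths_last(1)[of \<zeta> k] paths_ne[of \<zeta> k] last_in_set[of \<zeta>] by auto
    moreover obtain n where "(\<gamma>1, \<zeta>) \<in> P.T ^^ n" using z(1) by (auto simp: rtrancl_power)
    ultimately show "\<exists>n. \<exists>y\<in>{\<gamma>. v \<in> set \<gamma>}. (\<gamma>, y) \<in> P.T ^^ Suc n"
      using relpow_Suc_I2[OF g1] by blast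
  qed (use P.closed \<eta> in auto)
qed

text \<open>
  In an infinite graph the edge walk leaves the vertices of its current path together with the
  finite components of their complement.  It then enters an infinite component whose edges are all
  uncrossed, where it can follow a geodesic.
\<close>

lemma edge_hits_trail:
  assumes inf: "infinite V" and \<eta>: "\<eta> \<in> paths V E k" and k: "k \<ge> 1"
  shows "\<exists>n. surv K1 (paths_e V E k) n \<eta> \<le> 1 - (1 / real \<Delta>) ^ k / 2"
proof -
  interpret P: pchain V E \<Delta> k "edge_free E" "paths V E k" by (rule edge_pchain)
  define Q where "Q = {(x, y). (x, y) \<in> adj E \<and> x \<notin> set \<eta> \<and> y \<notin> set \<eta>}"
  have Qadj: "Q \<subseteq> adj E" by (auto simp: Q_def)
  have symQ: "sym Q" using adj_sym by (fastforce simp: Q_def sym_def)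
  have symQ': "(y, x) \<in> Q\<^sup>*" if "(x, y) \<in> Q\<^sup>*" for x y
    using that symQ by (meson sym_rtrancl symD)
  have degQ: "bdeg Q \<Delta>" by (rule bdeg_subset[OF bdeg_adj Qadj])
  \<comment> \<open>\<open>U\<close> collects the infinite components of the graph without the
    vertices of \<eta>; its complement \<open>F\<close> consists of the path and the finite
    components.\<close>
  define U where "U = {w \<in> V - set \<eta>. infinite (Q\<^sup>* `` {w})}"
  define F where "F = V - U"
  have \<eta>V: "set \<eta> \<subseteq> V" using \<eta> by (auto simp: paths_iff)
  have "finite F"
  proof -
    \<comment> \<open>Each finite component contains a neighbour of the path, and the path has
      finitely many neighbours. This makes \<open>F\<close> finite.\<close>
    define N where "N = {y \<in> V - set \<eta>. \<exists>x\<in>set \<eta>. (y, x) \<in> adj E \<and> finite (Q\<^sup>* `` {y})}"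
    have "finite N"
    proof (rule finite_subset)
      show "N \<subseteq> (\<Union>x\<in>set \<eta>. (adj E)\<inverse> `` {x})" by (auto simp: N_def)
    qed (use bdegD[OF bdeg_adj] in auto)
    have "\<exists>y\<in>V - set \<eta>. (w, y) \<in> Q\<^sup>* \<and> (\<exists>x\<in>set \<eta>. (y, x) \<in> adj E)"
      if "(w, h) \<in> (adj E)\<^sup>*" "h \<in> set \<eta>" "w \<in> V - set \<eta>" for w h
      using that
    proof (induction rule: converse_rtrancl_induct)
      case (step w w')
      show ?case
      proof (cases "w' \<in> set \<eta>")
        case True
        then show ?thesis using step by blast
      next
        case False
        then have "w' \<in> V - set \<eta>" using step(1) adj_V by blast
        then obtain y where y: "y \<in> V - set \<eta>" "(w', y) \<in> Q\<^sup>*" "\<exists>x\<in>set \<eta>. (y, x) \<in> adj E"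
          using step by blast
        have "(w, w') \<in> Q" using step False by (auto simp: Q_def)
        then have "(w, y) \<in> Q\<^sup>*" using y(2) by (rule converse_rtrancl_into_rtrancl)
        then show ?thesis using y by blast
      qed
    qed auto
    note near = this
    have "F \<subseteq> set \<eta> \<union> (\<Union>y\<in>N. Q\<^sup>* `` {y})"
    proof
      fix w assume w: "w \<in> F"
      show "w \<in> set \<eta> \<union> (\<Union>y\<in>N. Q\<^sup>* `` {y})"
      proof (cases "w \<in> set \<eta>")
        case False
        then have wV: "w \<in> V - set \<eta>" and finw: "finite (Q\<^sup>* `` {w})" using w by (auto simp: F_def U_def)
        have "hd \<eta> \<in> set \<eta>" using paths_ne[OF \<eta>] by simp
        then obtain y where y: "y \<in> V - set \<eta>" "(w, y) \<in> Q\<^sup>*" "\<exists>x\<in>set \<eta>. (y, x) \<in> adj E"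
          using near[of w "hd \<eta>"] reach_V wV \<eta>V by blast
        have "Q\<^sup>* `` {y} \<subseteq> Q\<^sup>* `` {w}" using y(2) by auto
        then have "y \<in> N" using y finw finite_subset by (auto simp: N_def)
        then show ?thesis using symQ'[OF y(2)] by auto
      qed simp
    qed
    moreover have "finite (set \<eta> \<union> (\<Union>y\<in>N. Q\<^sup>* `` {y}))" using \<open>finite N\<close> by (auto simp: N_def)
    ultimately show ?thesis by (rule finite_subset)
  qed
  have FV: "F \<subseteq> V" "F \<noteq> V" using \<open>finite F\<close> inf by (auto simp: F_def)
  define X where "X = {\<gamma> \<in> paths V E k. set \<gamma> \<subseteq> F}"
  \<comment> \<open>Paths that have just entered \<open>U\<close>: only the last vertex lies there,
    so no edge inside \<open>U\<close> is crossed by them.\<close>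
  define B where "B = {\<gamma> \<in> paths V E k. set (butlast \<gamma>) \<inter> U = {} \<and> last \<gamma> \<in> U}"
  have \<eta>X: "\<eta> \<in> X" using \<eta> \<eta>V by (auto simp: X_def F_def U_def)
  have XB: "\<gamma>' \<in> X \<or> \<gamma>' \<in> B" if t: "(\<gamma>, \<gamma>') \<in> P.T" and \<gamma>: "\<gamma> \<in> X" for \<gamma> \<gamma>'
  proof -
    obtain v where v: "\<gamma>' = tl \<gamma> @ [v]" using t by (auto simp: P.T_iff)
    have p: "\<gamma>' \<in> paths V E k" using P.T_in[OF t] by blast
    have "v \<in> V" using paths_last(1)[OF p] v by simp
    moreover have "set (tl \<gamma>) \<subseteq> F" using \<gamma> by (cases \<gamma>) (auto simp: X_def)
    ultimately show ?thesis using p v by (cases "v \<in> U") (auto simp: X_def B_def F_def)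
  qed
  have Xcl: "y \<in> X" if "x \<in> X" "y \<in> set_pmf (K1 x)" "y \<notin> B" for x y
    using XB[of x y] that by (auto simp: P.T_def X_def)
  have X\<Omega>: "X \<subseteq> paths V E k" by (auto simp: X_def)
  have "dead K1 B \<eta>"
  proof (rule P.dead_finite[OF X\<Omega> Xcl])
    show "finite X"
      by (rule finite_subset[OF _ finite_lists_length_eq[OF \<open>finite F\<close>, of "Suc k"]])
        (auto simp: X_def paths_iff)
    fix x assume x: "x \<in> X"
    then obtain \<zeta> where z: "(x, \<zeta>) \<in> P.T\<^sup>*" "last \<zeta> \<notin> F"
      using edge_reach_outside[OF _ \<open>finite F\<close> FV] X\<Omega> by blast
    have "\<zeta> \<in> X \<or> (\<exists>n. \<exists>y\<in>B. (x, y) \<in> P.T ^^ Suc n)"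
      using z(1)
    proof (induction rule: rtrancl_induct)
      case (step a b)
      then show ?case
      proof (elim disjE)
        assume a: "a \<in> X"
        obtain n where "(x, a) \<in> P.T ^^ n" using step(1) by (auto simp: rtrancl_power)
        then have "(x, b) \<in> P.T ^^ Suc n" using step(2) by auto
        then show ?case using XB[OF step(2) a] by blast
      qed auto
    qed (use x in auto)
    moreover have "\<zeta> \<notin> X"
    proof
      assume "\<zeta> \<in> X"
      then have "last \<zeta> \<in> F" using paths_ne[of \<zeta> k] last_in_set[of \<zeta>] by (auto simp: X_def)
      then show False using z(2) by simp
    qed
    ultimately show "\<exists>n. \<exists>y\<in>B. (x, y) \<in> P.T ^^ Suc n" by blast
  qed (use \<eta>X in auto)
  \<comment> \<open>Waiting until \<open>U\<close> has been entered with probability above one half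
    accounts for the factor 1/2 in the claim.\<close>
  then have "eventually (\<lambda>n. surv K1 B n \<eta> < 1 / 2) sequentially"
    unfolding dead_def by (rule order_tendstoD) simp
  then obtain n where n: "surv K1 B n \<eta> < 1 / 2" by (auto simp: eventually_sequentially)
  \<comment> \<open>Along a geodesic inside \<open>U\<close> the next edge is always uncrossed.
    Following it for \<open>k\<close> steps, each of probability at least
    \<open>1 / \<Delta>\<close>, fills the window with a self-avoiding path.\<close>
  have "surv K1 (paths_e V E k) k y \<le> 1 - (1 / real \<Delta>) ^ k" if y: "y \<in> B" for y
  proof -
    let ?w = "last y"
    have yp: "y \<in> paths V E k" "set (butlast y) \<inter> U = {}" "?w \<in> U" using y by (auto simp: B_def)
    have "infinite (Q\<^sup>* `` {?w})" using yp(3) by (simp add: U_def)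
    then obtain \<beta> where \<beta>: "length \<beta> = Suc k" "hd \<beta> = ?w" "distinct \<beta>" "successively (\<lambda>x y. (x, y) \<in> Q) \<beta>"
      using geodesic_segment[OF degQ] by blast
    have "\<beta> ! i \<in> U" if "i < Suc k" for i
      using that
    proof (induction i)
      case 0
      then show ?case using \<beta>(1,2) yp(3) by (cases \<beta>) auto
    next
      case (Suc i)
      then have q: "(\<beta> ! i, \<beta> ! Suc i) \<in> Q" using \<beta>(1,4) by (auto simp: successively_conv_nth)
      have "\<beta> ! i \<in> U" using Suc by simp
      moreover have "Q\<^sup>* `` {\<beta> ! i} \<subseteq> Q\<^sup>* `` {\<beta> ! Suc i}"
        using q symQ by (auto dest!: symD intro: converse_rtrancl_into_rtrancl)
      ultimately have "infinite (Q\<^sup>* `` {\<beta> ! Suc i})" unfolding U_def using finite_subset by blast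
      moreover have "\<beta> ! Suc i \<in> V" using q Qadj adj_V by blast
      ultimately show ?case using q by (auto simp: U_def Q_def)
    qed
    then have \<beta>U: "set \<beta> \<subseteq> U" using \<beta>(1) by (auto simp: set_conv_nth)
    have \<beta>p: "\<beta> \<in> paths_v V E k"
      using \<beta> \<beta>U Qadj by (auto simp: paths_v_iff paths_iff U_def adj_def elim!: successively_mono)
    obtain \<beta>' where \<beta>': "\<beta> = ?w # \<beta>'" using \<beta>(1,2) by (cases \<beta>) auto
    have ys: "y = butlast y @ [?w]" using paths_ne[OF yp(1)] by simp
    have ly: "length (butlast y) = k" using yp(1) by (simp add: paths_iff)
    define s where "s i = drop i (butlast y) @ take (Suc i) \<beta>" for i
    have s0: "s 0 = y" using ys \<beta>' by (simp add: s_def)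
    have sk: "s k = \<beta>" using ly \<beta>(1) by (simp add: s_def)
    have "(y, s i) \<in> P.T ^^ i" if "i \<le> k" for i
      using that
    proof (induction i)
      case 0
      then show ?case using s0 by simp
    next
      case (Suc i)
      have IH: "(y, s i) \<in> P.T ^^ i" using Suc by simp
      have sp: "s i \<in> paths V E k" using P.rtrancl_T_in[OF relpow_imp_rtrancl[OF IH] yp(1)] .
      let ?v = "\<beta> ! Suc i"
      have t: "take (Suc (Suc i)) \<beta> = take (Suc i) \<beta> @ [?v]"
        using Suc.prems \<beta>(1) by (intro take_Suc_conv_app_nth) simp
      have nxt: "s (Suc i) = tl (s i) @ [?v]"
      proof -
        have "drop i (butlast y) \<noteq> []" using ly Suc.prems by simp
        then have "tl (s i) = tl (drop i (butlast y)) @ take (Suc i) \<beta>" by (simp add: s_def)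
        then show ?thesis unfolding s_def[of "Suc i"] t by (simp add: drop_Suc tl_drop)
      qed
      have li: "last (s i) = \<beta> ! i"
        using \<beta>(1) Suc.prems take_Suc_conv_app_nth[of i \<beta>] by (simp add: s_def)
      have q: "(\<beta> ! i, ?v) \<in> Q" using \<beta>(1,4) Suc.prems by (auto simp: successively_conv_nth)
      have "{\<beta> ! i, ?v} \<notin> path_edges (s i)"
      proof
        assume "{\<beta> ! i, ?v} \<in> path_edges (s i)"
        then have "{\<beta> ! i, ?v} \<inter> set (drop i (butlast y)) \<noteq> {} \<or> {\<beta> ! i, ?v} \<in> set (elist (take (Suc i) \<beta>))"
          unfolding path_edges_elist s_def by (rule elist_append_cases)
        then show False
        proof
          assume "{\<beta> ! i, ?v} \<inter> set (drop i (butlast y)) \<noteq> {}"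
          moreover have "\<beta> ! i \<in> U" "?v \<in> U" using \<beta>U \<beta>(1) Suc.prems by (auto intro!: subsetD[OF \<beta>U])
          ultimately show False using yp(2) set_drop_subset[of i "butlast y"] by blast
        next
          assume "{\<beta> ! i, ?v} \<in> set (elist (take (Suc i) \<beta>))"
          then have "?v \<in> set (take (Suc i) \<beta>)" using elist_subset by blast
          then obtain j where "j < Suc i" "\<beta> ! j = ?v" by (auto simp: in_set_conv_nth)
          then show False using \<beta>(1,3) Suc.prems by (simp add: nth_eq_iff_index_eq)
        qed
      qed
      then have "?v \<in> edge_free E (s i)" using q Qadj li by (auto simp: edge_free_def nbrs_adj)
      then have "(s i, s (Suc i)) \<in> P.T" using sp nxt by (auto simp: P.T_iff opt_def)
      then show ?case using IH by auto
    qed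
    then have "(y, \<beta>) \<in> P.T ^^ k" using sk by auto
    then have "(1 / real \<Delta>) ^ k \<le> pmf (kn K1 k y) \<beta>" by (rule P.pmf_kn_ge[OF _ yp(1)])
    moreover have "\<beta> \<in> paths_e V E k" using \<beta>p paths_v_subset_e by blast
    ultimately show ?thesis using P.surv_le_kn[OF yp(1), of \<beta> "paths_e V E k" "k - 1"] k by simp
  qed
  then have "surv K1 (paths_e V E k) (n + k) \<eta> \<le> 1 - (1 - surv K1 B n \<eta>) * (1 / real \<Delta>) ^ k"
    by (intro P.surv_through[OF X\<Omega> Xcl _ _ \<eta>X]) auto
  also have "\<dots> \<le> 1 - (1 / 2) * (1 / real \<Delta>) ^ k"
    using n by (intro diff_left_mono mult_right_mono) auto
  finally show ?thesis by auto
qed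

text \<open>Trails are hit with a chance that is bounded below uniformly over all paths, so almost
  sure hitting of \<open>A\<close> extends from trails to arbitrary windows, including those left by
  an early stuck move.\<close>

lemma edge_dead_infinite:
  assumes inf: "infinite V" and k: "k \<ge> 1" and \<eta>: "\<eta> \<in> paths V E k"
    and dead: "\<And>\<gamma>. \<gamma> \<in> paths_e V E k \<Longrightarrow> dead K1 A \<gamma>"
  shows "dead K1 A \<eta>"
proof -
  interpret P: pchain V E \<Delta> k "edge_free E" "paths V E k" by (rule edge_pchain)
  have "\<Delta> \<ge> 1" using \<Delta>_pos inf by (metis finite.emptyI ex_in_conv)
  show ?thesis
  proof (rule P.dead_through[where X = "paths V E k" and B = "paths_e V E k" and \<delta> = "(1 / real \<Delta>) ^ k / 2"])
    show "0 < (1 / real \<Delta>) ^ k / 2" using \<open>\<Delta> \<ge> 1\<close> by simp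
  qed (use edge_hits_trail[OF inf _ k] dead \<eta> P.closed in auto)
qed

end

section \<open>Summability, irreducibility and recurrent path chains\<close>

lemma path_chain_n_kn: "path_chain_n E F n \<gamma> = kn (path_chain E F) n \<gamma>"
  by (induction n) (simp_all add: path_chain_n_def kn_Suc' del: kn.simps(2))

context pchain
begin

lemma summable_last:
  assumes bg: "\<And>z. z \<in> \<Omega> \<Longrightarrow> bounded_green K z" and \<gamma>: "\<gamma> \<in> \<Omega>"
  shows "summable (\<lambda>n. measure (measure_pmf (kn K n \<gamma>)) {\<gamma>'. last \<gamma>' = v})"
proof -
  let ?C = "{\<gamma>' \<in> \<Omega>. last \<gamma>' = v}"
  have "finite ?C"
  proof (rule finite_subset[OF _ finite_paths_at[of k v]], intro subsetI CollectI)
    fix \<gamma>' assume g: "\<gamma>' \<in> ?C"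
    then have p: "\<gamma>' \<in> paths V E k" using \<Omega>_paths by auto
    show "\<gamma>' \<in> paths V E k \<and> v \<in> set \<gamma>'" using p last_in_set[OF paths_ne[OF p]] g by auto
  qed
  show ?thesis
  proof (rule summable_comparison_test)
    show "summable (\<lambda>n. \<Sum>\<gamma>'\<in>?C. pmf (kn K n \<gamma>) \<gamma>')"
      using bg \<gamma> by (intro summable_sum summable_kn) auto
    have "measure (measure_pmf (kn K n \<gamma>)) {\<gamma>'. last \<gamma>' = v} \<le> (\<Sum>\<gamma>'\<in>?C. pmf (kn K n \<gamma>) \<gamma>')" for n
    proof -
      have "measure (measure_pmf (kn K n \<gamma>)) {\<gamma>'. last \<gamma>' = v} = measure (measure_pmf (kn K n \<gamma>)) ?C"
        using finite_kn[OF \<gamma>, of n] by (intro measure_pmf.finite_measure_eq_AE) (auto simp: AE_measure_pmf_iff)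
      also have "\<dots> = (\<Sum>\<gamma>'\<in>?C. pmf (kn K n \<gamma>) \<gamma>')"
        using \<open>finite ?C\<close> by (rule measure_measure_pmf_finite)
      finally show ?thesis by simp
    qed
    then show "\<exists>N. \<forall>n\<ge>N. norm (measure (measure_pmf (kn K n \<gamma>)) {\<gamma>'. last \<gamma>' = v})
        \<le> (\<Sum>\<gamma>'\<in>?C. pmf (kn K n \<gamma>) \<gamma>')" by auto
  qed
qed

lemma reach_of_uniform:
  assumes "uniformly_reachable E F \<Omega>"
  shows "\<exists>N. \<forall>\<gamma>\<in>\<Omega>. \<forall>\<gamma>'\<in>\<Omega>. set \<gamma> \<inter> set \<gamma>' \<noteq> {} \<longrightarrow> (\<gamma>, \<gamma>') \<in> (\<Union>n\<le>N. T ^^ n)"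
proof -
  obtain R where R: "\<And>\<gamma> \<gamma>'. \<gamma> \<in> \<Omega> \<Longrightarrow> \<gamma>' \<in> \<Omega> \<Longrightarrow> set \<gamma> \<inter> set \<gamma>' \<noteq> {} \<Longrightarrow> can_reach_within E F R \<gamma> \<gamma>'"
    using assms unfolding uniformly_reachable_def by blast
  have "(\<gamma>, \<gamma>') \<in> (\<Union>n\<le>nat \<lfloor>R\<rfloor>. T ^^ n)" if g: "\<gamma> \<in> \<Omega>" "\<gamma>' \<in> \<Omega>" "set \<gamma> \<inter> set \<gamma>' \<noteq> {}" for \<gamma> \<gamma>'
  proof -
    obtain n where n: "real n \<le> R" "pmf (kn K n \<gamma>) \<gamma>' > 0"
      using R[OF g] by (auto simp: can_reach_within_def path_chain_n_kn)
    have "n \<le> nat \<lfloor>R\<rfloor>" using n(1) by (rule le_nat_floor)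
    moreover have "(\<gamma>, \<gamma>') \<in> T ^^ n" using set_kn[OF g(1), of \<gamma>' n] n(2) by (simp add: set_pmf_iff)
    ultimately show ?thesis by blast
  qed
  then show ?thesis by blast
qed

text \<open>Overlapping paths communicate, and each edge lies on a self-avoiding path that overlaps
  with every path through either endpoint. Move along such paths from \<open>hd \<gamma>\<close> to
  \<open>hd \<gamma>'\<close>.\<close>

lemma irreducible:
  assumes inf: "infinite V" and k: "k \<ge> 1" and sub: "paths_v V E k \<subseteq> \<Omega>"
    and reach: "\<And>\<gamma> \<gamma>'. \<gamma> \<in> \<Omega> \<Longrightarrow> \<gamma>' \<in> \<Omega> \<Longrightarrow> set \<gamma> \<inter> set \<gamma>' \<noteq> {} \<Longrightarrow> (\<gamma>, \<gamma>') \<in> (\<Union>n\<le>N. T ^^ n)"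
    and \<gamma>: "\<gamma> \<in> \<Omega>" "\<gamma>' \<in> \<Omega>"
  shows "(\<gamma>, \<gamma>') \<in> T\<^sup>*"
proof -
  have share: "(\<alpha>, \<beta>) \<in> T\<^sup>*" if "\<alpha> \<in> \<Omega>" "\<beta> \<in> \<Omega>" "x \<in> set \<alpha>" "x \<in> set \<beta>" for \<alpha> \<beta> x
  proof -
    have "(\<alpha>, \<beta>) \<in> (\<Union>n\<le>N. T ^^ n)" using that by (intro reach) auto
    then show ?thesis by (auto intro: relpow_imp_rtrancl)
  qed
  have hd: "hd \<alpha> \<in> set \<alpha>" "hd \<alpha> \<in> V" if "\<alpha> \<in> \<Omega>" for \<alpha>
    using that \<Omega>_paths paths_ne paths_last hd_in_set by blast+
  have "\<exists>\<alpha>\<in>\<Omega>. y \<in> set \<alpha> \<and> (\<gamma>, \<alpha>) \<in> T\<^sup>*" if "(hd \<gamma>, y) \<in> (adj E)\<^sup>*" for y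
    using that
  proof (induction rule: rtrancl_induct)
    case base
    then show ?case using \<gamma>(1) hd by blast
  next
    case (step y w)
    obtain \<alpha> where \<alpha>: "\<alpha> \<in> \<Omega>" "y \<in> set \<alpha>" "(\<gamma>, \<alpha>) \<in> T\<^sup>*" using step by blast
    obtain \<tau> where \<tau>: "\<tau> \<in> \<Omega>" "y \<in> set \<tau>" "w \<in> set \<tau>" using ex_paths_v_edge[OF inf step(2) k] sub by blast
    have "(\<alpha>, \<tau>) \<in> T\<^sup>*" using share \<alpha> \<tau> by blast
    then show ?case using \<alpha>(3) \<tau> by (meson rtrancl_trans)
  qed
  then obtain \<alpha> where \<alpha>: "\<alpha> \<in> \<Omega>" "hd \<gamma>' \<in> set \<alpha>" "(\<gamma>, \<alpha>) \<in> T\<^sup>*" using reach_V hd \<gamma> by meson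
  have "(\<alpha>, \<gamma>') \<in> T\<^sup>*" using share[OF \<alpha>(1) \<gamma>(2) \<alpha>(2)] hd \<gamma> by blast
  with \<alpha>(3) show ?thesis by (rule rtrancl_trans)
qed

text \<open>
  When the chain is recurrent and the diagonal Green functions are comparable, the normalized
  occupation measures are nearly invariant and bounded below, which replaces an invariant measure
  in the energy estimate.
\<close>

lemma recurrent_energy:
  assumes z: "z \<in> \<Omega>" and unb: "\<not> bounded_green K z"
    and cmp: "\<And>x n. x \<in> \<Omega> \<Longrightarrow> p * green K n z z \<le> green K n x x + q" and p: "p > 0" "q \<ge> 0"
    and irr: "\<And>x. x \<in> \<Omega> \<Longrightarrow> (x, z) \<in> T\<^sup>*"
  shows "energy_le T (\<lambda>x. green K l x z) (8 * real \<Delta> / p * green K l z z)"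
  unfolding energy_le_def
proof (intro allI impI)
  fix B assume B: "finite B \<and> B \<subseteq> T"
  let ?f = "\<lambda>x. green K l x z"
  let ?G = "\<lambda>n. green K n z z"
  have Ginf: "filterlim ?G at_top sequentially"
    unfolding filterlim_at_top
  proof
    fix Z
    obtain N where N: "?G N > Z" using unb unfolding bounded_green_def by (meson not_le)
    show "eventually (\<lambda>n. Z \<le> ?G n) sequentially"
      unfolding eventually_sequentially using green_mono[of N _ z z] N by (intro exI[of _ N]) force
  qed
  \<comment> \<open>From \<open>z\<close> the chain hits \<open>x\<close> within some
    \<open>j\<close> steps with chance above 1/2, and the Green function at \<open>x\<close> is at
    least \<open>p\<close> times that at \<open>z\<close> up to \<open>q\<close>. One half of
    \<open>p\<close> is lost to the hitting chance, another absorbs \<open>j\<close> and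
    \<open>q\<close> once \<open>?G n\<close> is large.\<close>
  have low: "eventually (\<lambda>n. p / 4 * ?G n \<le> green K n z x) sequentially" if x: "x \<in> \<Omega>" for x
  proof -
    have ux: "\<not> bounded_green K x"
    proof
      assume "bounded_green K x"
      then obtain b where b: "\<And>n. green K n x x \<le> b" by (auto simp: bounded_green_def)
      have "?G n \<le> (b + q) / p" for n using cmp[OF x, of n] b[of n] p by (simp add: field_simps)
      then show False using unb by (auto simp: bounded_green_def)
    qed
    have "dead K {x} z" by (rule dead_reach[OF x ux irr[OF x]])
    then have "eventually (\<lambda>j. surv K {x} j z < 1 / 2) sequentially"
      unfolding dead_def by (rule order_tendstoD) simp
    then obtain j where j: "surv K {x} j z < 1 / 2" by (auto simp: eventually_sequentially)
    have "eventually (\<lambda>n. 2 * real j + 2 * q / p \<le> ?G n \<and> j \<le> n) sequentially"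
      using Ginf eventually_ge_at_top[of j] by (intro eventually_conj) (auto simp: filterlim_at_top)
    then show ?thesis
    proof eventually_elim
      fix n assume n: "2 * real j + 2 * q / p \<le> ?G n \<and> j \<le> n"
      have "?G n \<le> ?G (n - j) + real j" using green_le_add[of "n - j" j z z] n by simp
      then have "p * (?G n - real j) \<le> p * ?G (n - j)" using p by (intro mult_left_mono) auto
      also have "\<dots> \<le> green K (n - j) x x + q" by (rule cmp[OF x])
      finally have a: "p * (?G n - real j) - q \<le> green K (n - j) x x" by simp
      have "(1 / 2) * green K (n - j) x x \<le> (1 - surv K {x} j z) * green K (n - j) x x"
        using j green_nonneg by (intro mult_right_mono) auto
      also have "\<dots> \<le> green K (n - j + j) z x" by (rule green_ge_surv[OF x z])
      finally have b: "green K (n - j) x x / 2 \<le> green K n z x" using n by simp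
      have "p * (2 * real j + 2 * q / p) \<le> p * ?G n" using n p by (intro mult_left_mono) auto
      then have "2 * p * real j + 2 * q \<le> p * ?G n" using p by (simp add: distrib_left)
      then show "p / 4 * ?G n \<le> green K n z x" using a b by (simp add: right_diff_distrib)
    qed
  qed
  define S where "S = {x \<in> \<Omega>. ?f x \<noteq> 0} \<union> fst ` B \<union> snd ` B \<union> {z}"
  have S: "finite S" "S \<subseteq> \<Omega>" "z \<in> S"
    using B finite_green_support[OF T_bdeg] z T_in by (auto simp: S_def)
  have BS: "B \<subseteq> S \<times> S"
  proof
    fix i assume "i \<in> B"
    then have "fst i \<in> S" "snd i \<in> S" by (auto simp: S_def)
    then show "i \<in> S \<times> S" by (simp add: mem_Times_iff)
  qed
  let ?d = "\<lambda>x y. (?f x - ?f y)\<^sup>2"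
  let ?X = "\<Sum>(x, y)\<in>B. ?d x y"
  let ?Z = "4 * real \<Delta> / p * (\<Sum>x\<in>S. (?f x)\<^sup>2)"
  have "eventually (\<lambda>n. 1 \<le> ?G n) sequentially" using Ginf by (auto simp: filterlim_at_top)
  moreover have "eventually (\<lambda>n. \<forall>x\<in>S. p / 4 * ?G n \<le> green K n z x) sequentially"
    using S low by (intro eventually_ball_finite) auto
  ultimately have ev: "eventually (\<lambda>n. ?X \<le> 8 * real \<Delta> / p * ?f z + ?Z / ?G n) sequentially"
  proof eventually_elim
    fix n assume G1: "1 \<le> ?G n" and lw: "\<forall>x\<in>S. p / 4 * ?G n \<le> green K n z x"
    \<comment> \<open>The occupation measure up to time \<open>n\<close>, normalized to 1 at
      \<open>z\<close>. One step of the chain increases it by at most the boundary term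
      \<open>1 / ?G n\<close>, which vanishes as \<open>n\<close> grows, while \<open>l\<close> and
      hence \<open>S\<close> stay fixed.\<close>
    define \<pi> where "\<pi> x = green K n z x / ?G n" for x
    have \<pi>low: "p / 4 \<le> \<pi> x" if "x \<in> S" for x
      using lw that G1 by (simp add: \<pi>_def pos_le_divide_eq)
    have inflow: "(\<Sum>x\<in>S. \<pi> x * pmf (K x) y) \<le> \<pi> y + 1 / ?G n" for y
    proof -
      have "(\<Sum>x\<in>S. green K n z x * pmf (K x) y) = (\<Sum>m\<le>n. \<Sum>x\<in>S. pmf (kn K m z) x * pmf (K x) y)"
        unfolding green_def sum_distrib_right by (rule sum.swap)
      also have "\<dots> \<le> (\<Sum>m\<le>n. pmf (kn K (Suc m) z) y)"
      proof (intro sum_mono)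
        fix m
        have "pmf (kn K (Suc m) z) y = (\<Sum>x\<in>set_pmf (kn K m z). pmf (kn K m z) x * pmf (K x) y)"
          unfolding kn_Suc' using finite_kn[OF z] by (intro pmf_bind_sum) auto
        moreover have "(\<Sum>x\<in>S. pmf (kn K m z) x * pmf (K x) y) =
            (\<Sum>x\<in>S \<inter> set_pmf (kn K m z). pmf (kn K m z) x * pmf (K x) y)"
          using S(1) by (intro sum.mono_neutral_right) (auto simp: set_pmf_iff)
        moreover have "\<dots> \<le> (\<Sum>x\<in>set_pmf (kn K m z). pmf (kn K m z) x * pmf (K x) y)"
          using finite_kn[OF z] by (intro sum_mono2) auto
        ultimately show "(\<Sum>x\<in>S. pmf (kn K m z) x * pmf (K x) y) \<le> pmf (kn K (Suc m) z) y" by simp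
      qed
      also have "\<dots> \<le> pmf (kn K 0 z) y + (\<Sum>m\<le>n. pmf (kn K (Suc m) z) y)" by simp
      also have "\<dots> = green K (Suc n) z y" unfolding green_def by (rule sum.atMost_Suc_shift[symmetric])
      also have "\<dots> \<le> green K n z y + 1" using green_le_add[of n 1 z y] by simp
      finally have "(\<Sum>x\<in>S. green K n z x * pmf (K x) y) / ?G n \<le> (green K n z y + 1) / ?G n"
        using G1 by (intro divide_right_mono) auto
      then show ?thesis by (simp add: \<pi>_def sum_divide_distrib add_divide_distrib)
    qed
    have d0: "\<Delta> > 0" using z opt_props(4,5) by fastforce
    have "p / (4 * real \<Delta>) * ?X \<le> (\<Sum>(x, y)\<in>B. \<pi> x * pmf (K x) y * ?d x y)"
      unfolding sum_distrib_left case_prod_unfold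
    proof (intro sum_mono mult_right_mono)
      fix i assume i: "i \<in> B"
      have "(p / 4) * (1 / real \<Delta>) \<le> \<pi> (fst i) * pmf (K (fst i)) (snd i)"
      proof (intro mult_mono)
        show "p / 4 \<le> \<pi> (fst i)" using i by (intro \<pi>low) (auto simp: S_def)
        show "1 / real \<Delta> \<le> pmf (K (fst i)) (snd i)"
          using i B by (intro pmf_K_ge) (auto simp: T_def)
        show "0 \<le> \<pi> (fst i)" using G1 green_nonneg by (auto simp: \<pi>_def)
      qed simp
      then show "p / (4 * real \<Delta>) \<le> \<pi> (fst i) * pmf (K (fst i)) (snd i)" by simp
    qed simp
    also have "\<dots> \<le> (\<Sum>(x, y)\<in>S \<times> S. \<pi> x * pmf (K x) y * ?d x y)"
      using S BS G1 green_nonneg by (intro sum_mono2) (auto simp: \<pi>_def)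
    also have "\<dots> = (\<Sum>x\<in>S. \<Sum>y\<in>S. \<pi> x * pmf (K x) y * ?d x y)" by (simp add: sum.cartesian_product)
    also have "\<dots> \<le> 2 * \<pi> z * ?f z + 1 / ?G n * (\<Sum>x\<in>S. (?f x)\<^sup>2)"
    proof (rule green_energy[OF z S])
      show "0 \<le> \<pi> x" for x using G1 green_nonneg[of n z x] by (simp add: \<pi>_def)
    qed (use inflow in \<open>auto simp: S_def\<close>)
    also have "\<pi> z = 1" using G1 by (simp add: \<pi>_def)
    finally have "p / (4 * real \<Delta>) * ?X \<le> 2 * ?f z + 1 / ?G n * (\<Sum>x\<in>S. (?f x)\<^sup>2)" by simp
    then have "(4 * real \<Delta> / p) * (p / (4 * real \<Delta>) * ?X) \<le>
        (4 * real \<Delta> / p) * (2 * ?f z + 1 / ?G n * (\<Sum>x\<in>S. (?f x)\<^sup>2))"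
      using p by (intro mult_left_mono) auto
    moreover have "(4 * real \<Delta> / p) * (p / (4 * real \<Delta>) * ?X) = ?X" using p d0 by simp
    ultimately show "?X \<le> 8 * real \<Delta> / p * ?f z + ?Z / ?G n" by (simp add: algebra_simps)
  qed
  have "(\<lambda>n. 8 * real \<Delta> / p * ?f z + ?Z / ?G n) \<longlonglongrightarrow> 8 * real \<Delta> / p * ?f z + 0"
    by (intro tendsto_add tendsto_const real_tendsto_divide_at_top[OF tendsto_const Ginf])
  then show "?X \<le> 8 * real \<Delta> / p * ?f z"
    using tendsto_lowerbound[OF _ ev] by simp
qed

end

context bgraph
begin

subsection \<open>Automorphisms\<close>

text \<open>An automorphism maps the unvisited neighbours of a path onto those of its image, so it
  commutes with the chain.\<close>

lemma automorphism_chain: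
  assumes \<phi>: "graph_automorphism V E \<phi>" and stuck: "cannot_get_stuck (vertex_free E) (paths_v V E k)"
    and \<gamma>: "\<gamma> \<in> paths_v V E k"
  shows "map \<phi> \<gamma> \<in> paths_v V E k"
    and "kn (path_chain E (vertex_free E)) n (map \<phi> \<gamma>) = map_pmf (map \<phi>) (kn (path_chain E (vertex_free E)) n \<gamma>)"
proof -
  interpret P: pchain V E \<Delta> k "vertex_free E" "paths_v V E k" by (rule vertex_pchain_v[OF stuck])
  have inj: "inj_on \<phi> V" and im: "\<phi> ` V = V" and E: "\<And>x y. x \<in> V \<Longrightarrow> y \<in> V \<Longrightarrow> {\<phi> x, \<phi> y} \<in> E \<longleftrightarrow> {x, y} \<in> E"
    using \<phi> by (auto simp: graph_automorphism_def bij_betw_def)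
  have in_paths: "map \<phi> \<gamma> \<in> paths_v V E k" if \<gamma>: "\<gamma> \<in> paths_v V E k" for \<gamma>
  proof -
    have p: "length \<gamma> = Suc k" "set \<gamma> \<subseteq> V" "successively (\<lambda>x y. {x, y} \<in> E) \<gamma>" "distinct \<gamma>"
      using \<gamma> by (auto simp: paths_v_iff paths_iff)
    have "successively (\<lambda>x y. {\<phi> x, \<phi> y} \<in> E) \<gamma>"
      using p(3) by (rule successively_mono) (use p(2) E in auto)
    then show ?thesis using p inj im
      by (auto simp: paths_v_iff paths_iff successively_map distinct_map intro: inj_on_subset)
  qed
  show "map \<phi> \<gamma> \<in> paths_v V E k" by (rule in_paths[OF \<gamma>])
  have step: "P.K (map \<phi> \<gamma>) = map_pmf (map \<phi>) (P.K \<gamma>)" if \<gamma>: "\<gamma> \<in> paths_v V E k" for \<gamma>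
  proof -
    have ne: "\<gamma> \<noteq> []" and sV: "set \<gamma> \<subseteq> V" using \<gamma> by (auto simp: paths_v_iff paths_iff)
    have lV: "last \<gamma> \<in> V" using ne sV by auto
    have "nbrs E (\<phi> (last \<gamma>)) = \<phi> ` nbrs E (last \<gamma>)"
    proof (intro equalityI subsetI)
      fix y assume y: "y \<in> nbrs E (\<phi> (last \<gamma>))"
      then obtain x where x: "x \<in> V" "y = \<phi> x" using nbrs_V im by blast
      then show "y \<in> \<phi> ` nbrs E (last \<gamma>)" using y E[OF lV x(1)] by (auto simp: nbrs_def)
    next
      fix y assume "y \<in> \<phi> ` nbrs E (last \<gamma>)"
      then obtain x where x: "x \<in> nbrs E (last \<gamma>)" "y = \<phi> x" by auto
      then have "x \<in> V" using nbrs_V by auto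
      then show "y \<in> nbrs E (\<phi> (last \<gamma>))" using x E[OF lV] by (auto simp: nbrs_def)
    qed
    moreover have "\<phi> x \<in> \<phi> ` set \<gamma> \<longleftrightarrow> x \<in> set \<gamma>" if "x \<in> nbrs E (last \<gamma>)" for x
      using inj_on_image_mem_iff[OF inj _ sV] that nbrs_V by auto
    ultimately have vf: "vertex_free E (map \<phi> \<gamma>) = \<phi> ` vertex_free E \<gamma>"
      using ne by (auto simp: vertex_free_def last_map)
    have opt: "opt (vertex_free E) \<gamma> = vertex_free E \<gamma>" "opt (vertex_free E) (map \<phi> \<gamma>) = \<phi> ` vertex_free E \<gamma>"
      using stuck \<gamma> in_paths[OF \<gamma>] vf by (auto simp: opt_def cannot_get_stuck_def)
    have A: "finite (vertex_free E \<gamma>)" "vertex_free E \<gamma> \<noteq> {}"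
      using P.opt_props(1,2)[OF \<gamma>] opt(1) by simp_all
    have "vertex_free E \<gamma> \<subseteq> V" using P.opt_props(3)[OF \<gamma>] opt(1) nbrs_V[of "last \<gamma>"] by simp
    then have i: "inj_on \<phi> (vertex_free E \<gamma>)" by (rule inj_on_subset[OF inj])
    have "P.K (map \<phi> \<gamma>) = map_pmf (\<lambda>v. tl (map \<phi> \<gamma>) @ [v]) (pmf_of_set (\<phi> ` vertex_free E \<gamma>))"
      using P.K_eq[OF in_paths[OF \<gamma>]] opt by simp
    also have "pmf_of_set (\<phi> ` vertex_free E \<gamma>) = map_pmf \<phi> (pmf_of_set (vertex_free E \<gamma>))"
      by (rule map_pmf_of_set_inj[OF i A(2,1), symmetric])
    also have "map_pmf (\<lambda>v. tl (map \<phi> \<gamma>) @ [v]) \<dots> = map_pmf (map \<phi>) (P.K \<gamma>)"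
      using P.K_eq[OF \<gamma>] opt by (simp add: map_pmf_comp o_def map_tl)
    finally show ?thesis .
  qed
  have "kn P.K n (map \<phi> \<gamma>) = map_pmf (map \<phi>) (kn P.K n \<gamma>)" if "\<gamma> \<in> paths_v V E k" for n \<gamma>
    using that
  proof (induction n arbitrary: \<gamma>)
    case (Suc n)
    have "kn P.K (Suc n) (map \<phi> \<gamma>) = bind_pmf (P.K \<gamma>) (\<lambda>x. kn P.K n (map \<phi> x))"
      by (simp add: step[OF Suc.prems] bind_map_pmf)
    also have "\<dots> = bind_pmf (P.K \<gamma>) (\<lambda>x. map_pmf (map \<phi>) (kn P.K n x))"
      using Suc.IH P.closed[OF Suc.prems] by (intro bind_pmf_cong) auto
    finally show ?case by (simp add: map_bind_pmf)
  qed simp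
  then show "kn P.K n (map \<phi> \<gamma>) = map_pmf (map \<phi>) (kn P.K n \<gamma>)" using \<gamma> .
qed

lemma automorphism_green:
  assumes \<phi>: "graph_automorphism V E \<phi>" and stuck: "cannot_get_stuck (vertex_free E) (paths_v V E k)"
    and \<gamma>: "\<gamma> \<in> paths_v V E k"
  shows "green (path_chain E (vertex_free E)) n (map \<phi> \<gamma>) (map \<phi> \<gamma>) = green (path_chain E (vertex_free E)) n \<gamma> \<gamma>"
proof -
  interpret P: pchain V E \<Delta> k "vertex_free E" "paths_v V E k" by (rule vertex_pchain_v[OF stuck])
  have "inj_on \<phi> V" using \<phi> by (auto simp: graph_automorphism_def bij_betw_def)
  then have inj: "inj_on (map \<phi>) (paths_v V E k)"
    by (intro inj_on_mapI) (erule inj_on_subset, auto simp: paths_v_iff paths_iff)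
  have "pmf (kn P.K m (map \<phi> \<gamma>)) (map \<phi> \<gamma>) = pmf (kn P.K m \<gamma>) \<gamma>" for m
  proof -
    have "pmf (kn P.K m (map \<phi> \<gamma>)) (map \<phi> \<gamma>) = measure (measure_pmf (kn P.K m \<gamma>)) (map \<phi> -` {map \<phi> \<gamma>})"
      unfolding automorphism_chain(2)[OF \<phi> stuck \<gamma>] by (rule pmf_map)
    also have "\<dots> = measure (measure_pmf (kn P.K m \<gamma>)) {\<gamma>}"
      using P.finite_kn[OF \<gamma>, of m] inj \<gamma>
      by (intro measure_pmf.finite_measure_eq_AE) (auto simp: AE_measure_pmf_iff inj_on_def)
    finally show ?thesis by (simp add: measure_pmf_single)
  qed
  then show ?thesis by (simp add: green_def)
qed

text \<open>The argument is by contradiction, because the energy bound through occupation measures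
  is available only in the recurrent case. Together with the inequality inherited from the simple
  random walk it bounds the very Green function assumed unbounded.\<close>

lemma vertex_bounded:
  assumes inf: "infinite V" and k: "k \<ge> 1" and trans: "vertex_transitive V E"
    and reach: "uniformly_reachable E (vertex_free E) (paths_v V E k)"
    and stuck: "cannot_get_stuck (vertex_free E) (paths_v V E k)"
    and srw: "\<And>v. v \<in> V \<Longrightarrow> bounded_green K0 [v]"
    and z: "z \<in> paths_v V E k"
  shows "bounded_green (path_chain E (vertex_free E)) z"
proof (rule ccontr)
  interpret P: pchain V E \<Delta> k "vertex_free E" "paths_v V E k" by (rule vertex_pchain_v[OF stuck])
  assume unb: "\<not> bounded_green P.K z"
  obtain N where N: "\<And>\<gamma> \<gamma>'. \<gamma> \<in> paths_v V E k \<Longrightarrow> \<gamma>' \<in> paths_v V E k \<Longrightarrow> set \<gamma> \<inter> set \<gamma>' \<noteq> {} \<Longrightarrow>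
      (\<gamma>, \<gamma>') \<in> (\<Union>n\<le>N. P.T ^^ n)"
    using P.reach_of_uniform[OF reach] by blast
  have hd: "hd \<gamma> \<in> set \<gamma>" "hd \<gamma> \<in> V" "\<gamma> \<noteq> []" if "\<gamma> \<in> paths_v V E k" for \<gamma>
    using that paths_ne[of \<gamma> k] paths_last[of \<gamma> k] by (auto simp: paths_v_iff)
  have \<Delta>1: "\<Delta> \<ge> 1" using \<Delta>_pos hd(2)[OF z] by blast
  \<comment> \<open>Transitivity moves \<open>x\<close> to a path starting at \<open>hd z\<close>,
    and this path and \<open_z>\<open>z\<close> reach each other within \<open>N\<close> steps, each
    way with probability at least \<open>(1 / \<Delta>) ^ N\<close>. The at most
    \<open>2 * N\<close> additional steps give the additive constant.\<close>
  define p where "p = ((1 / real \<Delta>) ^ N)\<^sup>2"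
  have p0: "p > 0" using \<Delta>1 by (simp add: p_def)
  have cmp: "p * green P.K n z z \<le> green P.K n x x + 2 * real N" if x: "x \<in> paths_v V E k" for x n
  proof -
    obtain \<phi> where \<phi>: "graph_automorphism V E \<phi>" "\<phi> (hd x) = hd z"
      using trans hd(2)[OF x] hd(2)[OF z] unfolding vertex_transitive_def by blast
    let ?x = "map \<phi> x"
    have x': "?x \<in> paths_v V E k" by (rule automorphism_chain(1)[OF \<phi>(1) stuck x])
    have "hd ?x = hd z" using \<phi>(2) hd(3)[OF x] by (simp add: hd_map)
    then have s: "set ?x \<inter> set z \<noteq> {}" "set z \<inter> set ?x \<noteq> {}" using hd(1)[OF x'] hd(1)[OF z] by auto
    obtain a where a: "a \<le> N" "(?x, z) \<in> P.T ^^ a" using N[OF x' z s(1)] by auto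
    obtain b where b: "b \<le> N" "(z, ?x) \<in> P.T ^^ b" using N[OF z x' s(2)] by auto
    have mono: "(1 / real \<Delta>) ^ N \<le> (1 / real \<Delta>) ^ i" if "i \<le> N" for i
      using that \<Delta>1 by (intro power_decreasing) auto
    have "p * green P.K n z z = (1 / real \<Delta>) ^ N * green P.K n z z * (1 / real \<Delta>) ^ N"
      by (simp add: p_def power2_eq_square)
    also have "\<dots> \<le> pmf (kn P.K a ?x) z * green P.K n z z * pmf (kn P.K b z) ?x"
      using P.pmf_kn_ge[OF a(2) x'] P.pmf_kn_ge[OF b(2) z] mono[OF a(1)] mono[OF b(1)] P.green_nonneg
      by (intro mult_mono) auto
    also have "\<dots> \<le> green P.K (n + a + b) ?x ?x" by (rule P.green_add_ge[OF x' z])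
    also have "\<dots> \<le> green P.K n ?x ?x + real (a + b)"
      using P.green_le_add[of n "a + b" ?x ?x] by (simp add: add.assoc)
    also have "\<dots> \<le> green P.K n x x + 2 * real N"
      using a(1) b(1) automorphism_green[OF \<phi>(1) stuck x, of n] by simp
    finally show ?thesis .
  qed
  have irr: "(x, z) \<in> P.T\<^sup>*" if "x \<in> paths_v V E k" for x
    by (rule P.irreducible[OF inf k order_refl N that z])
  have en: "energy_le P.T (\<lambda>x. green P.K l x z) (8 * real \<Delta> / p * green P.K l z z)" for l
    by (rule P.recurrent_energy[OF z unb cmp p0 _ irr]) simp_all
  obtain C where C: "C \<ge> 0" "srw_ineq (hd z) C" using srw_ineqI[OF hd(2)[OF z] srw[OF hd(2)[OF z]]] by blast
  obtain C' where C': "\<And>f D. finite {x \<in> paths_v V E k. f x \<noteq> 0} \<Longrightarrow> energy_le P.T f D \<Longrightarrow> (f z)\<^sup>2 \<le> C' * D"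
    using P.compare_srw[OF inf k order_refl N z C(2,1)] by blast
  have "bounded_green P.K z"
  proof (rule P.bounded_of_energy[OF z P.T_bdeg])
    show "(f z)\<^sup>2 \<le> C' * D" if "finite {x \<in> paths_v V E k. f x \<noteq> 0}" "energy_le P.T f D" for f D
      using C' that by blast
  qed (rule en)
  then show False using unb by blast
qed

lemma edge_bounded:
  assumes inf: "infinite V" and k: "k \<ge> 1"
    and reach: "uniformly_reachable E (edge_free E) (paths_e V E k)"
    and stuck: "cannot_get_stuck (edge_free E) (paths_e V E k)"
    and srw: "\<And>v. v \<in> V \<Longrightarrow> bounded_green K0 [v]"
    and z: "z \<in> paths_e V E k"
  shows "bounded_green K1 z"
proof -
  interpret P: pchain V E \<Delta> k "edge_free E" "paths_e V E k" by (rule edge_pchain_e[OF stuck k])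
  obtain N where N: "\<And>\<gamma> \<gamma>'. \<gamma> \<in> paths_e V E k \<Longrightarrow> \<gamma>' \<in> paths_e V E k \<Longrightarrow> set \<gamma> \<inter> set \<gamma>' \<noteq> {} \<Longrightarrow>
      (\<gamma>, \<gamma>') \<in> (\<Union>n\<le>N. P.T ^^ n)"
    using P.reach_of_uniform[OF reach] by blast
  obtain \<pi> lo where fl: "rev_flow K1 (paths_e V E k) \<pi> rev lo \<Delta> \<Delta>" using edge_rev_flow[OF stuck k] by blast
  have hz: "hd z \<in> V" using z paths_last by (auto simp: paths_e_iff)
  obtain C where C: "C \<ge> 0" "srw_ineq (hd z) C" using srw_ineqI[OF hz srw[OF hz]] by blast
  obtain C' where "\<And>f D. finite {x \<in> paths_e V E k. f x \<noteq> 0} \<Longrightarrow> energy_le P.T f D \<Longrightarrow> (f z)\<^sup>2 \<le> C' * D"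
    using P.compare_srw[OF inf k paths_v_subset_e N z C(2,1)] by blast
  then show ?thesis by (rule rev_flow.bounded_greenI[OF fl z])
qed

lemma edge_backward:
  assumes k: "k \<ge> 1"
    and reach: "uniformly_reachable E (edge_free E) (paths_e V E k)"
    and stuck: "cannot_get_stuck (edge_free E) (paths_e V E k)"
    and z: "z \<in> paths_e V E k" and bg: "bounded_green K1 z"
  shows "bounded_green K0 [hd z]"
proof -
  interpret P: pchain V E \<Delta> k "edge_free E" "paths_e V E k" by (rule edge_pchain_e[OF stuck k])
  obtain N where N: "\<And>\<gamma> \<gamma>'. \<gamma> \<in> paths_e V E k \<Longrightarrow> \<gamma>' \<in> paths_e V E k \<Longrightarrow> set \<gamma> \<inter> set \<gamma>' \<noteq> {} \<Longrightarrow>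
      (\<gamma>, \<gamma>') \<in> (\<Union>n\<le>N. P.T ^^ n)"
    using P.reach_of_uniform[OF reach] by blast
  obtain \<pi> lo where fl: "rev_flow K1 (paths_e V E k) \<pi> rev lo \<Delta> \<Delta>" using edge_rev_flow[OF stuck k] by blast
  have "(\<gamma>, rev \<gamma>) \<in> (\<Union>n\<le>N. (P.T \<union> P.T\<inverse>) ^^ n)" if \<gamma>: "\<gamma> \<in> paths_e V E k" for \<gamma>
  proof -
    have "rev \<gamma> \<in> paths_e V E k" using \<gamma> paths_rev by (auto simp: paths_e_iff elist_rev)
    moreover have "set \<gamma> \<inter> set (rev \<gamma>) \<noteq> {}" using \<gamma> paths_ne[of \<gamma> k] by (auto simp: paths_e_iff)
    ultimately have "(\<gamma>, rev \<gamma>) \<in> (\<Union>n\<le>N. P.T ^^ n)" using N[OF \<gamma>] by blast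
    moreover have "P.T ^^ n \<subseteq> (P.T \<union> P.T\<inverse>) ^^ n" for n
      by (induction n) (auto intro: relcompI)
    ultimately show ?thesis by blast
  qed
  then show ?thesis by (rule P.backward[OF fl _ z bg])
qed

end

subsection \<open>Recurrence criteria for walks\<close>

context window_walk
begin

lemma ex_valid: "\<exists>y. valid step u t y"
proof (induction t)
  case 0
  show ?case by (intro exI[of _ "\<lambda>_. u"]) (simp add: valid_def)
next
  case (Suc t)
  then obtain y where y: "valid step u t y" by blast
  obtain w where "w \<in> set_pmf (step t y)" using set_pmf_not_empty[of "step t y"] by blast
  then show ?case using valid_upd[OF y] by blast
qed

lemma valid_Suc: "valid step u (Suc t) y \<Longrightarrow> valid step u t y"
  by (simp add: valid_def)

lemma win_T:
  assumes "valid step u (Suc t) y" "k \<le> t"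
  shows "(win k t y, win k (Suc t) y) \<in> T"
proof -
  have v: "valid step u t y" by (rule valid_Suc[OF assms(1)])
  have "y (Suc t) \<in> set_pmf (step t y)" using assms(1) by (simp add: valid_def)
  then have "win k (Suc t) y \<in> set_pmf (K (win k t y))"
    using win_step[OF v assms(2)] win_Suc[OF assms(2), of y] by simp
  then show ?thesis using win_in[OF v assms(2)] by (simp add: T_def)
qed

lemma win_reach: "valid step u t y \<Longrightarrow> k \<le> t \<Longrightarrow> (win k k y, win k t y) \<in> T\<^sup>*"
proof (induction t)
  case (Suc t)
  show ?case
  proof (cases "k = Suc t")
    case False
    then have k: "k \<le> t" using Suc.prems by simp
    have "(win k k y, win k t y) \<in> T\<^sup>*" by (rule Suc.IH[OF valid_Suc[OF Suc.prems(1)] k])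
    then show ?thesis using win_T[OF Suc.prems(1) k] by (rule rtrancl_into_rtrancl)
  qed simp
qed simp

lemma valid_le: "valid step u t y \<Longrightarrow> s \<le> t \<Longrightarrow> valid step u s y"
  by (simp add: valid_def)

text \<open>Whatever the first \<open>k\<close> steps were, the first full window contains the
  starting vertex. Almost sure return to this window therefore brings the walk back to
  \<open>u\<close>.\<close>

lemma recurrent_unbounded:
  assumes "\<And>z. z \<in> \<Omega> \<Longrightarrow> u \<in> set z \<Longrightarrow> \<not> bounded_green K z"
  shows "recurrent_vertex V step u"
  unfolding recurrent_vertex_def
proof (rule recurrentI[of 0])
  fix t y assume y: "valid step u t y" "k \<le> t"
  let ?e = "win k k y"
  have vk: "valid step u k y" by (rule valid_le[OF y])
  have e: "?e \<in> \<Omega>" by (rule win_in[OF vk order_refl])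
  have "u \<in> set ?e" using y(1) by (auto simp: set_win valid_def intro!: image_eqI[of _ _ 0])
  moreover have "dead K {?e} (win k t y)"
    by (rule dead_reach[OF e assms[OF e \<open>u \<in> set ?e\<close>] win_reach[OF y]])
  ultimately show "dead K {\<gamma>. u \<in> set \<gamma>} (win k t y)"
    using win_in[OF y] by (auto intro: dead_mono)
qed

lemma recurrent_dead:
  assumes "\<And>\<eta>. \<eta> \<in> \<Omega> \<Longrightarrow> dead K {\<gamma>. u \<in> set \<gamma>} \<eta>"
  shows "recurrent_vertex V step u"
  unfolding recurrent_vertex_def by (rule recurrentI[of 0]) (use assms win_in in blast)

end

lemma recurrent_one_vertex:
  assumes step: "\<And>t x. (\<And>i. i \<le> t \<Longrightarrow> x i = v) \<Longrightarrow> set_pmf (step t x) \<subseteq> {v}"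
  shows "recurrent_vertex {v} step v"
proof -
  interpret IT: Ionescu_Tulcea "walk_kernel {v} step v" "\<lambda>_. count_space {v}"
    by (rule Ionescu_Tulcea_walk_kernel) (use step in auto)
  have "space (walk_law {v} step v) = UNIV \<rightarrow>\<^sub>E {v}" by (simp add: walk_law_def space_PiM)
  then show ?thesis
    unfolding recurrent_vertex_def by (intro AE_I2) (auto simp: PiE_iff INFM_nat_le)
qed

section \<open>The four walks as window walks\<close>

context bgraph
begin

lemma set_uniform_nbr:
  assumes "x \<in> V" "S \<subseteq> nbrs E x"
  shows "set_pmf (uniform_or S (uniform_nbr E x)) \<subseteq> nbrs E x"
    and "finite (set_pmf (uniform_or S (uniform_nbr E x)))"
    and "S \<noteq> {} \<Longrightarrow> set_pmf (uniform_or S (uniform_nbr E x)) = S"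
proof -
  have f: "finite S" using assms deg_fin finite_subset by blast
  show a: "set_pmf (uniform_or S (uniform_nbr E x)) \<subseteq> nbrs E x"
    using assms(2) f deg_fin[OF assms(1)] deg_pos[OF assms(1)]
    by (auto simp: uniform_or_def uniform_nbr_def)
  show "finite (set_pmf (uniform_or S (uniform_nbr E x)))"
    using a deg_fin[OF assms(1)] by (rule finite_subset)
  show "S \<noteq> {} \<Longrightarrow> set_pmf (uniform_or S (uniform_nbr E x)) = S"
    using f by (simp add: uniform_or_def)
qed

text \<open>The neighbour condition may assume that earlier positions are successively adjacent; the
  non-backtracking walk needs this when it returns to its previous position at a dead end.\<close>

lemma window_walkI:
  assumes P: "pchain V E \<Delta> k F (paths V E k)" and u: "u \<in> V"
    and stepV: "\<And>t x. (\<And>i. i \<le> t \<Longrightarrow> x i \<in> V) \<Longrightarrow> set_pmf (step t x) \<subseteq> V \<and> finite (set_pmf (step t x))"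
    and past: "\<And>t x x'. (\<And>i. i \<le> t \<Longrightarrow> x i = x' i) \<Longrightarrow> step t x = step t x'"
    and nb: "\<And>t x. (\<And>i. i \<le> t \<Longrightarrow> x i \<in> V) \<Longrightarrow> (\<And>i. i < t \<Longrightarrow> (x i, x (Suc i)) \<in> adj E) \<Longrightarrow>
        set_pmf (step t x) \<subseteq> nbrs E (x t)"
    and K: "\<And>t x. win k t x \<in> paths V E k \<Longrightarrow> k \<le> t \<Longrightarrow>
        path_chain E F (win k t x) = map_pmf (\<lambda>v. tl (win k t x) @ [v]) (step t x)"
  shows "window_walk (path_chain E F) (paths V E k) V step u k"
proof -
  interpret P: pchain V E \<Delta> k F "paths V E k" by (rule P)
  have adj: "(x i, x (Suc i)) \<in> adj E" if "valid step u t x" "i < t" for t x i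
    using that
  proof (induction i rule: less_induct)
    case (less i)
    have prev: "(x j, x (Suc j)) \<in> adj E" if "j < i" for j using less that by simp
    have inV: "x j \<in> V" if "j \<le> i" for j
    proof (cases j)
      case 0
      then show ?thesis using less.prems(1) u by (simp add: valid_def)
    next
      case (Suc l)
      then show ?thesis using prev[of l] adj_V that by auto
    qed
    have "set_pmf (step i x) \<subseteq> nbrs E (x i)" using inV prev by (intro nb)
    then show ?case using less.prems by (auto simp: valid_def nbrs_adj)
  qed
  have win: "win k t x \<in> paths V E k" if v: "valid step u t x" and k: "k \<le> t" for t x
  proof -
    have V: "x i \<in> V" if "i \<le> t" for i
    proof (cases i)
      case 0
      then show ?thesis using v u by (simp add: valid_def)
    next
      case (Suc l)
      then show ?thesis using adj[OF v, of l] adj_V that by auto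
    qed
    have "successively (\<lambda>x y. {x, y} \<in> E) (win k t x)"
      unfolding successively_conv_nth win_def using adj[OF v] k
      by (auto simp: adj_def simp del: upt_Suc)
    moreover have "set (win k t x) \<subseteq> V" unfolding set_win using V by auto
    moreover have "length (win k t x) = Suc k" unfolding win_def using k by (simp del: upt_Suc)
    ultimately show ?thesis by (simp add: paths_iff)
  qed
  show ?thesis
    by standard (use countable_V u stepV past win K in blast)+
qed

lemma srw_walk:
  assumes "u \<in> V"
  shows "window_walk K0 (paths V E 0) V (srw E) u 0"
proof (rule window_walkI[OF srw_pchain assms])
  fix t and x :: "nat \<Rightarrow> 'a"
  have e: "uniform_nbr E (x t) = uniform_or {} (uniform_nbr E (x t))" by (simp add: uniform_or_def)
  show "set_pmf (srw E t x) \<subseteq> V \<and> finite (set_pmf (srw E t x))" if "\<And>i. i \<le> t \<Longrightarrow> x i \<in> V"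
    using set_uniform_nbr[of "x t" "{}"] that nbrs_V[of "x t"] unfolding srw_def by (subst (1 2) e) auto
  show "set_pmf (srw E t x) \<subseteq> nbrs E (x t)" if "\<And>i. i \<le> t \<Longrightarrow> x i \<in> V" "\<And>i. i < t \<Longrightarrow> (x i, x (Suc i)) \<in> adj E"
    using set_uniform_nbr(1)[of "x t" "{}"] that(1) unfolding srw_def by (subst e) auto
  show "K0 (win 0 t x) = map_pmf (\<lambda>v. tl (win 0 t x) @ [v]) (srw E t x)"
    unfolding path_chain_def last_win srw_def by (simp add: uniform_or_def)
qed (simp add: srw_def)

lemma nbrw_walk:
  assumes "u \<in> V"
  shows "window_walk K1 (paths V E 1) V (nbrw E) u 1"
proof (rule window_walkI[OF edge_pchain assms])
  fix t and x :: "nat \<Rightarrow> 'a"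
  have e: "uniform_nbr E y = uniform_or {} (uniform_nbr E y)" for y by (simp add: uniform_or_def)
  have S: "set_pmf (uniform_or {z \<in> nbrs E (x (Suc s)). z \<noteq> x s} (return_pmf (x s)))
      \<subseteq> insert (x s) (nbrs E (x (Suc s)))" if "x (Suc s) \<in> V" for s
    using deg_fin[OF that] by (auto simp: uniform_or_def)
  show "set_pmf (nbrw E t x) \<subseteq> V \<and> finite (set_pmf (nbrw E t x))" if V: "\<And>i. i \<le> t \<Longrightarrow> x i \<in> V"
  proof (cases t)
    case 0
    then show ?thesis using set_uniform_nbr[of "x 0" "{}"] V[of 0] nbrs_V[of "x 0"]
      unfolding nbrw_def by (simp add: e[symmetric])
  next
    case (Suc s)
    then show ?thesis using S[of s] V[of s] V[of t] nbrs_V[of "x t"] deg_fin[of "x t"]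
      unfolding nbrw_def by (auto intro: finite_subset)
  qed
  show "set_pmf (nbrw E t x) \<subseteq> nbrs E (x t)"
    if V: "\<And>i. i \<le> t \<Longrightarrow> x i \<in> V" and a: "\<And>i. i < t \<Longrightarrow> (x i, x (Suc i)) \<in> adj E"
  proof (cases t)
    case 0
    then show ?thesis using set_uniform_nbr(1)[of "x 0" "{}"] V[of 0]
      unfolding nbrw_def by (simp add: e[symmetric])
  next
    case (Suc s)
    have "x s \<in> nbrs E (x t)" using a[of s] Suc nbrs_sym by (auto simp: nbrs_adj[symmetric] simp flip: Image_singleton_iff)
    then show ?thesis using S[of s] V[of t] Suc unfolding nbrw_def by auto
  qed
  show "nbrw E t x = nbrw E t x'" if "\<And>i. i \<le> t \<Longrightarrow> x i = x' i" for x'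
    using that unfolding nbrw_def by (cases t) auto
  show "K1 (win 1 t x) = map_pmf (\<lambda>v. tl (win 1 t x) @ [v]) (nbrw E t x)"
    if w: "win 1 t x \<in> paths V E 1" and t: "1 \<le> t"
  proof -
    obtain s where s: "t = Suc s" using t by (cases t) auto
    have win: "win 1 t x = [x s, x t]" unfolding win_def s by simp
    have a: "(x s, x t) \<in> adj E" using w unfolding win paths_1 by simp
    then have n: "x s \<in> nbrs E (x t)" using nbrs_sym by (auto simp: nbrs_adj)
    have "uniform_or (nbrs E (x t) - {x s}) (uniform_nbr E (x t)) = nbrw E t x"
    \<comment> \<open>At a dead end both rules return to the previous vertex, which is then the only
      neighbour.\<close>
    proof (cases "nbrs E (x t) - {x s} = {}")
      case True
      then have "nbrs E (x t) = {x s}" using n by auto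
      then show ?thesis by (simp add: nbrw_def s uniform_or_def uniform_nbr_def pmf_of_set_singleton)
    next
      case False
      have S: "{z \<in> nbrs E (x t). z \<noteq> x s} = nbrs E (x t) - {x s}" by auto
      have "nbrw E t x = uniform_or {z \<in> nbrs E (x t). z \<noteq> x s} (return_pmf (x s))"
        by (simp add: nbrw_def s)
      then show ?thesis unfolding S using False by (simp only: uniform_or_def if_False)
    qed
    then show ?thesis unfolding path_chain_def win edge_free_1 by simp
  qed
qed

lemma edge_walk:
  assumes "u \<in> V"
  shows "window_walk K1 (paths V E k) V (edge_knbrw E k) u k"
proof (rule window_walkI[OF edge_pchain assms])
  fix t and x :: "nat \<Rightarrow> 'a"
  let ?S = "{z \<in> nbrs E (x t). {z, x t} \<notin> {{x (i - 1), x i} |i. t < i + k \<and> i \<le> t \<and> 1 \<le> i}}"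
  have S: "?S \<subseteq> nbrs E (x t)" by auto
  show "set_pmf (edge_knbrw E k t x) \<subseteq> V \<and> finite (set_pmf (edge_knbrw E k t x))" if "\<And>i. i \<le> t \<Longrightarrow> x i \<in> V"
    unfolding edge_knbrw_def using set_uniform_nbr(1,2)[OF _ S] that[of t] nbrs_V[of "x t"] by blast
  show "set_pmf (edge_knbrw E k t x) \<subseteq> nbrs E (x t)" if "\<And>i. i \<le> t \<Longrightarrow> x i \<in> V" "\<And>i. i < t \<Longrightarrow> (x i, x (Suc i)) \<in> adj E"
    unfolding edge_knbrw_def using set_uniform_nbr(1)[OF _ S] that(1)[of t] by blast
  show "edge_knbrw E k t x = edge_knbrw E k t x'" if "\<And>i. i \<le> t \<Longrightarrow> x i = x' i" for x'
  proof -
    have "{{x (i - 1), x i} |i. t < i + k \<and> i \<le> t \<and> 1 \<le> i} = {{x' (i - 1), x' i} |i. t < i + k \<and> i \<le> t \<and> 1 \<le> i}"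
      using that by (intro Collect_cong ex_cong1) auto
    then show ?thesis unfolding edge_knbrw_def using that[of t] by simp
  qed
  show "K1 (win k t x) = map_pmf (\<lambda>v. tl (win k t x) @ [v]) (edge_knbrw E k t x)"
    if w: "win k t x \<in> paths V E k" and t: "k \<le> t"
  proof -
    have nth: "win k t x ! j = x (t - k + j)" if "j \<le> k" for j
      using that t by (simp add: win_def del: upt_Suc)
    have len: "length (win k t x) = Suc k" using w by (simp add: paths_iff)
    have "path_edges (win k t x) = {{x (i - 1), x i} |i. t < i + k \<and> i \<le> t \<and> 1 \<le> i}"
    proof (intro equalityI subsetI)
      fix e assume "e \<in> path_edges (win k t x)"
      then obtain j where j: "1 \<le> j" "j \<le> k" "e = {win k t x ! (j - 1), win k t x ! j}"
        unfolding path_edges_def len by auto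
      then have "e = {x (t - k + j - 1), x (t - k + j)}" using nth[of j] nth[of "j - 1"] by simp
      then show "e \<in> {{x (i - 1), x i} |i. t < i + k \<and> i \<le> t \<and> 1 \<le> i}"
        using j t by (intro CollectI exI[of _ "t - k + j"]) auto
    next
      fix e assume "e \<in> {{x (i - 1), x i} |i. t < i + k \<and> i \<le> t \<and> 1 \<le> i}"
      then obtain i where i: "t < i + k" "i \<le> t" "1 \<le> i" "e = {x (i - 1), x i}" by auto
      let ?j = "i + k - t"
      have "win k t x ! (?j - 1) = x (i - 1)" "win k t x ! ?j = x i"
        using nth[of ?j] nth[of "?j - 1"] i t by auto
      then show "e \<in> path_edges (win k t x)"
        unfolding path_edges_def len using i t by (intro CollectI exI[of _ ?j]) auto
    qed
    then have "edge_free E (win k t x) = ?S"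
      unfolding edge_free_def last_win by (auto simp: insert_commute)
    then show ?thesis unfolding path_chain_def last_win edge_knbrw_def by simp
  qed
qed

lemma vertex_walk:
  assumes "u \<in> V"
  shows "window_walk (path_chain E (vertex_free E)) (paths V E k) V (vertex_knbrw E k) u k"
proof (rule window_walkI[OF vertex_pchain assms])
  fix t and x :: "nat \<Rightarrow> 'a"
  let ?S = "{z \<in> nbrs E (x t). z \<notin> {x i |i. t \<le> i + k \<and> i \<le> t}}"
  have S: "?S \<subseteq> nbrs E (x t)" by auto
  show "set_pmf (vertex_knbrw E k t x) \<subseteq> V \<and> finite (set_pmf (vertex_knbrw E k t x))" if "\<And>i. i \<le> t \<Longrightarrow> x i \<in> V"
    unfolding vertex_knbrw_def using set_uniform_nbr(1,2)[OF _ S] that[of t] nbrs_V[of "x t"] by blast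
  show "set_pmf (vertex_knbrw E k t x) \<subseteq> nbrs E (x t)" if "\<And>i. i \<le> t \<Longrightarrow> x i \<in> V" "\<And>i. i < t \<Longrightarrow> (x i, x (Suc i)) \<in> adj E"
    unfolding vertex_knbrw_def using set_uniform_nbr(1)[OF _ S] that(1)[of t] by blast
  show "vertex_knbrw E k t x = vertex_knbrw E k t x'" if "\<And>i. i \<le> t \<Longrightarrow> x i = x' i" for x'
  proof -
    have "{x i |i. t \<le> i + k \<and> i \<le> t} = {x' i |i. t \<le> i + k \<and> i \<le> t}"
      using that by (intro Collect_cong ex_cong1) auto
    then show ?thesis unfolding vertex_knbrw_def using that[of t] by simp
  qed
  show "path_chain E (vertex_free E) (win k t x) = map_pmf (\<lambda>v. tl (win k t x) @ [v]) (vertex_knbrw E k t x)"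
  proof -
    have "set (win k t x) = {x i |i. t \<le> i + k \<and> i \<le> t}" unfolding set_win by force
    then have "vertex_free E (win k t x) = ?S" unfolding vertex_free_def last_win by auto
    then show ?thesis unfolding path_chain_def last_win vertex_knbrw_def by simp
  qed
qed

lemma win_self: "\<gamma> \<in> paths V E k \<Longrightarrow> win k k (\<lambda>i. \<gamma> ! i) = \<gamma>"
  using map_nth[of \<gamma>] by (simp add: win_def paths_iff del: upt_Suc)

text \<open>Supplies a history of positive probability whose first full window is a trail: a
  self-avoiding path never reuses an edge, also while the memory is still short.\<close>

lemma valid_edge:
  assumes "\<gamma> \<in> paths_v V E k" "hd \<gamma> = v"
  shows "valid (edge_knbrw E k) v k (\<lambda>i. \<gamma> ! i)"
proof -
  have \<gamma>: "length \<gamma> = Suc k" "set \<gamma> \<subseteq> V" "successively (\<lambda>x y. {x, y} \<in> E) \<gamma>" "distinct \<gamma>"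
    using assms by (auto simp: paths_v_iff paths_iff)
  have "\<gamma> ! Suc i \<in> set_pmf (edge_knbrw E k i (\<lambda>i. \<gamma> ! i))" if i: "i < k" for i
  proof -
    let ?S = "{z \<in> nbrs E (\<gamma> ! i). {z, \<gamma> ! i} \<notin> {{\<gamma> ! (j - 1), \<gamma> ! j} |j. i < j + k \<and> j \<le> i \<and> 1 \<le> j}}"
    have "\<gamma> ! Suc i \<in> nbrs E (\<gamma> ! i)" using \<gamma>(1,3) i by (auto simp: successively_conv_nth nbrs_def)
    moreover have "{\<gamma> ! Suc i, \<gamma> ! i} \<noteq> {\<gamma> ! (j - 1), \<gamma> ! j}" if "j \<le> i" for j
      using \<gamma>(1,4) i that by (auto simp: doubleton_eq_iff nth_eq_iff_index_eq)
    ultimately have "\<gamma> ! Suc i \<in> ?S" by blast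
    moreover have "\<gamma> ! i \<in> V" using \<gamma>(1,2) i by auto
    moreover have "?S \<subseteq> nbrs E (\<gamma> ! i)" by auto
    ultimately show ?thesis unfolding edge_knbrw_def using set_uniform_nbr(3)[of "\<gamma> ! i" ?S] by blast
  qed
  moreover have "\<gamma> ! 0 = v" using \<gamma>(1) assms(2) by (cases \<gamma>) auto
  ultimately show ?thesis by (simp add: valid_def)
qed

lemma valid_vertex:
  assumes "\<gamma> \<in> paths_v V E k" "hd \<gamma> = v"
  shows "valid (vertex_knbrw E k) v k (\<lambda>i. \<gamma> ! i)"
proof -
  have \<gamma>: "length \<gamma> = Suc k" "set \<gamma> \<subseteq> V" "successively (\<lambda>x y. {x, y} \<in> E) \<gamma>" "distinct \<gamma>"
    using assms by (auto simp: paths_v_iff paths_iff)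
  have "\<gamma> ! Suc i \<in> set_pmf (vertex_knbrw E k i (\<lambda>i. \<gamma> ! i))" if i: "i < k" for i
  proof -
    let ?S = "{z \<in> nbrs E (\<gamma> ! i). z \<notin> {\<gamma> ! j |j. i \<le> j + k \<and> j \<le> i}}"
    have "\<gamma> ! Suc i \<in> nbrs E (\<gamma> ! i)" using \<gamma>(1,3) i by (auto simp: successively_conv_nth nbrs_def)
    moreover have "\<gamma> ! Suc i \<noteq> \<gamma> ! j" if "j \<le> i" for j
      using \<gamma>(1,4) i that by (simp add: nth_eq_iff_index_eq)
    ultimately have "\<gamma> ! Suc i \<in> ?S" by blast
    moreover have "\<gamma> ! i \<in> V" using \<gamma>(1,2) i by auto
    moreover have "?S \<subseteq> nbrs E (\<gamma> ! i)" by auto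
    ultimately show ?thesis unfolding vertex_knbrw_def using set_uniform_nbr(3)[of "\<gamma> ! i" ?S] by blast
  qed
  moreover have "\<gamma> ! 0 = v" using \<gamma>(1) assms(2) by (cases \<gamma>) auto
  ultimately show ?thesis by (simp add: valid_def)
qed

subsection \<open>Transience\<close>

text \<open>Transience only denies that infinitely many returns are almost sure. An unbounded Green
  function would make them almost sure, and a bounded one makes the visit probabilities
  summable.\<close>

lemma srw_transient_iff: "transient_walk V (srw E) \<longleftrightarrow> (\<forall>v\<in>V. bounded_green K0 [v])"
proof
  assume t: "transient_walk V (srw E)"
  show "\<forall>v\<in>V. bounded_green K0 [v]"
  proof
    fix v assume v: "v \<in> V"
    interpret W: window_walk K0 "paths V E 0" V "srw E" v 0 by (rule srw_walk[OF v])
    have "\<not> recurrent_vertex V (srw E) v" using t v by (simp add: transient_walk_def)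
    then obtain z where "z \<in> paths V E 0" "v \<in> set z" "bounded_green K0 z"
      using W.recurrent_unbounded by blast
    then show "bounded_green K0 [v]" by (auto simp: paths_0)
  qed
next
  assume b: "\<forall>v\<in>V. bounded_green K0 [v]"
  interpret S: pchain V E \<Delta> 0 "\<lambda>_. {}" "paths V E 0" by (rule srw_pchain)
  show "transient_walk V (srw E)"
    unfolding transient_walk_def recurrent_vertex_def
  proof
    fix v assume v: "v \<in> V"
    interpret W: window_walk K0 "paths V E 0" V "srw E" v 0 by (rule srw_walk[OF v])
    obtain y where y: "valid (srw E) v 0 y" using W.ex_valid by blast
    show "\<not> (AE x in walk_law V (srw E) v. \<exists>\<^sub>\<infinity>t. x t = v)"
      by (rule W.not_recurrentI[OF y order_refl S.summable_last]) (use b W.win_in[OF y] in \<open>auto simp: paths_0\<close>)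
  qed
qed

lemma nbrw_forward:
  assumes "transient_walk V (srw E)"
  shows "transient_walk V (nbrw E)"
proof -
  interpret P: pchain V E \<Delta> 1 "edge_free E" "paths V E 1" by (rule edge_pchain)
  have b: "bounded_green K1 z" if z: "z \<in> paths V E 1" for z
  proof -
    have hz: "hd z \<in> V" using paths_last[OF z] by simp
    obtain C where "srw_ineq (hd z) C"
      using srw_ineqI[OF hz] assms hz unfolding srw_transient_iff by blast
    then show ?thesis by (rule nb_forward[OF z])
  qed
  show ?thesis
    unfolding transient_walk_def recurrent_vertex_def
  proof
    fix v assume v: "v \<in> V"
    interpret W: window_walk K1 "paths V E 1" V "nbrw E" v 1 by (rule nbrw_walk[OF v])
    obtain y where y: "valid (nbrw E) v 1 y" using W.ex_valid by blast
    show "\<not> (AE x in walk_law V (nbrw E) v. \<exists>\<^sub>\<infinity>t. x t = v)"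
      by (rule W.not_recurrentI[OF y order_refl P.summable_last[OF b W.win_in[OF y order_refl]]])
  qed
qed

lemma srw_transientI: "v \<in> V \<Longrightarrow> bounded_green K0 [v] \<Longrightarrow> transient_walk V (srw E)"
  unfolding srw_transient_iff using srw_bounded_all by blast

lemma srw_transient_infinite: "transient_walk V (srw E) \<Longrightarrow> v \<in> V \<Longrightarrow> infinite V"
  unfolding srw_transient_iff using srw_bounded_infinite by blast

text \<open>Finite graphs are excluded since the walk is recurrent on them; on an infinite graph
  short cycles yield nearby vertices of degree at least three.\<close>

lemma nbrw_backward:
  assumes v: "v \<in> V" and R: "\<And>x. x \<in> V \<Longrightarrow> contains_cycle E (graph_ball V E x R)"
    and t: "transient_walk V (nbrw E)"
  shows "transient_walk V (srw E)"
proof -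
  interpret W: window_walk K1 "paths V E 1" V "nbrw E" v 1 by (rule nbrw_walk[OF v])
  have nr: "\<not> recurrent_vertex V (nbrw E) v" using t v by (simp add: transient_walk_def)
  have inf: "infinite V"
  proof
    assume "finite V"
    then show False using W.recurrent_dead[OF edge_dead_finite[OF _ v]] nr by simp
  qed
  obtain z where z: "z \<in> paths V E 1" "bounded_green K1 z" using W.recurrent_unbounded nr by blast
  have "bounded_green K0 [hd z]" by (rule nb_backward[OF inf R z])
  then show ?thesis using srw_transientI paths_last(2)[OF z(1)] by blast
qed

lemma edge_forward:
  assumes k: "k \<ge> 1" and reach: "uniformly_reachable E (edge_free E) (paths_e V E k)"
    and stuck: "cannot_get_stuck (edge_free E) (paths_e V E k)"
    and t: "transient_walk V (srw E)"
  shows "transient_walk V (edge_knbrw E k)"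
  unfolding transient_walk_def recurrent_vertex_def
proof
  fix v assume v: "v \<in> V"
  interpret P: pchain V E \<Delta> k "edge_free E" "paths_e V E k" by (rule edge_pchain_e[OF stuck k])
  interpret W: window_walk K1 "paths V E k" V "edge_knbrw E k" v k by (rule edge_walk[OF v])
  have inf: "infinite V" by (rule srw_transient_infinite[OF t v])
  have b: "bounded_green K1 z" if "z \<in> paths_e V E k" for z
    using edge_bounded[OF inf k reach stuck _ that] t unfolding srw_transient_iff by blast
  obtain \<gamma> where \<gamma>: "\<gamma> \<in> paths_v V E k" "hd \<gamma> = v" using ex_paths_v[OF inf v] by blast
  have w: "win k k (\<lambda>i. \<gamma> ! i) = \<gamma>" using \<gamma>(1) by (intro win_self) (simp add: paths_v_iff)
  have "summable (\<lambda>n. measure (measure_pmf (kn K1 n \<gamma>)) {\<gamma>'. last \<gamma>' = v})"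
    using \<gamma>(1) paths_v_subset_e by (intro P.summable_last[OF b]) auto
  then show "\<not> (AE x in walk_law V (edge_knbrw E k) v. \<exists>\<^sub>\<infinity>t. x t = v)"
    by (intro W.not_recurrentI[OF valid_edge[OF \<gamma>] order_refl]) (simp add: w)
qed

lemma vertex_forward:
  assumes k: "k \<ge> 1" and trans: "vertex_transitive V E"
    and reach: "uniformly_reachable E (vertex_free E) (paths_v V E k)"
    and stuck: "cannot_get_stuck (vertex_free E) (paths_v V E k)"
    and t: "transient_walk V (srw E)"
  shows "transient_walk V (vertex_knbrw E k)"
  unfolding transient_walk_def recurrent_vertex_def
proof
  fix v assume v: "v \<in> V"
  let ?K = "path_chain E (vertex_free E)"
  interpret P: pchain V E \<Delta> k "vertex_free E" "paths_v V E k" by (rule vertex_pchain_v[OF stuck])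
  interpret W: window_walk ?K "paths V E k" V "vertex_knbrw E k" v k by (rule vertex_walk[OF v])
  have inf: "infinite V" by (rule srw_transient_infinite[OF t v])
  have b: "bounded_green ?K z" if "z \<in> paths_v V E k" for z
    using vertex_bounded[OF inf k trans reach stuck _ that] t unfolding srw_transient_iff by blast
  obtain \<gamma> where \<gamma>: "\<gamma> \<in> paths_v V E k" "hd \<gamma> = v" using ex_paths_v[OF inf v] by blast
  have w: "win k k (\<lambda>i. \<gamma> ! i) = \<gamma>" using \<gamma>(1) by (intro win_self) (simp add: paths_v_iff)
  have "summable (\<lambda>n. measure (measure_pmf (kn ?K n \<gamma>)) {\<gamma>'. last \<gamma>' = v})"
    using \<gamma>(1) by (intro P.summable_last[OF b])
  then show "\<not> (AE x in walk_law V (vertex_knbrw E k) v. \<exists>\<^sub>\<infinity>t. x t = v)"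
    by (intro W.not_recurrentI[OF valid_vertex[OF \<gamma>] order_refl]) (simp add: w)
qed

text \<open>If the Green function at a self-avoiding path \<sigma> through \<open>v\<close> were
  unbounded, \<sigma> would be hit almost surely from every trail, hence \<open>v\<close> from every
  window. This contradicts transience without any control of the first steps.\<close>

lemma edge_transient_backward:
  assumes v: "v \<in> V" and k: "k \<ge> 1" and reach: "uniformly_reachable E (edge_free E) (paths_e V E k)"
    and stuck: "cannot_get_stuck (edge_free E) (paths_e V E k)"
    and t: "transient_walk V (edge_knbrw E k)"
  shows "transient_walk V (srw E)"
proof -
  interpret P: pchain V E \<Delta> k "edge_free E" "paths_e V E k" by (rule edge_pchain_e[OF stuck k])
  interpret W: window_walk K1 "paths V E k" V "edge_knbrw E k" v k by (rule edge_walk[OF v])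
  have nr: "\<not> recurrent_vertex V (edge_knbrw E k) v" using t v by (simp add: transient_walk_def)
  have inf: "infinite V"
  proof
    assume "finite V"
    then show False using W.recurrent_dead[OF edge_dead_finite[OF _ v]] nr by simp
  qed
  obtain N where N: "\<And>\<gamma> \<gamma>'. \<gamma> \<in> paths_e V E k \<Longrightarrow> \<gamma>' \<in> paths_e V E k \<Longrightarrow> set \<gamma> \<inter> set \<gamma>' \<noteq> {} \<Longrightarrow>
      (\<gamma>, \<gamma>') \<in> (\<Union>n\<le>N. P.T ^^ n)"
    using P.reach_of_uniform[OF reach] by blast
  obtain \<sigma> where \<sigma>: "\<sigma> \<in> paths_v V E k" "hd \<sigma> = v" using ex_paths_v[OF inf v] by blast
  have \<sigma>e: "\<sigma> \<in> paths_e V E k" using \<sigma>(1) paths_v_subset_e by blast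
  have v\<sigma>: "v \<in> set \<sigma>" using \<sigma> paths_ne[of \<sigma> k] hd_in_set[of \<sigma>] by (auto simp: paths_v_iff)
  have "bounded_green K1 \<sigma>"
  proof (rule ccontr)
    assume unb: "\<not> bounded_green K1 \<sigma>"
    have "dead K1 {\<gamma>. v \<in> set \<gamma>} \<gamma>" if \<gamma>: "\<gamma> \<in> paths_e V E k" for \<gamma>
    proof -
      have "(\<sigma>, \<gamma>) \<in> P.T\<^sup>*" by (rule P.irreducible[OF inf k paths_v_subset_e N \<sigma>e \<gamma>])
      then have "dead K1 {\<sigma>} \<gamma>" by (rule P.dead_reach[OF \<sigma>e unb])
      then show ?thesis by (rule P.dead_mono[OF _ _ \<gamma>]) (use v\<sigma> in simp)
    qed
    then have "dead K1 {\<gamma>. v \<in> set \<gamma>} \<eta>" if "\<eta> \<in> paths V E k" for \<eta>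
      by (rule edge_dead_infinite[OF inf k that])
    from W.recurrent_dead[OF this] show False using nr by simp
  qed
  then have "bounded_green K0 [hd \<sigma>]" by (rule edge_backward[OF k reach stuck \<sigma>e])
  then show ?thesis using srw_transientI v \<sigma>(2) by blast
qed

end

theorem theorem1:
  fixes V :: "'a set" and E :: "'a set set" and k :: nat
  assumes "simple_graph V E" and "connected_graph V E" and "bounded_degree V E" and "k \<ge> 1"
  shows
    "(transient_walk V (srw E) \<longrightarrow> transient_walk V (nbrw E)) \<and>
     ((\<exists>R>0. \<forall>x\<in>V. contains_cycle E (graph_ball V E x R)) \<longrightarrow>
        (transient_walk V (srw E) \<longleftrightarrow> transient_walk V (nbrw E))) \<and>
     (uniformly_reachable E (edge_free E) (paths_e V E k) \<and>
      cannot_get_stuck (edge_free E) (paths_e V E k) \<longrightarrow>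
        (transient_walk V (srw E) \<longleftrightarrow> transient_walk V (edge_knbrw E k))) \<and>
     (vertex_transitive V E \<and>
      uniformly_reachable E (vertex_free E) (paths_v V E k) \<and>
      cannot_get_stuck (vertex_free E) (paths_v V E k) \<longrightarrow>
        transient_walk V (srw E) \<longrightarrow> transient_walk V (vertex_knbrw E k))"
proof -
  \<comment> \<open>The case of an isolated vertex is the one-vertex graph, where the walks stay put
    and are recurrent; it is separated because \<open>bgraph\<close> requires neighbours.\<close>
  consider (empty) "V = {}" | (isolated) v where "v \<in> V" "nbrs E v = {}"
    | (regular) v where "v \<in> V" "\<And>w. w \<in> V \<Longrightarrow> nbrs E w \<noteq> {}" by blast
  then show ?thesis
  proof cases
    case empty
    then show ?thesis by (simp add: transient_walk_def)
  next
    case (isolated v)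
    have only: "w = v" if w: "w \<in> V" for w
    proof -
      obtain n \<gamma> where \<gamma>: "\<gamma> \<in> paths V E n" "hd \<gamma> = v" "last \<gamma> = w"
        using assms(2) isolated(1) w unfolding connected_graph_def by blast
      show ?thesis
      proof (cases n)
        case 0
        then show ?thesis using \<gamma> by (auto simp: paths_iff length_Suc_conv)
      next
        case (Suc m)
        then obtain y \<beta> where "\<gamma> = v # y # \<beta>" using \<gamma> by (auto simp: paths_iff length_Suc_conv)
        then have "y \<in> nbrs E v" using \<gamma>(1) by (auto simp: paths_iff nbrs_def)
        then show ?thesis using isolated(2) by simp
      qed
    qed
    have "V \<subseteq> {v}" by (rule subsetI) (use only in blast)
    then have V: "V = {v}" using isolated(1) by blast
    have u: "uniform_nbr E v = return_pmf v" using isolated(2) by (simp add: uniform_nbr_def uniform_or_def)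
    have "recurrent_vertex {v} (srw E) v"
      by (rule recurrent_one_vertex) (simp add: srw_def u)
    moreover have "recurrent_vertex {v} (nbrw E) v"
      by (rule recurrent_one_vertex) (auto simp: nbrw_def u isolated(2) uniform_or_def split: nat.splits)
    moreover have "recurrent_vertex {v} (edge_knbrw E k) v"
      by (rule recurrent_one_vertex) (simp add: edge_knbrw_def u isolated(2) uniform_or_def)
    ultimately show ?thesis by (simp add: transient_walk_def V)
  next
    case (regular v)
    obtain \<Delta> where \<Delta>: "\<And>w. w \<in> V \<Longrightarrow> card (nbrs E w) \<le> \<Delta>"
      using assms(3) by (auto simp: bounded_degree_def bdd_above_def)
    interpret bgraph V E \<Delta>
      by standard (use assms \<Delta> regular(2) in \<open>auto simp: bounded_degree_def\<close>)
    show ?thesis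
      using nbrw_forward nbrw_backward[OF regular(1)] edge_forward[OF assms(4)]
        edge_transient_backward[OF regular(1) assms(4)] vertex_forward[OF assms(4)] by blast
  qed
qed

end
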